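(* Let $(\mathbf{T}_n,\mu_n)_{n\in\mathbb{N}}$ be a QF-convergent sequence of finite weighted colored tree-semilattices (all with the same finite set of color predicates $M_1,\dots,M_k$). Then there exists a Borel colored tree-semilattice $(\hat{\mathbf{T}},\hat{\mu})$, equipped with a Borel probability measure $\hat\mu$, which is a QF-limit of the sequence, i.e. $\lim_{n\to\infty}\langle\phi,(\mathbf{T}_n,\mu_n)\rangle=\langle\phi,(\hat{\mathbf T},\hat\mu)\rangle$ for every quantifier-free formula $\phi$.
   Context: A tree-semilattice is a structure $\mathbf{T}=(T,\wedge)$ where $\wedge$ is a binary operation that is idempotent, commutative and associative (a meet semilattice), and such that for all $x,y,z\in T$, if $x\wedge z=x$ and $y\wedge z=y$ then $x\wedge y\in\{x,y\}$. It defines a partial order by $x\le y$ iff $x\wedge y=x$. A colored tree-semilattice additionally carries finitely many unary relations $M_1,\dots,M_k$. A Borel (colored) tree-semilattice is one whose domain $T$ is a standard Borel space, with $\wedge:T\times T\to T$ Borel (and the $M_i$ Borel sets); finite tree-semilattices are Borel. A weighted tree-semilattice is one equipped with a (Borel) probability measure $\mu$ on $T$. For a quantifier-free formula $\phi$ (in the language of $\wedge$, equality and the $M_i$) with $p$ free variables, let $\phi(\mathbf T)=\{(v_1,\dots,v_p)\in T^p:\mathbf T\models\phi(v_1,\dots,v_p)\}$ and $\langle\phi,(\mathbf T,\mu)\rangle=\mu^{\otimes p}(\phi(\mathbf T))$. A sequence $(\mathbf T_n,\mu_n)$ is QF-convergent if $\langle\phi,(\mathbf T_n,\mu_n)\rangle$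 converges for every quantifier-free formula $\phi$. *)

theory Defs
  imports "HOL-Probability.Probability"
begin

section \<open>Colored tree-semilattices\<close>

text \<open>Only the colors with index below the number \<open>k\<close> of color predicates are meaningful.\<close>

record 'a colored_structure =
  domain_of :: "'a set"
  meet :: "'a \<Rightarrow> 'a \<Rightarrow> 'a"
  color :: "nat \<Rightarrow> 'a set"

locale tree_semilattice =
  fixes T :: "'a set" and m :: "'a \<Rightarrow> 'a \<Rightarrow> 'a"
  assumes closed: "\<lbrakk>x \<in> T; y \<in> T\<rbrakk> \<Longrightarrow> m x y \<in> T"
    and idem: "x \<in> T \<Longrightarrow> m x x = x"
    and comm: "\<lbrakk>x \<in> T; y \<in> T\<rbrakk> \<Longrightarrow> m x y = m y x"
    and assoc: "\<lbrakk>x \<in> T; y \<in> T; z \<in> T\<rbrakk> \<Longrightarrow> m (m x y) z = m x (m y z)"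
    and tree: "\<lbrakk>x \<in> T; y \<in> T; z \<in> T; m x z = x; m y z = y\<rbrakk> \<Longrightarrow> m x y \<in> {x, y}"

definition colored_tree_semilattice :: "nat \<Rightarrow> 'a colored_structure \<Rightarrow> bool" where
  "colored_tree_semilattice k S \<longleftrightarrow>
     tree_semilattice (domain_of S) (meet S) \<and> (\<forall>i<k. color S i \<subseteq> domain_of S)"


section \<open>Borel and finite weighted structures\<close>

text \<open>The Polish topology is arbitrary; it need not be related to any topology that the type \<open>'a\<close>
  may carry. As a standard Borel space has at most continuum many points, every such space has an
  isomorphic copy, in this sense, on a set of real numbers.\<close>

definition standard_borel :: "'a measure \<Rightarrow> bool" where
  "standard_borel M \<longleftrightarrow>
     (\<exists>X. completely_metrizable_space X \<and> second_countable X \<and> topspace X = space M \<and>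
          sets M = sigma_sets (topspace X) {U. openin X U})"

text \<open>The \<open>\<sigma>\<close>-algebra on the domain is the one carried by the measure.\<close>

definition borel_weighted_tree_semilattice ::
    "nat \<Rightarrow> 'a colored_structure \<Rightarrow> 'a measure \<Rightarrow> bool" where
  "borel_weighted_tree_semilattice k S \<mu> \<longleftrightarrow>
     colored_tree_semilattice k S \<and> space \<mu> = domain_of S \<and> standard_borel \<mu> \<and>
     (\<lambda>(x, y). meet S x y) \<in> measurable (\<mu> \<Otimes>\<^sub>M \<mu>) \<mu> \<and>
     (\<forall>i<k. color S i \<in> sets \<mu>) \<and> prob_space \<mu>"

definition finite_weighted_tree_semilattice ::
    "nat \<Rightarrow> 'a colored_structure \<Rightarrow> 'a measure \<Rightarrow> bool" where
  "finite_weighted_tree_semilattice k S \<mu> \<longleftrightarrow>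
     colored_tree_semilattice k S \<and> finite (domain_of S) \<and> space \<mu> = domain_of S \<and>
     sets \<mu> = Pow (domain_of S) \<and> prob_space \<mu>"


section \<open>Quantifier-free formulas\<close>

datatype qf_term = Var nat | Meet qf_term qf_term

datatype qf_formula =
    Falsum
  | Eq qf_term qf_term
  | Color nat qf_term
  | Neg qf_formula
  | Conj qf_formula qf_formula
  | Disj qf_formula qf_formula

text \<open>Well-formedness: variables among the first \<open>p\<close> ones, colors among the first \<open>k\<close> ones.\<close>

primrec wf_term :: "nat \<Rightarrow> qf_term \<Rightarrow> bool" where
  "wf_term p (Var i) \<longleftrightarrow> i < p"
| "wf_term p (Meet s t) \<longleftrightarrow> wf_term p s \<and> wf_term p t"

primrec wf_formula :: "nat \<Rightarrow> nat \<Rightarrow> qf_formula \<Rightarrow> bool" where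
  "wf_formula k p Falsum \<longleftrightarrow> True"
| "wf_formula k p (Eq s t) \<longleftrightarrow> wf_term p s \<and> wf_term p t"
| "wf_formula k p (Color i t) \<longleftrightarrow> i < k \<and> wf_term p t"
| "wf_formula k p (Neg \<phi>) \<longleftrightarrow> wf_formula k p \<phi>"
| "wf_formula k p (Conj \<phi> \<psi>) \<longleftrightarrow> wf_formula k p \<phi> \<and> wf_formula k p \<psi>"
| "wf_formula k p (Disj \<phi> \<psi>) \<longleftrightarrow> wf_formula k p \<phi> \<and> wf_formula k p \<psi>"

primrec eval_term :: "'a colored_structure \<Rightarrow> (nat \<Rightarrow> 'a) \<Rightarrow> qf_term \<Rightarrow> 'a" where
  "eval_term S v (Var i) = v i"
| "eval_term S v (Meet s t) = meet S (eval_term S v s) (eval_term S v t)"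

primrec sat :: "'a colored_structure \<Rightarrow> (nat \<Rightarrow> 'a) \<Rightarrow> qf_formula \<Rightarrow> bool" where
  "sat S v Falsum \<longleftrightarrow> False"
| "sat S v (Eq s t) \<longleftrightarrow> eval_term S v s = eval_term S v t"
| "sat S v (Color i t) \<longleftrightarrow> eval_term S v t \<in> color S i"
| "sat S v (Neg \<phi>) \<longleftrightarrow> \<not> sat S v \<phi>"
| "sat S v (Conj \<phi> \<psi>) \<longleftrightarrow> sat S v \<phi> \<and> sat S v \<psi>"
| "sat S v (Disj \<phi> \<psi>) \<longleftrightarrow> sat S v \<phi> \<or> sat S v \<psi>"

definition solutions :: "nat \<Rightarrow> qf_formula \<Rightarrow> 'a colored_structure \<Rightarrow> (nat \<Rightarrow> 'a) set" where
  "solutions p \<phi> S = {v \<in> {..<p} \<rightarrow>\<^sub>E domain_of S. sat S v \<phi>}"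

definition pairing ::
    "nat \<Rightarrow> qf_formula \<Rightarrow> 'a colored_structure \<Rightarrow> 'a measure \<Rightarrow> real" where
  "pairing p \<phi> S \<mu> = measure (PiM {..<p} (\<lambda>_. \<mu>)) (solutions p \<phi> S)"


section \<open>Convergence and limits\<close>

definition QF_convergent ::
    "nat \<Rightarrow> (nat \<Rightarrow> 'a colored_structure) \<Rightarrow> (nat \<Rightarrow> 'a measure) \<Rightarrow> bool" where
  "QF_convergent k T \<mu> \<longleftrightarrow>
     (\<forall>p \<phi>. wf_formula k p \<phi> \<longrightarrow> convergent (\<lambda>n. pairing p \<phi> (T n) (\<mu> n)))"

definition QF_limit ::
    "nat \<Rightarrow> (nat \<Rightarrow> 'a colored_structure) \<Rightarrow> (nat \<Rightarrow> 'a measure) \<Rightarrow>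
     'b colored_structure \<Rightarrow> 'b measure \<Rightarrow> bool" where
  "QF_limit k T \<mu> S \<nu> \<longleftrightarrow>
     (\<forall>p \<phi>. wf_formula k p \<phi> \<longrightarrow>
        (\<lambda>n. pairing p \<phi> (T n) (\<mu> n)) \<longlonglongrightarrow> pairing p \<phi> S \<nu>)"

end

theory Submission
  imports Defs
begin

text \<open>In every finite weighted tree one finds, for each \<open>\<epsilon>\<close>, a number of points bounded in terms of
  \<open>\<epsilon>\<close> only such that for each \<open>x\<close> all but an \<open>\<epsilon>\<close>-fraction of the points are separated from \<open>x\<close>
  by one of them. Along a subsequence, the position of a random point relative to the countably
  many points generated by all these separators converges in law to a random type. A separated pair
  has its meet determined by the types of its two points, so the types of a tuple determine its
  quantifier-free properties with high probability. The limit tree consists of the chains \<open>I\<close> of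
  separators that can lie below a point, together with extra coordinates for colors and for
  distinguishing different points above the same chain. A chain without maximum is almost surely
  below at most one sample, whereas samples above the same chain with maximum \<open>t\<close> meet at \<open>t\<close>;
  hence pairs of samples of the limit tree are almost surely separated as well.\<close>


section \<open>Separators in finite trees\<close>

text \<open>If \<open>b\<close> separates \<open>x\<close> from \<open>y\<close> and lies below
  \<open>y\<close>, then \<open>m x y = m x b\<close>: the meet of two random points becomes the
  meet of one of them with a fixed point, a statement about a single random point. This lets the law
  of one type control all tuples, since the types of independent points have a product law. The
  bound for separators is asked for every \<open>x\<close>, not merely on average: a class of
  pairwise inseparable points then lies in the exceptional set of any of its members and is small.
  This is what makes unwanted types null. The obstacle is that meets with separators may fall into
  gaps of the countable skeleton, where no term names them, although their colors are visible to
  formulas; the limit needs extra points there. Moreover, many distinct points can share one type,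
  so a type alone cannot be a point of the limit: a uniform random number is sampled together with
  it. The subsequence only serves to build the limit object. The densities of formulas converge
  along the full sequence by assumption, so their limits can be identified along any
  subsequence.\<close>

definition tle :: "('a \<Rightarrow> 'a \<Rightarrow> 'a) \<Rightarrow> 'a \<Rightarrow> 'a \<Rightarrow> bool" where
  "tle m x y \<longleftrightarrow> m x y = x"

definition separated :: "('a \<Rightarrow> 'a \<Rightarrow> 'a) \<Rightarrow> 'a set \<Rightarrow> 'a \<Rightarrow> 'a \<Rightarrow> bool" where
  "separated m B x y \<longleftrightarrow> (\<exists>b\<in>B. tle m (m x y) b \<and> (tle m b x \<or> tle m b y))"

lemma separated_mono: "separated m B x y \<Longrightarrow> B \<subseteq> C \<Longrightarrow> separated m C x y"
  unfolding separated_def by blast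

context tree_semilattice
begin

abbreviation le (infix "\<sqsubseteq>" 50) where "x \<sqsubseteq> y \<equiv> tle m x y"

lemma le_refl: "x \<in> T \<Longrightarrow> x \<sqsubseteq> x"
  by (simp add: tle_def idem)

lemma le_trans: "x \<sqsubseteq> y \<Longrightarrow> y \<sqsubseteq> z \<Longrightarrow> x \<in> T \<Longrightarrow> y \<in> T \<Longrightarrow> z \<in> T \<Longrightarrow> x \<sqsubseteq> z"
  unfolding tle_def by (metis assoc)

lemma le_antisym: "x \<sqsubseteq> y \<Longrightarrow> y \<sqsubseteq> x \<Longrightarrow> x \<in> T \<Longrightarrow> y \<in> T \<Longrightarrow> x = y"
  unfolding tle_def by (metis comm)

lemma meet_le1: "x \<in> T \<Longrightarrow> y \<in> T \<Longrightarrow> m x y \<sqsubseteq> x"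
  unfolding tle_def by (metis assoc comm idem)

lemma meet_le2: "x \<in> T \<Longrightarrow> y \<in> T \<Longrightarrow> m x y \<sqsubseteq> y"
  unfolding tle_def by (metis assoc idem)

lemma le_meet_iff:
  assumes "x \<in> T" "y \<in> T" "z \<in> T"
  shows "z \<sqsubseteq> m x y \<longleftrightarrow> z \<sqsubseteq> x \<and> z \<sqsubseteq> y"
proof
  assume "z \<sqsubseteq> m x y"
  then show "z \<sqsubseteq> x \<and> z \<sqsubseteq> y"
    using le_trans[of z "m x y" x] le_trans[of z "m x y" y] meet_le1 meet_le2 closed assms by simp
next
  assume "z \<sqsubseteq> x \<and> z \<sqsubseteq> y"
  then show "z \<sqsubseteq> m x y"
    using assoc[of z x y] assms by (simp add: tle_def)
qed

lemma le_meetI: "z \<sqsubseteq> x \<Longrightarrow> z \<sqsubseteq> y \<Longrightarrow> x \<in> T \<Longrightarrow> y \<in> T \<Longrightarrow> z \<in> T \<Longrightarrow> z \<sqsubseteq> m x y"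
  by (simp add: le_meet_iff)

lemma le_meetD:
  assumes "z \<sqsubseteq> m x y" "x \<in> T" "y \<in> T" "z \<in> T"
  shows "z \<sqsubseteq> x" "z \<sqsubseteq> y"
  using assms by (simp_all add: le_meet_iff)

lemma le_linear: "x \<sqsubseteq> z \<Longrightarrow> y \<sqsubseteq> z \<Longrightarrow> x \<in> T \<Longrightarrow> y \<in> T \<Longrightarrow> z \<in> T \<Longrightarrow> x \<sqsubseteq> y \<or> y \<sqsubseteq> x"
  unfolding tle_def by (metis comm tree insert_iff empty_iff)

lemma separated_sym:
  assumes "x \<in> T" "y \<in> T"
  shows "separated m B x y \<longleftrightarrow> separated m B y x"
  using comm[OF assms] unfolding separated_def by auto

text \<open>Both \<open>b\<close> and \<open>m x y\<close> lie below \<open>x\<close>, hence are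
  comparable, and \<open>m x y\<close> below \<open>b\<close> would make \<open>b\<close> a
  separator. So an inseparable pair branches strictly above each member of \<open>B\<close> below
  one of its points.\<close>

lemma not_separated_le:
  assumes "\<not> separated m B x y" "x \<in> T" "y \<in> T" "b \<in> B" "b \<in> T" "b \<sqsubseteq> x"
  shows "b \<sqsubseteq> m x y" "b \<noteq> m x y"
proof -
  have "\<not> m x y \<sqsubseteq> b"
    using assms by (auto simp: separated_def)
  then show "b \<sqsubseteq> m x y" "b \<noteq> m x y"
    using le_linear[of "m x y" x b] meet_le1 le_refl assms closed by auto
qed

text \<open>All meets with \<open>x\<close> lie on the chain below \<open>x\<close>, so finitely
  many of them have a least one.\<close>

lemma ex_min_meet:
  assumes "finite E" "E \<noteq> {}" "E \<subseteq> T" "x \<in> T"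
  shows "\<exists>e\<in>E. \<forall>e'\<in>E. m x e \<sqsubseteq> m x e'"
  using assms(1-3)
proof (induction rule: finite_ne_induct)
  case (singleton e)
  then show ?case using le_refl closed assms(4) by auto
next
  case (insert e E)
  then obtain d where d: "d \<in> E" "\<forall>e'\<in>E. m x d \<sqsubseteq> m x e'" by auto
  have T: "e \<in> T" "d \<in> T" "E \<subseteq> T" using insert d by auto
  consider "m x d \<sqsubseteq> m x e" | "m x e \<sqsubseteq> m x d"
    using le_linear[of "m x d" x "m x e"] meet_le1 closed T assms(4) by auto
  then show ?case
  proof cases
    case 1
    then show ?thesis using d by auto
  next
    case 2
    have "m x e \<sqsubseteq> m x e'" if "e' \<in> E" for e'
      using le_trans[OF 2] d that closed T assms(4) by blast
    then show ?thesis using le_refl closed T assms(4) by auto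
  qed
qed

lemma ex_maximal:
  assumes "finite V" "V \<noteq> {}" "V \<subseteq> T"
  shows "\<exists>v\<in>V. \<forall>u\<in>V. v \<sqsubseteq> u \<longrightarrow> u = v"
  using assms
proof (induction rule: finite_ne_induct)
  case (insert e V)
  then obtain v where v: "v \<in> V" "\<forall>u\<in>V. v \<sqsubseteq> u \<longrightarrow> u = v" by auto
  show ?case
  proof (cases "v \<sqsubseteq> e")
    case True
    have "u = e" if "u \<in> V" "e \<sqsubseteq> u" for u
      using le_trans[of v e u] le_antisym[of v e] that True v insert by auto
    then show ?thesis by auto
  qed (use v in auto)
qed auto

text \<open>Greedy choice: pick a maximal \<open>v\<close> such that at least \<open>\<epsilon>\<close> of the mass not yet covered lies
  above \<open>v\<close>, and cover everything above \<open>v\<close>. Since \<open>v\<close> is maximal, each branch at \<open>v\<close> carries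
  less than \<open>\<epsilon>\<close> of this mass, and at most \<open>1/\<epsilon>\<close> picks are possible.\<close>

lemma finite_separator:
  assumes "finite T" "prob_space \<mu>" "space \<mu> = T" "sets \<mu> = Pow T" "real N * \<epsilon> > 1" "\<epsilon> > 0"
  shows "\<exists>B. B \<subseteq> T \<and> finite B \<and> card B \<le> N \<and>
    (\<forall>x\<in>T. measure \<mu> {y\<in>T. \<not> separated m B x y} \<le> \<epsilon>)"
proof -
  interpret prob_space \<mu> by fact
  \<comment> \<open>\<open>R B\<close> is the part not yet covered by the picks in \<open>B\<close>;
    \<open>E B x\<close> is the exceptional set of \<open>x\<close>.\<close>
  define R where "R B = {x\<in>T. \<forall>b\<in>B. \<not> b \<sqsubseteq> x}" for B
  define E where "E B x = {y\<in>T. \<not> separated m B x y}" for B x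
  have meas [simp]: "A \<in> sets \<mu>" if "A \<subseteq> T" for A
    using that assms by auto
  have mono: "measure \<mu> A \<le> measure \<mu> C" if "A \<subseteq> C" "C \<subseteq> T" for A C
    using that by (intro finite_measure_mono) auto
  have E_mono: "E C x \<subseteq> E B x" if "B \<subseteq> C" for B C x
    using separated_mono[OF _ that] by (auto simp: E_def)
  have RT: "R B \<subseteq> T" and ET: "E B x \<subseteq> T" for B x
    by (auto simp: R_def E_def)
  \<comment> \<open>A pick \<open>b\<close> below \<open>y\<close> would, by inseparability, lie
    below \<open>m y x\<close> and hence below the uncovered point \<open>x\<close>.\<close>
  have ER: "E B x \<subseteq> R B" if "x \<in> R B" "B \<subseteq> T" for B x
  proof
    fix y assume y: "y \<in> E B x"
    have "x \<in> T" "y \<in> T" using that y by (auto simp: R_def E_def)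
    moreover have False if "b \<in> B" "b \<sqsubseteq> y" for b
    proof -
      have "b \<in> T" using that \<open>B \<subseteq> T\<close> by auto
      have "\<not> separated m B y x" using y separated_sym[of x y] \<open>x \<in> T\<close> \<open>y \<in> T\<close> by (auto simp: E_def)
      then have "b \<sqsubseteq> m y x"
        using not_separated_le \<open>x \<in> T\<close> \<open>y \<in> T\<close> \<open>b \<in> T\<close> that by blast
      then have "b \<sqsubseteq> x" using le_meet_iff \<open>x \<in> T\<close> \<open>y \<in> T\<close> \<open>b \<in> T\<close> by blast
      then show False using \<open>x \<in> R B\<close> \<open>b \<in> B\<close> by (auto simp: R_def)
    qed
    ultimately show "y \<in> R B" by (auto simp: R_def)
  qed
  \<comment> \<open>The least meet \<open>m x e\<close> lies below every point inseparable from
    \<open>x\<close>, so one upper set of mass less than \<epsilon> contains them all.\<close>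
  have small: "measure \<mu> (E B x) \<le> \<epsilon>"
    if "x \<in> T" "E B x \<subseteq> Q" "Q \<subseteq> T"
      "\<And>y. y \<in> E B x \<Longrightarrow> measure \<mu> {z\<in>Q. m x y \<sqsubseteq> z} < \<epsilon>" for B x Q
  proof (cases "E B x = {}")
    case True
    then show ?thesis using assms by simp
  next
    case False
    obtain e where e: "e \<in> E B x" "\<forall>e'\<in>E B x. m x e \<sqsubseteq> m x e'"
      using ex_min_meet[of "E B x" x] False ET \<open>x \<in> T\<close> assms(1) finite_subset by metis
    have "E B x \<subseteq> {z\<in>Q. m x e \<sqsubseteq> z}"
    proof
      fix z assume "z \<in> E B x"
      then have "m x e \<sqsubseteq> m x z" "z \<in> T" using e ET by auto
      then have "m x e \<sqsubseteq> z"
        using le_meet_iff[of x z "m x e"] closed[of x e] e ET \<open>x \<in> T\<close> by auto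
      then show "z \<in> {z\<in>Q. m x e \<sqsubseteq> z}" using \<open>z \<in> E B x\<close> that by auto
    qed
    then have "measure \<mu> (E B x) \<le> measure \<mu> {z\<in>Q. m x e \<sqsubseteq> z}"
      using \<open>Q \<subseteq> T\<close> by (intro mono) auto
    then show ?thesis using that(4)[OF e(1)] by simp
  qed
  \<comment> \<open>Invariant: covered points are already settled, and unless all points are, each
    pick has removed mass at least \<epsilon> from the uncovered part.\<close>
  have step: "\<exists>B. B \<subseteq> T \<and> finite B \<and> card B \<le> i \<and> (\<forall>x\<in>T - R B. measure \<mu> (E B x) \<le> \<epsilon>) \<and>
      ((\<forall>x\<in>T. measure \<mu> (E B x) \<le> \<epsilon>) \<or> measure \<mu> (R B) \<le> 1 - i * \<epsilon>)" for i :: nat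
  proof (induction i)
    case 0
    show ?case
      by (rule exI[of _ "{}"]) (auto simp: R_def)
  next
    case (Suc i)
    then obtain B where B: "B \<subseteq> T" "finite B" "card B \<le> i" "\<forall>x\<in>T - R B. measure \<mu> (E B x) \<le> \<epsilon>"
      and dis: "(\<forall>x\<in>T. measure \<mu> (E B x) \<le> \<epsilon>) \<or> measure \<mu> (R B) \<le> 1 - i * \<epsilon>" by blast
    show ?case
    proof (cases "\<forall>x\<in>T. measure \<mu> (E B x) \<le> \<epsilon>")
      case True
      then show ?thesis using B by (intro exI[of _ B]) auto
    next
      case nall: False
      define V where "V = {v\<in>T. measure \<mu> {z\<in>R B. v \<sqsubseteq> z} \<ge> \<epsilon>}"
      \<comment> \<open>If no upper set were heavy, \<open>small\<close> would settle the uncovered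
        points too.\<close>
      have "V \<noteq> {}"
      proof
        assume "V = {}"
        have "measure \<mu> (E B x) \<le> \<epsilon>" if "x \<in> R B" for x
        proof (rule small[of x B "R B"])
          show "x \<in> T" using that RT by auto
          fix y assume "y \<in> E B x"
          then have "m x y \<in> T" using closed ET RT that by blast
          then show "measure \<mu> {z\<in>R B. m x y \<sqsubseteq> z} < \<epsilon>"
            using \<open>V = {}\<close> by (auto simp: V_def not_le)
        qed (use ER[OF that B(1)] RT in auto)
        then show False using nall B(4) by auto
      qed
      moreover have "finite V" "V \<subseteq> T" using assms(1) by (auto simp: V_def)
      ultimately obtain v where v: "v \<in> V" "\<forall>u\<in>V. v \<sqsubseteq> u \<longrightarrow> u = v"
        using ex_maximal by blast
      let ?B = "insert v B"
      have vT: "v \<in> T" using v V_def by auto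
      have RB: "R ?B = R B - {z\<in>R B. v \<sqsubseteq> z}" by (auto simp: R_def)
      have "measure \<mu> (R ?B) = measure \<mu> (R B) - measure \<mu> {z\<in>R B. v \<sqsubseteq> z}"
        unfolding RB by (intro finite_measure_Diff meas) (auto simp: R_def)
      moreover have "measure \<mu> {z\<in>R B. v \<sqsubseteq> z} \<ge> \<epsilon>" using v by (auto simp: V_def)
      ultimately have R_le: "measure \<mu> (R ?B) \<le> 1 - Suc i * \<epsilon>"
        using dis nall by (auto simp: algebra_simps)
      have "measure \<mu> (E ?B x) \<le> \<epsilon>" if x: "x \<in> T - R ?B" for x
      proof (cases "x \<in> R B")
        case False
        then have "measure \<mu> (E B x) \<le> \<epsilon>" using B x by auto
        moreover have "measure \<mu> (E ?B x) \<le> measure \<mu> (E B x)"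
          using E_mono[of B ?B] ET by (intro mono) auto
        ultimately show ?thesis by simp
      next
        case True
        have xT: "x \<in> T" using x by auto
        have vx: "v \<sqsubseteq> x" using True x RB by auto
        show ?thesis
        proof (rule small[of x ?B "R B"])
          show "E ?B x \<subseteq> R B" using ER[OF True B(1)] E_mono[of B ?B x] by auto
          fix y assume y: "y \<in> E ?B x"
          then have yT: "y \<in> T" and ns: "\<not> separated m ?B x y" by (auto simp: E_def)
          \<comment> \<open>A newly covered point is inseparable only from points that branch off
            strictly above \<open>v\<close>, where maximality of \<open>v\<close> leaves mass less
            than \<epsilon>.\<close>
          have "v \<sqsubseteq> m x y" "v \<noteq> m x y"
            using not_separated_le[OF ns xT yT _ vT vx] by auto
          then have "m x y \<notin> V" using v by auto
          then show "measure \<mu> {z\<in>R B. m x y \<sqsubseteq> z} < \<epsilon>"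
            using closed[OF xT yT] by (auto simp: V_def)
        qed (use xT RT in auto)
      qed
      moreover have "card ?B \<le> Suc i" using B by (simp add: card_insert_if)
      ultimately show ?thesis using R_le B vT
        by (intro exI[of _ ?B]) auto
    qed
  qed
  obtain B where B: "B \<subseteq> T" "finite B" "card B \<le> N"
    "(\<forall>x\<in>T. measure \<mu> (E B x) \<le> \<epsilon>) \<or> measure \<mu> (R B) \<le> 1 - N * \<epsilon>"
    using step[of N] by blast
  have "\<not> measure \<mu> (R B) \<le> 1 - N * \<epsilon>"
    using measure_nonneg[of \<mu> "R B"] assms(5) by linarith
  then show ?thesis using B unfolding E_def by blast
qed

end

text \<open>Separators for all precisions \<open>1 / (j + 1)\<close> are put into one sequence, so
  that the same countable set of names serves every tree. For precision \<open>j\<close> it takes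
  \<open>j + 2\<close> points, as \<open>(j + 2) / (j + 1) > 1\<close>.\<close>

lemma ex_separator_sequence:
  assumes "tree_semilattice T m" "finite T" "prob_space \<mu>" "space \<mu> = T" "sets \<mu> = Pow T"
  shows "\<exists>y :: nat \<Rightarrow> 'a. range y \<subseteq> T \<and>
    (\<forall>j. \<forall>x\<in>T. measure \<mu> {x'\<in>T. \<not> separated m ((\<lambda>i. y (prod_encode (j, i))) ` {..<j+2}) x x'}
       \<le> 1 / (j + 1))"
proof -
  interpret tree_semilattice T m by fact
  interpret prob_space \<mu> by fact
  have "T \<noteq> {}" using not_empty assms by auto
  then obtain a where a: "a \<in> T" by auto
  have "\<forall>j. \<exists>e :: nat \<Rightarrow> 'a. range e \<subseteq> T \<and>
    (\<forall>x\<in>T. measure \<mu> {x'\<in>T. \<not> separated m (e ` {..<j+2}) x x'} \<le> 1 / real (j + 1))"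
  proof
    fix j :: nat
    obtain B where B: "B \<subseteq> T" "finite B" "card B \<le> j + 2"
        "\<forall>x\<in>T. measure \<mu> {y\<in>T. \<not> separated m B x y} \<le> 1 / (j + 1)"
      using finite_separator[of \<mu> "j+2" "1 / real (j+1)"] assms by (auto simp: divide_simps)
    obtain h where h: "h ` {..<card B} = B"
      using ex_bij_betw_nat_finite[OF B(2)] by (auto simp: bij_betw_def atLeast0LessThan)
    \<comment> \<open>Padding with an arbitrary point gives exactly \<open>j + 2\<close> entries;
      more separators do no harm.\<close>
    define e where "e i = (if i < card B then h i else a)" for i
    have "range e \<subseteq> T" using h B(1) a by (auto simp: e_def)
    have "B \<subseteq> e ` {..<j+2}"
    proof
      fix b assume "b \<in> B"
      then obtain i where "i < card B" "h i = b" by (metis h imageE lessThan_iff)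
      then show "b \<in> e ` {..<j+2}" using B(3) by (intro image_eqI[of _ _ i]) (auto simp: e_def)
    qed
    then have "measure \<mu> {x'\<in>T. \<not> separated m (e ` {..<j+2}) x x'}
        \<le> measure \<mu> {y\<in>T. \<not> separated m B x y}" for x
      using separated_mono[OF _ \<open>B \<subseteq> e ` {..<j+2}\<close>] assms by (intro finite_measure_mono) auto
    then have "\<forall>x\<in>T. measure \<mu> {x'\<in>T. \<not> separated m (e ` {..<j+2}) x x'} \<le> 1 / real (j + 1)"
      using B(4) by (meson order_trans)
    then show "\<exists>e :: nat \<Rightarrow> 'a. range e \<subseteq> T \<and>
      (\<forall>x\<in>T. measure \<mu> {x'\<in>T. \<not> separated m (e ` {..<j+2}) x x'} \<le> 1 / real (j + 1))"
      using \<open>range e \<subseteq> T\<close> by (intro exI[of _ e] conjI)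
  qed
  from choice[OF this] obtain e where e: "\<And>j. range (e j) \<subseteq> T"
      "\<And>j x. x \<in> T \<Longrightarrow> measure \<mu> {x'\<in>T. \<not> separated m (e j ` {..<j+2}) x x'} \<le> 1 / real (j + 1)"
    by blast
  show ?thesis
  proof (intro exI[of _ "\<lambda>n. case prod_decode n of (j, i) \<Rightarrow> e j i"] conjI allI ballI)
    show "range (\<lambda>n. case prod_decode n of (j, i) \<Rightarrow> e j i) \<subseteq> T"
      using e(1) by (force split: prod.splits)
  qed (use e(2) in \<open>simp add: add.commute\<close>)
qed


section \<open>Limits of bit distributions\<close>

text \<open>Ternary digits 0 and 2 instead of a binary expansion: the gaps of the Cantor set make
  every digit a continuous function of the code, as weak convergence requires.\<close>

definition cantor_code :: "(nat \<Rightarrow> bool) \<Rightarrow> real" where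
  "cantor_code b = (\<Sum>i. 2 * of_bool (b i) / 3 ^ Suc i)"

text \<open>Constant on the outer thirds of the unit interval, where the codes lie, and linear
  across the gap between them.\<close>

definition cantor_digit :: "real \<Rightarrow> real" where
  "cantor_digit x = max 0 (min 1 (3 * x - 1))"

definition cantor_shift :: "real \<Rightarrow> real" where
  "cantor_shift x = 3 * x - 2 * cantor_digit x"

lemma summable_cantor_code: "summable (\<lambda>i. 2 * of_bool (b i) / 3 ^ Suc i :: real)"
proof (rule summable_comparison_test')
  show "summable (\<lambda>i. 2 / 3 * (1 / 3) ^ i :: real)"
    by (intro summable_mult summable_geometric) simp
  show "\<And>i. i \<ge> 0 \<Longrightarrow> norm (2 * of_bool (b i) / 3 ^ Suc i :: real) \<le> 2 / 3 * (1 / 3) ^ i"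
    by (simp add: power_one_over field_simps)
qed

lemma cantor_code_ge_0: "0 \<le> cantor_code b"
  unfolding cantor_code_def by (rule suminf_nonneg[OF summable_cantor_code]) simp

lemma cantor_code_le_1: "cantor_code b \<le> 1"
proof -
  have "(\<lambda>i. 2 / 3 * (1 / 3) ^ i :: real) sums (2 / 3 * (1 / (1 - 1 / 3)))"
    by (intro sums_mult geometric_sums) simp
  then have "(\<Sum>i. 2 * of_bool (b i) / 3 ^ Suc i) \<le> (2 / 3 * (1 / (1 - 1 / 3)) :: real)"
    by (intro sums_le[OF _ summable_sums[OF summable_cantor_code]])
      (auto simp: power_one_over field_simps)
  then show ?thesis by (simp add: cantor_code_def)
qed

lemma cantor_code_rec: "cantor_code b = (2 * of_bool (b 0) + cantor_code (\<lambda>i. b (Suc i))) / 3"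
proof -
  have "cantor_code b = 2 * of_bool (b 0) / 3 + (\<Sum>i. 2 * of_bool (b (Suc i)) / 3 ^ Suc i / 3)"
    using suminf_split_head[OF summable_cantor_code, of b]
    by (simp add: cantor_code_def field_simps)
  also have "(\<Sum>i. 2 * of_bool (b (Suc i)) / 3 ^ Suc i / 3) = cantor_code (\<lambda>i. b (Suc i)) / 3"
    unfolding cantor_code_def by (rule suminf_divide[OF summable_cantor_code])
  finally show ?thesis by simp
qed

lemma cantor_digit_code: "cantor_digit (cantor_code b) = of_bool (b 0)"
  using cantor_code_ge_0[of "\<lambda>i. b (Suc i)"] cantor_code_le_1[of "\<lambda>i. b (Suc i)"]
  by (auto simp: cantor_digit_def cantor_code_rec[of b])

lemma cantor_shift_code: "cantor_shift (cantor_code b) = cantor_code (\<lambda>i. b (Suc i))"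
  unfolding cantor_shift_def cantor_digit_code by (simp add: cantor_code_rec[of b] field_simps)

lemma cantor_digit_shift_code: "cantor_digit ((cantor_shift ^^ i) (cantor_code b)) = of_bool (b i)"
proof (induction i arbitrary: b)
  case (Suc i)
  then show ?case by (simp add: funpow_Suc_right cantor_shift_code del: funpow.simps)
qed (simp add: cantor_digit_code)

lemma continuous_cantor_digit_shift: "isCont (\<lambda>x. cantor_digit ((cantor_shift ^^ i) x)) x"
proof -
  have d: "continuous_on UNIV cantor_digit"
    unfolding cantor_digit_def by (intro continuous_intros)
  have s: "continuous_on UNIV cantor_shift"
    unfolding cantor_shift_def by (intro continuous_intros d)
  have "continuous_on UNIV (cantor_shift ^^ i)"
  proof (induction i)
    case (Suc i)
    then show ?case
      using continuous_on_compose[OF Suc continuous_on_subset[OF s subset_UNIV]] by simp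
  qed (simp add: id_def)
  then have "continuous_on UNIV (cantor_digit \<circ> (cantor_shift ^^ i))"
    by (intro continuous_on_compose continuous_on_subset[OF d]) auto
  then show ?thesis by (simp add: continuous_on_eq_continuous_at o_def)
qed

lemma cantor_digit_bounds: "0 \<le> cantor_digit x" "cantor_digit x \<le> 1"
  by (auto simp: cantor_digit_def)

lemma sets_bit_pattern:
  fixes s :: "'i \<Rightarrow> bool"
  assumes "finite F"
  shows "{q. \<forall>i\<in>F. q i = s i} \<in> sets (PiM UNIV (\<lambda>_ :: 'i. count_space UNIV))"
proof -
  have "{q \<in> space (PiM UNIV (\<lambda>_ :: 'i. count_space (UNIV :: bool set))). \<forall>i\<in>F. q i = s i}
      \<in> sets (PiM UNIV (\<lambda>_ :: 'i. count_space UNIV))"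
    using assms by measurable
  then show ?thesis by (simp add: space_PiM)
qed

text \<open>The bits of \<open>x\<close> are read off from its Cantor code by continuous functions, so weak limits
  of the code distributions (Helly's theorem) yield the limit distribution of the bits.\<close>

lemma ex_limit_bit_distribution:
  fixes M :: "nat \<Rightarrow> 'a measure" and b :: "nat \<Rightarrow> 'a \<Rightarrow> 'i :: countable \<Rightarrow> bool"
  assumes prob: "\<And>n. prob_space (M n)" and sets: "\<And>n. sets (M n) = Pow (space (M n))"
  obtains r \<rho> where "strict_mono (r :: nat \<Rightarrow> nat)" "prob_space \<rho>"
    "sets \<rho> = sets (PiM UNIV (\<lambda>_ :: 'i. count_space UNIV))"
    "\<And>F s. finite F \<Longrightarrow> (\<lambda>n. measure (M (r n)) {x \<in> space (M (r n)). \<forall>i\<in>F. b (r n) x i = s i})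
       \<longlonglongrightarrow> measure \<rho> {q \<in> space \<rho>. \<forall>i\<in>F. q i = s i}"
proof -
  \<comment> \<open>The existential quantifier makes the digit false at positions outside the range
    of \<open>to_nat\<close>, which need not be all of the natural numbers.\<close>
  define code where "code n x = cantor_code (\<lambda>j. \<exists>i. to_nat (i :: 'i) = j \<and> b n x i)" for n x
  define d where "d i u = cantor_digit ((cantor_shift ^^ to_nat (i :: 'i)) u)" for i u
  define D where "D n = distr (M n) borel (code n)" for n
  have code_meas [measurable]: "code n \<in> borel_measurable (M n)" for n
    by (auto simp: measurable_def sets)
  have d_code: "d i (code n x) = of_bool (b n x i)" for i n x
    by (simp add: d_def code_def cantor_digit_shift_code)
  have d_cont: "isCont (d i) u" for i u
    unfolding d_def by (rule continuous_cantor_digit_shift)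
  have d_meas [measurable]: "d i \<in> borel_measurable borel" for i
    using d_cont by (intro borel_measurable_continuous_onI) (auto simp: continuous_on_eq_continuous_at)
  have d01: "0 \<le> d i u" "d i u \<le> 1" for i u
    by (auto simp: d_def cantor_digit_bounds)
  have code01: "-1 < code n x \<and> code n x \<le> 2" for n x
    using cantor_code_ge_0[of "\<lambda>j. \<exists>i. to_nat (i :: 'i) = j \<and> b n x i"]
      cantor_code_le_1[of "\<lambda>j. \<exists>i. to_nat (i :: 'i) = j \<and> b n x i"] unfolding code_def by linarith
  have rd: "real_distribution (D n)" for n
    unfolding D_def by (rule prob_space.real_distribution_distr[OF prob code_meas])
  have "tight D"
    unfolding tight_def
  proof (intro conjI allI impI rd)
    fix \<epsilon> :: real assume "\<epsilon> > 0"
    have "measure (D n) {-1<..2} = 1" for n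
    proof -
      interpret prob_space "M n" by (rule prob)
      have "measure (D n) {-1<..2} = prob (code n -` {-1<..2} \<inter> space (M n))"
        unfolding D_def by (rule measure_distr) auto
      also have "code n -` {-1<..2} \<inter> space (M n) = space (M n)"
        using code01[of n] by auto
      finally show ?thesis by (simp add: prob_space)
    qed
    then show "\<exists>a b::real. a < b \<and> (\<forall>n. measure (D n) {a<..b} > 1 - \<epsilon>)"
      using \<open>\<epsilon> > 0\<close> by (intro exI[of _ "-1"] exI[of _ 2]) auto
  qed
  then obtain r L where r: "strict_mono r" and L: "real_distribution L"
      and weak: "weak_conv_m (D \<circ> r) L"
    using tight_imp_convergent_subsubsequence[of D id] by (auto simp: strict_mono_id)
  interpret L: real_distribution L by fact
  have conv: "(\<lambda>n. integral\<^sup>L (D (r n)) f) \<longlonglongrightarrow> integral\<^sup>L L f"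
    if "\<And>x. isCont f x" "\<And>x. \<bar>f x\<bar> \<le> 1" for f :: "real \<Rightarrow> real"
  proof -
    have "(\<lambda>n. integral\<^sup>L ((D \<circ> r) n) f) \<longlonglongrightarrow> integral\<^sup>L L f"
      using weak_conv_imp_integral_bdd_continuous_conv[of "D \<circ> r" L f 1] rd L weak that by auto
    then show ?thesis by simp
  qed
  have int_D: "integral\<^sup>L (D n) f = integral\<^sup>L (M n) (\<lambda>x. f (code n x))"
    if "f \<in> borel_measurable borel" for f :: "real \<Rightarrow> real" and n
    unfolding D_def by (rule integral_distr) (use that in auto)
  \<comment> \<open>The continuous function \<open>d i u * (1 - d i u)\<close> vanishes on all
    codes, so its integral is 0 along the sequence and in the limit; being nonnegative, it vanishes
    almost surely.\<close>
  have AE01: "AE u in L. d i u = 0 \<or> d i u = 1" for i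
  proof -
    have 1: "(\<lambda>n. integral\<^sup>L (D (r n)) (\<lambda>u. d i u * (1 - d i u))) \<longlonglongrightarrow> integral\<^sup>L L (\<lambda>u. d i u * (1 - d i u))"
      using d01[of i] by (intro conv continuous_intros d_cont) (auto simp: abs_mult intro!: mult_le_one)
    have "integral\<^sup>L (D n) (\<lambda>u. d i u * (1 - d i u)) = 0" for n
    proof -
      have "(\<lambda>x. d i (code n x) * (1 - d i (code n x))) = (\<lambda>x. 0)"
        by (auto simp: d_code fun_eq_iff)
      then show ?thesis by (subst int_D) auto
    qed
    with 1 have "integral\<^sup>L L (\<lambda>u. d i u * (1 - d i u)) = 0"
      by (simp add: LIMSEQ_const_iff)
    moreover have "integrable L (\<lambda>u. d i u * (1 - d i u))"
      using d01[of i] by (intro L.integrable_const_bound[of _ 1]) (auto simp: abs_mult intro!: mult_le_one AE_I2)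
    ultimately have "AE u in L. d i u * (1 - d i u) = 0"
      using d01[of i] by (subst (asm) integral_nonneg_eq_0_iff_AE) auto
    then show ?thesis by eventually_elim auto
  qed
  define \<rho> where "\<rho> = distr L (PiM UNIV (\<lambda>_ :: 'i. count_space UNIV)) (\<lambda>u i. d i u = 1)"
  have rm [measurable]: "(\<lambda>u i. d i u = 1) \<in> measurable L (PiM UNIV (\<lambda>_ :: 'i. count_space UNIV))"
    by (intro measurable_PiM_single') (auto simp: space_PiM)
  have "prob_space \<rho>"
    unfolding \<rho>_def by (rule L.prob_space_distr[OF rm])
  moreover have "sets \<rho> = sets (PiM UNIV (\<lambda>_ :: 'i. count_space UNIV))"
    by (simp add: \<rho>_def)
  moreover have "(\<lambda>n. measure (M (r n)) {x \<in> space (M (r n)). \<forall>i\<in>F. b (r n) x i = s i})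
       \<longlonglongrightarrow> measure \<rho> {q \<in> space \<rho>. \<forall>i\<in>F. q i = s i}" if "finite F" for F s
  proof -
    \<comment> \<open>A continuous function that on codes is the indicator of the pattern, so that
      weak convergence gives convergence of the pattern's probability.\<close>
    define f where "f u = (\<Prod>i\<in>F. if s i then d i u else 1 - d i u)" for u
    have f01: "0 \<le> f u" "f u \<le> 1" for u
      unfolding f_def using d01 by (auto intro!: prod_nonneg prod_le_1)
    have f_cont: "isCont f u" for u
    proof -
      have "isCont (\<lambda>x. if s i then d i x else 1 - d i x) u" for i
        by (cases "s i") (auto intro!: continuous_intros d_cont)
      then show ?thesis unfolding f_def by (intro continuous_intros)
    qed
    have [measurable]: "f \<in> borel_measurable borel"
      unfolding f_def by measurable
    have f_ind: "f u = of_bool (\<forall>i\<in>F. (d i u = 1) = s i)" if "\<forall>i\<in>F. d i u = 0 \<or> d i u = 1" for u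
    proof (cases "\<forall>i\<in>F. (d i u = 1) = s i")
      case True
      then show ?thesis using that unfolding f_def by (auto intro!: prod.neutral)
    next
      case False
      then obtain i where i: "i \<in> F" "(d i u = 1) \<noteq> s i" by blast
      then have "(if s i then d i u else 1 - d i u) = 0" using that by (cases "s i") auto
      then have "f u = 0" using i(1) \<open>finite F\<close> unfolding f_def by (intro prod_zero bexI[of _ i])
      then show ?thesis using False by simp
    qed
    have 1: "integral\<^sup>L (D n) f = measure (M n) {x \<in> space (M n). \<forall>i\<in>F. b n x i = s i}" for n
    proof -
      have "integral\<^sup>L (D n) f = integral\<^sup>L (M n) (indicator {x \<in> space (M n). \<forall>i\<in>F. b n x i = s i})"
        by (subst int_D, simp, intro Bochner_Integration.integral_cong)
          (auto simp: f_ind d_code indicator_def split: if_splits)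
      also have "\<dots> = measure (M n) {x \<in> space (M n). \<forall>i\<in>F. b n x i = s i}"
        by (simp add: Int_absorb2)
      finally show ?thesis .
    qed
    have 2: "integral\<^sup>L L f = measure \<rho> {q \<in> space \<rho>. \<forall>i\<in>F. q i = s i}"
    proof -
      have "AE u in L. \<forall>i\<in>F. d i u = 0 \<or> d i u = 1"
        using AE01 \<open>finite F\<close> by (simp add: AE_finite_all)
      then have "integral\<^sup>L L f = integral\<^sup>L L (indicator {u \<in> space L. \<forall>i\<in>F. (d i u = 1) = s i})"
        using \<open>finite F\<close> by (intro integral_cong_AE) (auto simp: f_ind indicator_def elim!: eventually_mono)
      also have "\<dots> = measure L {u \<in> space L. \<forall>i\<in>F. (d i u = 1) = s i}"
        by (simp add: Int_absorb2)
      also have "\<dots> = measure \<rho> {q \<in> space \<rho>. \<forall>i\<in>F. q i = s i}"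
        unfolding \<rho>_def using \<open>finite F\<close>
        by (subst measure_distr)
          (auto intro!: arg_cong[where f="measure L"] sets_bit_pattern simp: space_PiM)
      finally show ?thesis .
    qed
    show ?thesis
      using conv[of f] f_cont f01 by (auto simp: 1 2)
  qed
  ultimately show ?thesis using that r by blast
qed


section \<open>The tree of term ideals\<close>

instance qf_term :: countable
  by countable_datatype

text \<open>The limit tree is easier to describe by its order. An element is determined by the
  elements below it, so the greatest lower bound property yields commutativity and
  associativity.\<close>

lemma tree_semilatticeI:
  fixes T :: "'a set" and ord :: "'a \<Rightarrow> 'a \<Rightarrow> bool"
  assumes closed: "\<And>x y. x \<in> T \<Longrightarrow> y \<in> T \<Longrightarrow> m x y \<in> T"
    and refl: "\<And>x. x \<in> T \<Longrightarrow> ord x x"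
    and antisym: "\<And>x y. x \<in> T \<Longrightarrow> y \<in> T \<Longrightarrow> ord x y \<Longrightarrow> ord y x \<Longrightarrow> x = y"
    and glb: "\<And>x y z. x \<in> T \<Longrightarrow> y \<in> T \<Longrightarrow> z \<in> T \<Longrightarrow> ord z (m x y) \<longleftrightarrow> ord z x \<and> ord z y"
    and linear: "\<And>x y z. x \<in> T \<Longrightarrow> y \<in> T \<Longrightarrow> z \<in> T \<Longrightarrow> ord x z \<Longrightarrow> ord y z \<Longrightarrow> ord x y \<or> ord y x"
  shows "tree_semilattice T m" and "\<And>x y. x \<in> T \<Longrightarrow> y \<in> T \<Longrightarrow> tle m x y \<longleftrightarrow> ord x y"
proof -
  have eqI: "x = y" if "x \<in> T" "y \<in> T" "\<And>z. z \<in> T \<Longrightarrow> ord z x \<longleftrightarrow> ord z y" for x y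
    using that antisym refl by blast
  have ord_iff: "m x y = x \<longleftrightarrow> ord x y" if "x \<in> T" "y \<in> T" for x y
  proof
    assume "m x y = x"
    then show "ord x y" using glb[of x y x] refl that by simp
  next
    assume "ord x y"
    then have "ord x (m x y)" "ord (m x y) x"
      using glb[of x y x] glb[of x y "m x y"] closed refl that by auto
    then show "m x y = x" using antisym closed that by auto
  qed
  show "tle m x y \<longleftrightarrow> ord x y" if "x \<in> T" "y \<in> T" for x y
    using ord_iff that by (simp add: tle_def)
  have comm: "m x y = m y x" if "x \<in> T" "y \<in> T" for x y
    by (rule eqI) (use that closed glb in auto)
  show "tree_semilattice T m"
  proof
    fix x y z assume T: "x \<in> T" "y \<in> T" "z \<in> T"
    show "m (m x y) z = m x (m y z)"
      by (rule eqI) (use T closed glb in auto)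
    assume "m x z = x" "m y z = y"
    then have "ord x y \<or> ord y x" using linear[of x y z] ord_iff T by auto
    then show "m x y \<in> {x, y}" using ord_iff[of x y] ord_iff[of y x] comm[of x y] T by auto
  qed (use closed comm ord_iff refl in auto)
qed

type_synonym point = "qf_term set \<times> nat \<times> real"

text \<open>Terms over the separator points, preordered by the eventual order of their values.\<close>

locale term_tree =
  fixes LE :: "qf_term \<Rightarrow> qf_term \<Rightarrow> bool" and CA :: "nat \<Rightarrow> qf_term \<Rightarrow> bool"
  assumes LE_refl: "LE t t"
    and LE_trans: "LE r s \<Longrightarrow> LE s t \<Longrightarrow> LE r t"
    and LE_Meet: "LE r (Meet s t) \<longleftrightarrow> LE r s \<and> LE r t"
    and LE_linear: "LE r t \<Longrightarrow> LE s t \<Longrightarrow> LE r s \<or> LE s r"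
    and CA_cong: "LE s t \<Longrightarrow> LE t s \<Longrightarrow> CA i s \<longleftrightarrow> CA i t"
begin

definition ideal :: "qf_term set \<Rightarrow> bool" where
  "ideal I \<longleftrightarrow> (\<forall>t\<in>I. \<forall>s. LE s t \<longrightarrow> s \<in> I) \<and> (\<forall>s\<in>I. \<forall>t\<in>I. LE s t \<or> LE t s)"

definition down :: "qf_term \<Rightarrow> qf_term set" where
  "down t = {s. LE s t}"

definition principal :: "qf_term set \<Rightarrow> bool" where
  "principal I \<longleftrightarrow> (\<exists>t\<in>I. \<forall>s\<in>I. LE s t)"

text \<open>A point of the limit consists of the chain of terms below it, a tag separating the points
  that have this chain below them and from which further points may branch off, and the position
  \<open>w\<close> above such a branching point (\<open>w = 0\<close> being the branching point itself). Tags are ordered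
  downwards, so that tag \<open>0\<close> is the top one.\<close>

definition hat_dom :: "point set" where
  "hat_dom = {I. ideal I} \<times> UNIV"

fun hat_le :: "point \<Rightarrow> point \<Rightarrow> bool" where
  "hat_le (I, a, w) (J, b, v) \<longleftrightarrow> (I, a, w) = (J, b, v) \<or> w = 0 \<and> (I \<subset> J \<or> I = J \<and> b \<le> a)"

text \<open>If the chains differ and one contains the other, the branching point of the smaller
  chain with its own tag is below the other argument. If they are incomparable, the greatest common
  lower bound is the topmost branching point over \<open>I \<inter> J\<close>, which has tag
  0.\<close>

fun hat_meet :: "point \<Rightarrow> point \<Rightarrow> point" where
  "hat_meet (I, a, w) (J, b, v) =
     (if (I, a, w) = (J, b, v) then (I, a, w)
      else (I \<inter> J, if I = J then max a b else if I \<subset> J then a else if J \<subset> I then b else 0, 0))"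

text \<open>A branching point over a principal chain takes its colors from the maximal term; over a
  chain without maximum no term names it, and the tag itself is a code of its colors. Elsewhere the
  integer part of \<open>w\<close> is such a code.\<close>

definition hat_color :: "nat \<Rightarrow> point set" where
  "hat_color i = {(I, a, w) \<in> hat_dom.
     if w \<noteq> 0 then i \<in> set_decode (nat \<lfloor>w\<rfloor>)
     else if principal I then \<exists>t\<in>I. (\<forall>s\<in>I. LE s t) \<and> CA i t
     else i \<in> set_decode a}"

definition hat :: "point colored_structure" where
  "hat = \<lparr>domain_of = hat_dom, meet = hat_meet, color = hat_color\<rparr>"

definition base :: "nat \<Rightarrow> point" where
  "base i = (down (Var i), 0, 0)"

lemma ideal_Int: "ideal I \<Longrightarrow> ideal J \<Longrightarrow> ideal (I \<inter> J)"
  unfolding ideal_def by blast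

lemma ideal_comparable:
  assumes "ideal I" "ideal J" "ideal L" "I \<subseteq> L" "J \<subseteq> L"
  shows "I \<subseteq> J \<or> J \<subseteq> I"
  using assms unfolding ideal_def by blast

lemma ideal_down: "ideal (down t)"
  unfolding ideal_def down_def using LE_trans LE_linear by blast

lemma ideal_principal: "ideal I \<Longrightarrow> principal I \<longleftrightarrow> (\<exists>t. I = down t)"
  unfolding ideal_def principal_def down_def using LE_refl by blast

lemma down_subset: "ideal I \<Longrightarrow> down t \<subseteq> I \<longleftrightarrow> t \<in> I"
  unfolding ideal_def down_def using LE_refl by blast

lemma hat_meet_in_dom: "x \<in> hat_dom \<Longrightarrow> y \<in> hat_dom \<Longrightarrow> hat_meet x y \<in> hat_dom"
  by (cases x; cases y) (auto simp: hat_dom_def ideal_Int)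

lemma hat_le_meet:
  assumes "x \<in> hat_dom" "y \<in> hat_dom" "z \<in> hat_dom"
  shows "hat_le z (hat_meet x y) \<longleftrightarrow> hat_le z x \<and> hat_le z y"
proof -
  obtain I a w J b v L c u where [simp]: "x = (I, a, w)" "y = (J, b, v)" "z = (L, c, u)"
    by (cases x; cases y; cases z) auto
  show ?thesis by auto
qed

lemma hat_le_linear:
  assumes "x \<in> hat_dom" "y \<in> hat_dom" "z \<in> hat_dom" "hat_le x z" "hat_le y z"
  shows "hat_le x y \<or> hat_le y x"
proof -
  obtain I a w J b v L c u where [simp]: "x = (I, a, w)" "y = (J, b, v)" "z = (L, c, u)"
    by (cases x; cases y; cases z) auto
  have "I \<subseteq> J \<or> J \<subseteq> I"
    using ideal_comparable[of I J L] assms by (auto simp: hat_dom_def)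
  then show ?thesis using assms by auto
qed

lemma tree_hat: "tree_semilattice hat_dom hat_meet"
  and tle_hat: "x \<in> hat_dom \<Longrightarrow> y \<in> hat_dom \<Longrightarrow> tle hat_meet x y \<longleftrightarrow> hat_le x y"
proof -
  have 1: "hat_le x x" for x
    by (cases x) auto
  have 2: "x = y" if "hat_le x y" "hat_le y x" for x y
    using that by (cases x; cases y) auto
  show "tree_semilattice hat_dom hat_meet"
    by (rule tree_semilatticeI(1)[where ord = hat_le]) (blast intro: hat_meet_in_dom 1 2 dest: hat_le_meet hat_le_linear)+
  show "tle hat_meet x y \<longleftrightarrow> hat_le x y" if "x \<in> hat_dom" "y \<in> hat_dom"
    using that by (rule tree_semilatticeI(2)[where ord = hat_le, rotated -2]) (blast intro: hat_meet_in_dom 1 2 dest: hat_le_meet hat_le_linear)+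
qed

lemma down_Meet: "down (Meet s t) = down s \<inter> down t"
  by (auto simp: down_def LE_Meet)

text \<open>The terms embed as the principal chains with tag 0: meets turn into intersections by
  \<open>down_Meet\<close>, and the tag 0 is preserved.\<close>

lemma eval_base: "eval_term hat base t = (down t, 0, 0)"
  by (induction t) (auto simp: hat_def base_def down_Meet)

end


section \<open>Standard Borel spaces and products\<close>

lemma standard_borel_vimage_algebra:
  fixes emb :: "'b \<Rightarrow> 'c :: {complete_space, second_countable_topology}"
  assumes inj: "inj_on emb D" and cl: "closed (emb ` D)"
    and sets: "sets M = sets (vimage_algebra D emb borel)" and space: "space M = D"
  shows "standard_borel M"
proof -
  define X where "X = pullback_topology D emb euclidean"
  let ?Y = "subtopology euclidean (emb ` D)"
  have top: "topspace X = D"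
    by (simp add: X_def topspace_pullback_topology)
  have opn: "openin X S \<longleftrightarrow> (\<exists>U. open U \<and> S = emb -` U \<inter> D)" for S
    by (simp add: X_def openin_pullback_topology open_openin[symmetric])
  have "homeomorphic_map X ?Y emb"
  proof (rule bijective_open_imp_homeomorphic_map)
    show "continuous_map X ?Y emb"
      unfolding X_def
      by (intro continuous_map_into_subtopology continuous_map_pullback[OF continuous_map_id, unfolded id_comp])
         (auto simp: topspace_pullback_topology)
    show "open_map X ?Y emb"
      unfolding open_map_def
    proof (intro allI impI)
      fix S assume "openin X S"
      then obtain U where "open U" "S = emb -` U \<inter> D" using opn by auto
      moreover from this have "emb ` S = U \<inter> emb ` D" by auto
      ultimately show "openin ?Y (emb ` S)" using openin_open_Int[of U "emb ` D"] by (simp add: Int_commute)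
    qed
  qed (use inj top in auto)
  then have hom: "X homeomorphic_space ?Y"
    by (rule homeomorphic_map_imp_homeomorphic_space)
  have "completely_metrizable_space ?Y"
    by (rule completely_metrizable_space_closedin[OF completely_metrizable_space_euclidean])
      (rule cl[THEN closed_closedin[THEN iffD1]])
  then have "completely_metrizable_space X"
    using homeomorphic_completely_metrizable_space[OF hom] by simp
  moreover have "second_countable ?Y"
  proof (rule second_countable_subtopology)
    obtain B :: "'c set set" where "countable B" "topological_basis B"
      using ex_countable_basis by blast
    then show "second_countable (euclidean :: 'c topology)"
      unfolding second_countable_def open_openin[symmetric]
      by (intro exI[of _ B]) (metis topological_basisE topological_basis_open)
  qed
  then have "second_countable X"
    using homeomorphic_space_second_countability[OF hom] by simp
  moreover have "sets M = sigma_sets (topspace X) {U. openin X U}"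
  proof -
    have "sets M = {emb -` A \<inter> D | A. A \<in> sets borel}"
      unfolding sets by (rule sets_vimage_algebra2) auto
    also have "\<dots> = {emb -` A \<inter> D | A. A \<in> sigma_sets UNIV {S. open S}}"
      by (simp add: borel_def)
    also have "\<dots> = sigma_sets D {emb -` A \<inter> D | A. A \<in> {S. open S}}"
      by (rule sigma_sets_vimage_commute) auto
    also have "{emb -` A \<inter> D | A. A \<in> {S. open S}} = {U. openin X U}"
      by (auto simp: opn)
    finally show ?thesis by (simp add: top)
  qed
  ultimately show ?thesis
    unfolding standard_borel_def using top space by blast
qed

lemma pred_eq_vimage_algebra:
  fixes emb :: "'b \<Rightarrow> 'c :: {complete_space, second_countable_topology}"
  assumes inj: "inj_on emb D"
    and sets: "sets M = sets (vimage_algebra D emb borel)" and space: "space M = D"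
  shows "Measurable.pred (M \<Otimes>\<^sub>M M) (\<lambda>p. fst p = snd p)"
proof -
  have [measurable]: "emb \<in> borel_measurable M"
    unfolding measurable_cong_sets[OF sets refl] by (rule measurable_vimage_algebra1) auto
  have "Measurable.pred (M \<Otimes>\<^sub>M M) (\<lambda>p. emb (fst p) = emb (snd p))"
    by measurable
  moreover have "emb (fst p) = emb (snd p) \<longleftrightarrow> fst p = snd p" if "p \<in> space (M \<Otimes>\<^sub>M M)" for p
    using that inj by (auto simp: space_pair_measure space inj_on_eq_iff)
  ultimately show ?thesis
    by (subst measurable_cong[where g = "\<lambda>p. emb (fst p) = emb (snd p)"]) auto
qed

section \<open>Evaluation, measurability and transport of formulas\<close>

lemma eval_term_cong: "wf_term p t \<Longrightarrow> (\<And>i. i < p \<Longrightarrow> v i = w i) \<Longrightarrow> eval_term S v t = eval_term S w t"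
  by (induction t) auto

lemma sat_cong: "wf_formula k p \<phi> \<Longrightarrow> (\<And>i. i < p \<Longrightarrow> v i = w i) \<Longrightarrow> sat S v \<phi> \<longleftrightarrow> sat S w \<phi>"
proof (induction \<phi>)
  case (Eq s t)
  then show ?case using eval_term_cong[of p s v w S] eval_term_cong[of p t v w S] by simp
next
  case (Color i t)
  then show ?case using eval_term_cong[of p t v w S] by simp
qed auto

lemma eval_term_closed:
  assumes "tree_semilattice (domain_of S) (meet S)"
  shows "wf_term p t \<Longrightarrow> (\<And>i. i < p \<Longrightarrow> v i \<in> domain_of S) \<Longrightarrow> eval_term S v t \<in> domain_of S"
  by (induction t) (auto intro: tree_semilattice.closed[OF assms])

lemma measurable_solutions:
  assumes meet: "(\<lambda>(x, y). meet S x y) \<in> measurable (M \<Otimes>\<^sub>M M) M"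
    and eq: "Measurable.pred (M \<Otimes>\<^sub>M M) (\<lambda>p. fst p = snd p)"
    and color: "\<forall>i<k. color S i \<in> sets M" and space: "space M = domain_of S"
    and wf: "wf_formula k p \<phi>"
  shows "solutions p \<phi> S \<in> sets (PiM {..<p} (\<lambda>_. M))"
proof -
  let ?P = "PiM {..<p} (\<lambda>_. M)"
  have ev: "(\<lambda>v. eval_term S v t) \<in> measurable ?P M" if "wf_term p t" for t
    using that
  proof (induction t)
    case (Meet s t)
    then have "(\<lambda>v. (eval_term S v s, eval_term S v t)) \<in> measurable ?P (M \<Otimes>\<^sub>M M)"
      by simp
    from measurable_compose[OF this meet] show ?case by simp
  qed simp
  have "Measurable.pred ?P (\<lambda>v. sat S v \<phi>)"
    using wf
  proof (induction \<phi>)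
    case (Eq s t)
    then have "(\<lambda>v. (eval_term S v s, eval_term S v t)) \<in> measurable ?P (M \<Otimes>\<^sub>M M)"
      using ev by simp
    from measurable_compose[OF this eq] show ?case by simp
  next
    case (Color i t)
    then have "color S i \<in> sets M" "(\<lambda>v. eval_term S v t) \<in> measurable ?P M"
      using color ev by auto
    then have "Measurable.pred ?P (\<lambda>v. eval_term S v t \<in> color S i)" by measurable
    then show ?case by simp
  qed auto
  then have "{v \<in> space ?P. sat S v \<phi>} \<in> sets ?P"
    by measurable
  then show ?thesis by (simp add: solutions_def space_PiM space)
qed

text \<open>The random points of the limit will be functions \<open>X\<close> of a simpler random
  source; densities of formulas then become probabilities about independent copies of that
  source.\<close>

lemma pairing_distr:
  assumes N: "prob_space N" and X: "X \<in> measurable N M" and space: "space M = domain_of S"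
    and sol: "solutions p \<phi> S \<in> sets (PiM {..<p} (\<lambda>_. M))" and wf: "wf_formula k p \<phi>"
  shows "pairing p \<phi> S (distr N M X) =
    measure (PiM {..<p} (\<lambda>_. N)) {\<omega> \<in> space (PiM {..<p} (\<lambda>_. N)). sat S (\<lambda>i. X (\<omega> i)) \<phi>}"
proof -
  let ?P = "PiM {..<p} (\<lambda>_. N)"
  let ?M = "distr N M X"
  have M: "prob_space ?M" using N X by (rule prob_space.prob_space_distr)
  have X': "X \<in> measurable N ?M" using X by simp
  have sets: "sets (PiM {..<p} (\<lambda>_. ?M)) = sets (PiM {..<p} (\<lambda>_. M))"
    by (intro sets_PiM_cong) auto
  have "distr N ?M X = ?M" by (intro distr_cong) auto
  then have eq: "distr ?P (PiM {..<p} (\<lambda>_. ?M)) (compose {..<p} X) = PiM {..<p} (\<lambda>_. ?M)"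
    using distr_PiM_finite_prob_space'[of "{..<p}" "\<lambda>_. N" "\<lambda>_. ?M" X] N M X' by simp
  have meas: "compose {..<p} X \<in> measurable ?P (PiM {..<p} (\<lambda>_. ?M))"
    unfolding compose_def using X' by measurable
  have "pairing p \<phi> S ?M = measure (distr ?P (PiM {..<p} (\<lambda>_. ?M)) (compose {..<p} X)) (solutions p \<phi> S)"
    unfolding pairing_def eq ..
  also have "\<dots> = measure ?P (compose {..<p} X -` solutions p \<phi> S \<inter> space ?P)"
    using meas sol sets by (intro measure_distr) auto
  also have "compose {..<p} X -` solutions p \<phi> S \<inter> space ?P = {\<omega> \<in> space ?P. sat S (\<lambda>i. X (\<omega> i)) \<phi>}"
  proof -
    have "sat S (compose {..<p} X \<omega>) \<phi> \<longleftrightarrow> sat S (\<lambda>i. X (\<omega> i)) \<phi>" for \<omega>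
      using wf by (rule sat_cong) (simp add: compose_def)
    moreover have "compose {..<p} X \<omega> \<in> {..<p} \<rightarrow>\<^sub>E domain_of S" if "\<omega> \<in> space ?P" for \<omega>
      using that measurable_space[OF X] by (auto simp: space_PiM compose_def space PiE_iff)
    ultimately show ?thesis by (auto simp: solutions_def)
  qed
  finally show ?thesis .
qed

lemma eval_term_transport:
  assumes "tree_semilattice (domain_of S) (meet S)" "inj_on f (domain_of S)"
    and "S' = \<lparr>domain_of = f ` domain_of S,
      meet = (\<lambda>a b. f (meet S (inv_into (domain_of S) f a) (inv_into (domain_of S) f b))),
      color = (\<lambda>i. f ` color S i)\<rparr>"
  shows "wf_term p t \<Longrightarrow> (\<And>i. i < p \<Longrightarrow> v i \<in> domain_of S) \<Longrightarrow>
    eval_term S' (\<lambda>i. f (v i)) t = f (eval_term S v t)"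
proof (induction t)
  case (Meet s t)
  have "eval_term S v s \<in> domain_of S" "eval_term S v t \<in> domain_of S"
    using Meet.prems eval_term_closed[OF assms(1), of p] by auto
  then show ?case using Meet assms(2) by (simp add: assms(3))
qed (simp add: assms(3))

lemma sat_transport:
  assumes S: "colored_tree_semilattice k S" and f: "inj_on f (domain_of S)"
    and S': "S' = \<lparr>domain_of = f ` domain_of S,
      meet = (\<lambda>a b. f (meet S (inv_into (domain_of S) f a) (inv_into (domain_of S) f b))),
      color = (\<lambda>i. f ` color S i)\<rparr>"
    and v: "\<And>i. i < p \<Longrightarrow> v i \<in> domain_of S"
  shows "wf_formula k p \<phi> \<Longrightarrow> sat S' (\<lambda>i. f (v i)) \<phi> \<longleftrightarrow> sat S v \<phi>"
proof -
  have tree: "tree_semilattice (domain_of S) (meet S)"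
    using S by (simp add: colored_tree_semilattice_def)
  note ev = eval_term_transport[OF tree f S', of p _ v] eval_term_closed[OF tree, of p _ v]
  show "wf_formula k p \<phi> \<Longrightarrow> sat S' (\<lambda>i. f (v i)) \<phi> \<longleftrightarrow> sat S v \<phi>"
  proof (induction \<phi>)
    case (Eq s t)
    then show ?case using ev v f by (auto simp: inj_on_eq_iff)
  next
    case (Color i t)
    then have "eval_term S v t \<in> domain_of S" "color S i \<subseteq> domain_of S"
      using ev v S by (auto simp: colored_tree_semilattice_def)
    then have "f (eval_term S v t) \<in> f ` color S i \<longleftrightarrow> eval_term S v t \<in> color S i"
      using f by (auto simp: inj_on_def)
    then show ?case using Color ev v by (simp add: S')
  qed auto
qed

text \<open>\<open>f\<close> is an injection of bare sets: its image receives the sigma-algebra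
  pulled back along \<open>emb \<circ> g\<close>, so the Polish structure is that of the original
  space and unrelated to the usual topology of the reals.\<close>

lemma ex_real_copy:
  fixes S :: "'b colored_structure" and f :: "'b \<Rightarrow> real" and emb :: "'b \<Rightarrow> 'c :: {complete_space, second_countable_topology}"
  assumes S: "colored_tree_semilattice k S" and space: "space M = domain_of S"
    and sets: "sets M = sets (vimage_algebra (domain_of S) emb borel)"
    and emb: "inj_on emb (domain_of S)" "closed (emb ` domain_of S)"
    and meet: "(\<lambda>(x, y). meet S x y) \<in> measurable (M \<Otimes>\<^sub>M M) M"
    and color: "\<forall>i<k. color S i \<in> sets M" and M: "prob_space M"
    and f: "inj_on f (domain_of S)"
  obtains S' :: "real colored_structure" and M' where "borel_weighted_tree_semilattice k S' M'"
    "\<And>p \<phi>. wf_formula k p \<phi> \<Longrightarrow> pairing p \<phi> S' M' = pairing p \<phi> S M"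
proof -
  let ?D = "domain_of S"
  define g where "g = inv_into ?D f"
  define S' where "S' = \<lparr>domain_of = f ` ?D, meet = (\<lambda>a b. f (meet S (g a) (g b))),
    color = (\<lambda>i. f ` color S i)\<rparr>"
  define V where "V = vimage_algebra (f ` ?D) (emb \<circ> g) borel"
  define M' where "M' = distr M V f"
  have S'_eq [simp]: "domain_of S' = f ` ?D" "meet S' a b = f (meet S (g a) (g b))" "color S' i = f ` color S i" for a b i
    by (simp_all add: S'_def)
  have gf [simp]: "g (f x) = x" if "x \<in> ?D" for x
    using f that by (simp add: g_def)
  interpret T: tree_semilattice ?D "meet S"
    using S by (simp add: colored_tree_semilattice_def)
  have tree': "tree_semilattice (f ` ?D) (meet S')"
  proof
    fix a b c assume "a \<in> f ` ?D" "b \<in> f ` ?D" "c \<in> f ` ?D"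
    then obtain x y z where xyz: "x \<in> ?D" "y \<in> ?D" "z \<in> ?D" and [simp]: "a = f x" "b = f y" "c = f z" by auto
    show "meet S' (meet S' a b) c = meet S' a (meet S' b c)"
      using xyz T.closed T.assoc by simp
    assume "meet S' a c = a" "meet S' b c = b"
    then have "meet S x z = x" "meet S y z = y"
      using xyz T.closed f by (auto simp: inj_on_eq_iff)
    then show "meet S' a b \<in> {a, b}" using T.tree[of x y z] xyz by auto
  qed (auto simp: T.closed T.idem T.comm)
  have col_sub: "color S i \<subseteq> ?D" if "i < k" for i
    using S that by (simp add: colored_tree_semilattice_def)
  have space_V: "space V = f ` ?D" by (simp add: V_def)
  have emb_meas: "emb \<in> borel_measurable M"
    unfolding measurable_cong_sets[OF sets refl] by (rule measurable_vimage_algebra1) auto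
  have f_meas: "f \<in> measurable M V"
    unfolding V_def
  proof (rule measurable_vimage_algebra2)
    show "(\<lambda>x. (emb \<circ> g) (f x)) \<in> borel_measurable M"
      using emb_meas by (subst measurable_cong[where g = emb]) (auto simp: space)
  qed (simp add: space)
  have g_meas: "g \<in> measurable V M"
  proof -
    have "g \<in> measurable V (vimage_algebra ?D emb borel)"
    proof (rule measurable_vimage_algebra2)
      show "(\<lambda>x. emb (g x)) \<in> borel_measurable V"
        unfolding V_def using measurable_vimage_algebra1[of "emb \<circ> g" "f ` ?D" borel] by (simp add: o_def)
    qed (auto simp: space_V)
    then show ?thesis using measurable_cong_sets[OF refl sets, of V] by simp
  qed
  have meet': "(\<lambda>(a, b). meet S' a b) \<in> measurable (V \<Otimes>\<^sub>M V) V"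
  proof -
    have "(\<lambda>p. (g (fst p), g (snd p))) \<in> measurable (V \<Otimes>\<^sub>M V) (M \<Otimes>\<^sub>M M)"
      using g_meas by measurable
    from measurable_compose[OF measurable_compose[OF this meet] f_meas]
    show ?thesis by (simp add: case_prod_beta)
  qed
  have color': "color S' i \<in> sets V" if "i < k" for i
  proof -
    have "f ` color S i = g -` color S i \<inter> space V"
      using col_sub[OF that] by (force simp: space_V)
    then show ?thesis using measurable_sets[OF g_meas, of "color S i"] color that by simp
  qed
  have prob': "prob_space M'"
    unfolding M'_def using M f_meas by (rule prob_space.prob_space_distr)
  have inj': "inj_on (emb \<circ> g) (f ` ?D)"
    using emb(1) by (auto simp: inj_on_def)
  have im': "(emb \<circ> g) ` f ` ?D = emb ` ?D"
    by (force simp: image_image)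
  have "closed ((emb \<circ> g) ` f ` ?D)"
    unfolding im' by (rule emb)
  then have "standard_borel M'"
    by (rule standard_borel_vimage_algebra[OF inj']) (simp_all add: M'_def V_def)
  moreover have sM: "sets M' = sets V"
    by (simp add: M'_def)
  have meetM: "(\<lambda>(a, b). meet S' a b) \<in> measurable (M' \<Otimes>\<^sub>M M') M'"
    unfolding measurable_cong_sets[OF sets_pair_measure_cong[OF sM sM] sM] by (rule meet')
  ultimately have bw: "borel_weighted_tree_semilattice k S' M'"
    unfolding borel_weighted_tree_semilattice_def colored_tree_semilattice_def
    using tree' meetM color' prob' col_sub by (auto simp: M'_def space_V simp del: S'_eq(2))
  moreover have "pairing p \<phi> S' M' = pairing p \<phi> S M" if wf: "wf_formula k p \<phi>" for p \<phi>
  proof -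
    have "pairing p \<phi> S' M' = measure (PiM {..<p} (\<lambda>_. M)) {\<omega> \<in> space (PiM {..<p} (\<lambda>_. M)). sat S' (\<lambda>i. f (\<omega> i)) \<phi>}"
      unfolding M'_def
    proof (rule pairing_distr[OF M f_meas _ _ wf])
      show "solutions p \<phi> S' \<in> sets (PiM {..<p} (\<lambda>_. V))"
      proof (rule measurable_solutions[OF meet' _ _ _ wf])
        show "Measurable.pred (V \<Otimes>\<^sub>M V) (\<lambda>p. fst p = snd p)"
          by (rule pred_eq_vimage_algebra[OF inj']) (auto simp: V_def)
      qed (use color' space_V in auto)
    qed (simp add: space_V)
    also have "{\<omega> \<in> space (PiM {..<p} (\<lambda>_. M)). sat S' (\<lambda>i. f (\<omega> i)) \<phi>} = solutions p \<phi> S"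
    proof -
      have "sat S' (\<lambda>i. f (\<omega> i)) \<phi> \<longleftrightarrow> sat S \<omega> \<phi>" if "\<omega> \<in> space (PiM {..<p} (\<lambda>_. M))" for \<omega>
        using that by (intro sat_transport[OF S f S'_def[unfolded g_def] _ wf]) (auto simp: space_PiM space)
      then show ?thesis by (auto simp: solutions_def space_PiM space)
    qed
    finally show ?thesis by (simp add: pairing_def)
  qed
  ultimately show ?thesis by (rule that)
qed

text \<open>Reduces events about two coordinates of a sampled tuple to events about an independent
  pair. It suffices to compare rectangles, which are boxes of the large product.\<close>

lemma distr_PiM_pair:
  fixes p :: nat
  assumes M: "prob_space M" and ij: "i < p" "j < p" "i \<noteq> j"
  shows "distr (PiM {..<p} (\<lambda>_. M)) (M \<Otimes>\<^sub>M M) (\<lambda>v. (v i, v j)) = M \<Otimes>\<^sub>M M"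
proof -
  let ?P = "PiM {..<p} (\<lambda>_. M)"
  interpret M: prob_space M by fact
  interpret P: product_prob_space "\<lambda>_. M" "{..<p}" by unfold_locales
  have meas: "(\<lambda>v. (v i, v j)) \<in> measurable ?P (M \<Otimes>\<^sub>M M)"
    using ij by (intro measurable_Pair measurable_component_singleton) auto
  show ?thesis
  proof (rule pair_measure_eqI[symmetric])
    fix A B assume AB: "A \<in> sets M" "B \<in> sets M"
    define C where "C l = (if l = i then A else if l = j then B else space M)" for l
    have "emeasure (distr ?P (M \<Otimes>\<^sub>M M) (\<lambda>v. (v i, v j))) (A \<times> B)
        = emeasure ?P ((\<lambda>v. (v i, v j)) -` (A \<times> B) \<inter> space ?P)"
      using meas AB by (intro emeasure_distr) auto
    also have "(\<lambda>v. (v i, v j)) -` (A \<times> B) \<inter> space ?P = Pi\<^sub>E {..<p} C"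
    proof -
      have C: "C i = A" "C j = B" "C l \<subseteq> space M" for l
        using AB[THEN sets.sets_into_space] ij by (auto simp: C_def)
      have "v \<in> {..<p} \<rightarrow>\<^sub>E space M \<and> v i \<in> A \<and> v j \<in> B \<longleftrightarrow> v \<in> Pi\<^sub>E {..<p} C" for v
      proof
        assume v: "v \<in> {..<p} \<rightarrow>\<^sub>E space M \<and> v i \<in> A \<and> v j \<in> B"
        have "v l \<in> C l" if "l < p" for l
          using v that by (cases "l = i \<or> l = j") (auto simp: C_def PiE_iff)
        then show "v \<in> Pi\<^sub>E {..<p} C" using v by (simp add: PiE_iff)
      next
        assume v: "v \<in> Pi\<^sub>E {..<p} C"
        then have "v l \<in> C l" if "l < p" for l using that by (simp add: PiE_iff)
        then show "v \<in> {..<p} \<rightarrow>\<^sub>E space M \<and> v i \<in> A \<and> v j \<in> B"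
          using v C ij by (auto simp: PiE_iff)
      qed
      then show ?thesis by (auto simp: space_PiM)
    qed
    also have "emeasure ?P (Pi\<^sub>E {..<p} C) = (\<Prod>l<p. emeasure M (C l))"
      using AB by (intro P.emeasure_PiM) (auto simp: C_def)
    also have "\<dots> = (\<Prod>l\<in>{i, j}. emeasure M (C l))"
      using ij M.emeasure_space_1 by (intro prod.mono_neutral_right) (auto simp: C_def)
    also have "\<dots> = emeasure M A * emeasure M B"
      using ij by (simp add: C_def)
    finally show "emeasure M A * emeasure M B = emeasure (distr ?P (M \<Otimes>\<^sub>M M) (\<lambda>v. (v i, v j))) (A \<times> B)" ..
  qed (auto intro: M.sigma_finite_measure_axioms)
qed


section \<open>Limit types\<close>

text \<open>These bits locate a point relative to the terms: terms below and above it, positions of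
  its meets with terms, colors of the point and of these meets. \<open>B_le\<close> and
  \<open>B_ca\<close> do not speak of the point; they are included so that convergence of the law of
  the bits also fixes the eventual order and colors of the terms.\<close>

datatype bit =
    B_up qf_term
  | B_dn qf_term
  | B_ml qf_term qf_term
  | B_cx nat
  | B_cm nat qf_term
  | B_le qf_term qf_term
  | B_ca nat qf_term

instance bit :: countable
  by countable_datatype

primrec holds :: "'a colored_structure \<Rightarrow> (nat \<Rightarrow> 'a) \<Rightarrow> 'a \<Rightarrow> bit \<Rightarrow> bool" where
  "holds S y x (B_up t) \<longleftrightarrow> tle (meet S) (eval_term S y t) x"
| "holds S y x (B_dn t) \<longleftrightarrow> tle (meet S) x (eval_term S y t)"
| "holds S y x (B_ml s t) \<longleftrightarrow> tle (meet S) (meet S x (eval_term S y s)) (eval_term S y t)"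
| "holds S y x (B_cx i) \<longleftrightarrow> x \<in> color S i"
| "holds S y x (B_cm i t) \<longleftrightarrow> meet S x (eval_term S y t) \<in> color S i"
| "holds S y x (B_le s t) \<longleftrightarrow> tle (meet S) (eval_term S y s) (eval_term S y t)"
| "holds S y x (B_ca i t) \<longleftrightarrow> eval_term S y t \<in> color S i"

lemma eventually_iff_of_bool_tendsto:
  fixes P :: "nat \<Rightarrow> bool"
  assumes "(\<lambda>n. of_bool (P n) :: real) \<longlonglongrightarrow> l"
  shows "\<forall>\<^sub>F n in sequentially. P n \<longleftrightarrow> l > 1/2"
proof -
  have "\<forall>\<^sub>F n in sequentially. dist (of_bool (P n)) l < 1/4"
    using tendstoD[OF assms, of "1/4"] by simp
  then obtain N where N: "\<And>n. n \<ge> N \<Longrightarrow> dist (of_bool (P n)) l < 1/4"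
    by (auto simp: eventually_sequentially)
  have "P n \<longleftrightarrow> l > 1/2" if "n \<ge> N" for n
    using N[OF that] by (cases "P n") (auto simp: dist_real_def abs_if split: if_splits)
  then show ?thesis by (auto simp: eventually_sequentially)
qed

text \<open>In \<open>sep\<close> the finite set \<open>F\<close> is chosen before \<open>n\<close>:
  the same names of separators work in all trees, although the points they name vary.\<close>

locale type_limit =
  fixes k :: nat and T :: "nat \<Rightarrow> 'a colored_structure" and \<mu> :: "nat \<Rightarrow> 'a measure"
    and y :: "nat \<Rightarrow> nat \<Rightarrow> 'a" and \<rho> :: "(bit \<Rightarrow> bool) measure"
  assumes fin: "\<And>n. finite_weighted_tree_semilattice k (T n) (\<mu> n)"
    and y_in: "\<And>n i. y n i \<in> domain_of (T n)"
    and sep: "\<And>e. e > 0 \<Longrightarrow> \<exists>F. finite F \<and> (\<forall>n. \<forall>x\<in>domain_of (T n).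
      measure (\<mu> n) {x'\<in>domain_of (T n).
        \<not> separated (meet (T n)) (eval_term (T n) (y n) ` F) x x'} \<le> e)"
    and prob_\<rho>: "prob_space \<rho>"
    and sets_\<rho> [measurable_cong]: "sets \<rho> = sets (PiM UNIV (\<lambda>_. count_space UNIV))"
    and lim: "\<And>F s. finite F \<Longrightarrow>
      (\<lambda>n. measure (\<mu> n) {x \<in> domain_of (T n). \<forall>b\<in>F. holds (T n) (y n) x b = s b})
        \<longlonglongrightarrow> measure \<rho> {q. \<forall>b\<in>F. q b = s b}"
begin

abbreviation "z n \<equiv> eval_term (T n) (y n)"
abbreviation "dm n \<equiv> domain_of (T n)"
abbreviation "mt n \<equiv> meet (T n)"
abbreviation "leq n \<equiv> tle (meet (T n))"

lemma tree: "tree_semilattice (dm n) (mt n)"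
  and prob_\<mu>: "prob_space (\<mu> n)"
  and space_\<mu>: "space (\<mu> n) = dm n"
  and sets_\<mu>: "sets (\<mu> n) = Pow (dm n)"
  using fin[of n]
  by (auto simp: finite_weighted_tree_semilattice_def colored_tree_semilattice_def)

lemma space_\<rho>: "space \<rho> = UNIV"
  using sets_eq_imp_space_eq[OF sets_\<rho>] by (simp add: space_PiM)

lemma z_in: "z n t \<in> dm n"
  by (induction t) (use y_in tree_semilattice.closed[OF tree] in auto)

definition LE :: "qf_term \<Rightarrow> qf_term \<Rightarrow> bool" where
  "LE s t \<longleftrightarrow> (\<forall>\<^sub>F n in sequentially. leq n (z n s) (z n t))"

definition CA :: "nat \<Rightarrow> qf_term \<Rightarrow> bool" where
  "CA i t \<longleftrightarrow> (\<forall>\<^sub>F n in sequentially. z n t \<in> color (T n) i)"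

text \<open>A bit that ignores the point has probability 0 or 1, so convergence of these
  probabilities makes its truth value eventually constant.\<close>

lemma eventually_const_bit:
  assumes "\<And>n x. x \<in> dm n \<Longrightarrow> holds (T n) (y n) x b \<longleftrightarrow> P n"
  shows "(\<forall>\<^sub>F n in sequentially. P n \<longleftrightarrow> (\<forall>\<^sub>F n in sequentially. P n))"
proof -
  have "measure (\<mu> n) {x \<in> dm n. \<forall>b\<in>{b}. holds (T n) (y n) x b = True} = of_bool (P n)" for n
  proof -
    interpret prob_space "\<mu> n" by (rule prob_\<mu>)
    have "{x \<in> dm n. \<forall>b\<in>{b}. holds (T n) (y n) x b = True} = (if P n then space (\<mu> n) else {})"
      using assms by (auto simp: space_\<mu>)
    then show ?thesis by (auto simp: prob_space)
  qed
  with lim[of "{b}" "\<lambda>_. True"]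
  have "(\<lambda>n. of_bool (P n)) \<longlonglongrightarrow> measure \<rho> {q. \<forall>b\<in>{b}. q b = True}" by simp
  from eventually_iff_of_bool_tendsto[OF this]
  have ev: "\<forall>\<^sub>F n in sequentially. P n \<longleftrightarrow> 1 / 2 < measure \<rho> {q. \<forall>b\<in>{b}. q b = True}" (is "\<forall>\<^sub>F n in _. P n \<longleftrightarrow> ?c") .
  have "(\<forall>\<^sub>F n in sequentially. P n) \<longleftrightarrow> ?c"
  proof
    assume "\<forall>\<^sub>F n in sequentially. P n"
    from eventually_happens'[OF sequentially_bot eventually_conj[OF ev this]]
    show ?c by blast
  next
    assume ?c
    with ev show "\<forall>\<^sub>F n in sequentially. P n" by (auto elim: eventually_mono)
  qed
  with ev show ?thesis by simp
qed

lemma eventually_LE: "\<forall>\<^sub>F n in sequentially. leq n (z n s) (z n t) \<longleftrightarrow> LE s t"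
  unfolding LE_def by (rule eventually_const_bit[of "B_le s t"]) simp

lemma eventually_CA: "\<forall>\<^sub>F n in sequentially. z n t \<in> color (T n) i \<longleftrightarrow> CA i t"
  unfolding CA_def by (rule eventually_const_bit[of "B_ca i t"]) simp

lemma eventually_reflect:
  assumes "finite P"
  shows "\<forall>\<^sub>F n in sequentially. (\<forall>s\<in>P. \<forall>t\<in>P. leq n (z n s) (z n t) \<longleftrightarrow> LE s t) \<and>
    (\<forall>i<k. \<forall>t\<in>P. z n t \<in> color (T n) i \<longleftrightarrow> CA i t)"
proof -
  have "\<forall>\<^sub>F n in sequentially. \<forall>i\<in>{..<k}. \<forall>t\<in>P. z n t \<in> color (T n) i \<longleftrightarrow> CA i t"
    using assms eventually_CA by (simp add: eventually_ball_finite_distrib)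
  moreover have "\<forall>\<^sub>F n in sequentially. \<forall>s\<in>P. \<forall>t\<in>P. leq n (z n s) (z n t) \<longleftrightarrow> LE s t"
    using assms eventually_LE by (simp add: eventually_ball_finite_distrib)
  ultimately show ?thesis by eventually_elim auto
qed

lemma reflect:
  assumes "finite P"
  obtains n where "\<And>s t. s \<in> P \<Longrightarrow> t \<in> P \<Longrightarrow> leq n (z n s) (z n t) \<longleftrightarrow> LE s t"
    "\<And>i t. i < k \<Longrightarrow> t \<in> P \<Longrightarrow> z n t \<in> color (T n) i \<longleftrightarrow> CA i t"
  using eventually_happens'[OF sequentially_bot eventually_reflect[OF assms]] by blast

text \<open>Each axiom involves finitely many terms, and some \<open>T n\<close> orders and colors
  these as in the limit; there the axiom holds.\<close>

sublocale term_tree LE "\<lambda>i t. i < k \<and> CA i t"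
proof
  fix r s t :: qf_term and i :: nat
  obtain n where n: "\<And>a b. a \<in> {r, s, t, Meet s t} \<Longrightarrow> b \<in> {r, s, t, Meet s t} \<Longrightarrow> leq n (z n a) (z n b) \<longleftrightarrow> LE a b"
    "\<And>i a. i < k \<Longrightarrow> a \<in> {r, s, t, Meet s t} \<Longrightarrow> z n a \<in> color (T n) i \<longleftrightarrow> CA i a"
    using reflect[of "{r, s, t, Meet s t}"] by (metis finite.emptyI finite.insertI)
  interpret tr: tree_semilattice "dm n" "mt n" by (rule tree)
  note zz = z_in[of n r] z_in[of n s] z_in[of n t]
  show "LE t t" using n(1)[of t t] tr.le_refl zz by simp
  show "LE r s \<Longrightarrow> LE s t \<Longrightarrow> LE r t"
    using n(1)[of r s] n(1)[of s t] n(1)[of r t] tr.le_trans[of "z n r" "z n s" "z n t"] zz by simp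
  show "LE r (Meet s t) \<longleftrightarrow> LE r s \<and> LE r t"
    using n(1)[of r s] n(1)[of r t] n(1)[of r "Meet s t"] tr.le_meet_iff[of "z n s" "z n t" "z n r"] zz
    by simp
  show "LE r t \<Longrightarrow> LE s t \<Longrightarrow> LE r s \<or> LE s r"
    using n(1)[of r t] n(1)[of s t] n(1)[of r s] n(1)[of s r] tr.le_linear[of "z n r" "z n t" "z n s"] zz
    by simp
  show "LE s t \<Longrightarrow> LE t s \<Longrightarrow> (i < k \<and> CA i s) = (i < k \<and> CA i t)"
    using n(1)[of s t] n(1)[of t s] n(2)[of i s] n(2)[of i t] tr.le_antisym[of "z n s" "z n t"] zz
    by auto
qed

text \<open>Every finite part of the type is realised by actual points in arbitrarily late trees, so
  that statements about a point and finitely many terms can be verified in a finite tree.\<close>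

definition consistent :: "(bit \<Rightarrow> bool) \<Rightarrow> bool" where
  "consistent q \<longleftrightarrow> (\<forall>l N. \<exists>n\<ge>N. \<exists>x\<in>dm n. \<forall>b\<in>set l. q b = holds (T n) (y n) x b)"

text \<open>A pattern that no point realises from index \<open>N\<close> on has limit probability 0.
  Bit lists, unlike sets of bits, are countably many, so the exceptions form a null set.\<close>

lemma AE_consistent: "AE q in \<rho>. consistent q"
proof -
  have "AE q in \<rho>. \<exists>n\<ge>N. \<exists>x\<in>dm n. \<forall>b\<in>set l. q b = holds (T n) (y n) x b" for l :: "bit list" and N
  proof -
    let ?ok = "\<lambda>c. \<exists>n\<ge>N. \<exists>x\<in>dm n. \<forall>b\<in>set l. (b \<in> c) = holds (T n) (y n) x b"
    have "AE q in \<rho>. (\<forall>b\<in>set l. q b = (b \<in> c)) \<longrightarrow> ?ok c" for c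
    proof (cases "?ok c")
      case False
      let ?A = "{q. \<forall>b\<in>set l. q b = (b \<in> c)}"
      have A: "?A \<in> sets \<rho>"
        unfolding sets_\<rho> by (rule sets_bit_pattern) simp
      have "\<forall>\<^sub>F n in sequentially. measure (\<mu> n) {x \<in> dm n. \<forall>b\<in>set l. holds (T n) (y n) x b = (b \<in> c)} = 0"
        using False unfolding eventually_sequentially
        by (intro exI[of _ N]) (auto intro!: arg_cong[where f="measure _" and y="{}", simplified])
      then have "(\<lambda>n. measure (\<mu> n) {x \<in> dm n. \<forall>b\<in>set l. holds (T n) (y n) x b = (b \<in> c)}) \<longlonglongrightarrow> 0"
        by (rule tendsto_eventually)
      then have "measure \<rho> ?A = 0"
        using lim[of "set l" "\<lambda>b. b \<in> c"] LIMSEQ_unique by fastforce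
      then have "emeasure \<rho> ?A = 0"
        by (simp add: finite_measure.emeasure_eq_measure[OF prob_space.finite_measure[OF prob_\<rho>]])
      then have "AE q in \<rho>. q \<notin> ?A"
        using A by (intro AE_not_in) (auto simp: null_sets_def)
      then show ?thesis by eventually_elim auto
    qed simp
    then have "AE q in \<rho>. \<forall>c\<in>Pow (set l). (\<forall>b\<in>set l. q b = (b \<in> c)) \<longrightarrow> ?ok c"
      by (intro AE_finite_allI) auto
    then show ?thesis
    proof eventually_elim
      case (elim q)
      from elim[rule_format, of "{b\<in>set l. q b}"] show ?case by auto
    qed
  qed
  then show ?thesis unfolding consistent_def by (simp add: AE_all_countable)
qed

lemma consistent_reflect:
  assumes "consistent q" "finite F" "finite P"
  obtains n x where "x \<in> dm n" "\<And>b. b \<in> F \<Longrightarrow> q b = holds (T n) (y n) x b"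
    "\<And>s t. s \<in> P \<Longrightarrow> t \<in> P \<Longrightarrow> leq n (z n s) (z n t) \<longleftrightarrow> LE s t"
    "\<And>i t. i < k \<Longrightarrow> t \<in> P \<Longrightarrow> z n t \<in> color (T n) i \<longleftrightarrow> CA i t"
proof -
  obtain l where l: "set l = F" using finite_list[OF assms(2)] by blast
  obtain N where N: "\<forall>n\<ge>N. (\<forall>s\<in>P. \<forall>t\<in>P. leq n (z n s) (z n t) \<longleftrightarrow> LE s t) \<and>
    (\<forall>i<k. \<forall>t\<in>P. z n t \<in> color (T n) i \<longleftrightarrow> CA i t)"
    using eventually_reflect[OF assms(3)] unfolding eventually_sequentially by blast
  obtain n x where "n \<ge> N" "x \<in> dm n" "\<forall>b\<in>F. q b = holds (T n) (y n) x b"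
    using assms(1) l unfolding consistent_def by blast
  with N that show ?thesis by blast
qed

definition below :: "(bit \<Rightarrow> bool) \<Rightarrow> qf_term set" where
  "below q = {t. q (B_up t)}"

text \<open>When the points of a pattern are pairwise inseparable, all of them lie in the
  exceptional set of any one of them. This bounds their mass in \<open>T n\<close>, and the bound
  survives in the limit.\<close>

lemma inseparable_pattern:
  assumes F: "\<And>n x. x \<in> dm n \<Longrightarrow> measure (\<mu> n) {x'\<in>dm n. \<not> separated (mt n) (z n ` F) x x'} \<le> e"
    and "finite Q" "e \<ge> 0"
    and insep: "\<forall>\<^sub>F n in sequentially. \<forall>x\<in>dm n. \<forall>x'\<in>dm n.
      (\<forall>b\<in>Q. holds (T n) (y n) x b = s b) \<longrightarrow> (\<forall>b\<in>Q. holds (T n) (y n) x' b = s b) \<longrightarrow>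
      \<not> separated (mt n) (z n ` F) x x'"
  shows "measure \<rho> {q. \<forall>b\<in>Q. q b = s b} \<le> e"
proof (rule tendsto_upperbound[OF lim])
  show "\<forall>\<^sub>F n in sequentially. measure (\<mu> n) {x \<in> dm n. \<forall>b\<in>Q. holds (T n) (y n) x b = s b} \<le> e"
    using insep
  proof eventually_elim
    case (elim n)
    interpret prob_space "\<mu> n" by (rule prob_\<mu>)
    let ?A = "{x \<in> dm n. \<forall>b\<in>Q. holds (T n) (y n) x b = s b}"
    show ?case
    proof (cases "?A = {}")
      case False
      then obtain x where x: "x \<in> ?A" by blast
      have "prob ?A \<le> prob {x'\<in>dm n. \<not> separated (mt n) (z n ` F) x x'}"
        using elim x by (intro finite_measure_mono) (auto simp: sets_\<mu>)
      also have "\<dots> \<le> e" using F x by auto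
      finally show ?thesis .
    next
      case True
      show ?thesis unfolding True using \<open>e \<ge> 0\<close> by simp
    qed
  qed
qed (use assms in auto)

end

lemma measure_eq_0I:
  assumes "\<And>e::real. e > 0 \<Longrightarrow> measure M A \<le> e"
  shows "measure M A = 0"
proof (rule ccontr)
  assume "measure M A \<noteq> 0"
  then have "measure M A > 0" using measure_nonneg[of M A] by linarith
  then show False using assms[of "measure M A / 2"] by simp
qed

section \<open>Properties of consistent types, read off in finite trees; null sets of types\<close>

context type_limit begin

context
  fixes q assumes cons: "consistent q"
begin

lemma up_down: "q (B_up t) \<Longrightarrow> LE s t \<Longrightarrow> q (B_up s)"
proof -
  assume "q (B_up t)" "LE s t"
  obtain n x where n: "x \<in> dm n" "\<And>b. b \<in> {B_up t, B_up s} \<Longrightarrow> q b = holds (T n) (y n) x b"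
    "\<And>a b. a \<in> {s, t} \<Longrightarrow> b \<in> {s, t} \<Longrightarrow> leq n (z n a) (z n b) \<longleftrightarrow> LE a b"
    using consistent_reflect[OF cons, of "{B_up t, B_up s}" "{s, t}"] by (metis finite.emptyI finite.insertI)
  interpret tr: tree_semilattice "dm n" "mt n" by (rule tree)
  show "q (B_up s)"
    using n(2)[of "B_up t"] n(2)[of "B_up s"] n(3)[of s t] \<open>q (B_up t)\<close> \<open>LE s t\<close> tr.le_trans z_in n(1) by auto
qed

lemma up_chain: "q (B_up t) \<Longrightarrow> q (B_up s) \<Longrightarrow> LE s t \<or> LE t s"
proof -
  assume *: "q (B_up t)" "q (B_up s)"
  obtain n x where n: "x \<in> dm n" "\<And>b. b \<in> {B_up t, B_up s} \<Longrightarrow> q b = holds (T n) (y n) x b"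
    "\<And>a b. a \<in> {s, t} \<Longrightarrow> b \<in> {s, t} \<Longrightarrow> leq n (z n a) (z n b) \<longleftrightarrow> LE a b"
    using consistent_reflect[OF cons, of "{B_up t, B_up s}" "{s, t}"] by (metis finite.emptyI finite.insertI)
  interpret tr: tree_semilattice "dm n" "mt n" by (rule tree)
  show "LE s t \<or> LE t s"
    using n(2)[of "B_up t"] n(2)[of "B_up s"] n(3)[of s t] n(3)[of t s] * tr.le_linear[of "z n s" x "z n t"] z_in n(1) by auto
qed

lemma ideal_below: "ideal (below q)"
  unfolding ideal_def below_def using up_down up_chain by blast

text \<open>A term \<open>s'\<close> below the point and not strictly below \<open>t\<close>
  determines the meet with \<open>t\<close>: this meet and \<open>s'\<close> are both below the
  point, and either way of comparing them puts the meet below \<open>s'\<close>. Hence it is the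
  meet of \<open>s'\<close> and \<open>t\<close>.\<close>

lemma ml_below:
  assumes "q (B_up s')" "LE s' t \<Longrightarrow> LE t s'"
  shows "q (B_ml t s) \<longleftrightarrow> LE (Meet s' t) s"
    and "i < k \<Longrightarrow> q (B_cm i t) \<longleftrightarrow> CA i (Meet s' t)"
proof -
  obtain n x where n: "x \<in> dm n"
    "\<And>b. b \<in> {B_up s', B_ml t s, B_cm i t} \<Longrightarrow> q b = holds (T n) (y n) x b"
    "\<And>a b. a \<in> {s, t, s', Meet s' t} \<Longrightarrow> b \<in> {s, t, s', Meet s' t} \<Longrightarrow> leq n (z n a) (z n b) \<longleftrightarrow> LE a b"
    "\<And>i a. i < k \<Longrightarrow> a \<in> {s, t, s', Meet s' t} \<Longrightarrow> z n a \<in> color (T n) i \<longleftrightarrow> CA i a"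
    by (rule consistent_reflect[OF cons, of "{B_up s', B_ml t s, B_cm i t}" "{s, t, s', Meet s' t}"]) auto
  interpret tr: tree_semilattice "dm n" "mt n" by (rule tree)
  have inT: "z n s' \<in> dm n" "z n t \<in> dm n" "mt n x (z n t) \<in> dm n"
    using z_in n(1) tr.closed by auto
  have s'x: "leq n (z n s') x" using n(2)[of "B_up s'"] assms by simp
  have "leq n (mt n x (z n t)) (z n s')"
  proof (cases "leq n (z n s') (mt n x (z n t))")
    case True
    then have "leq n (z n s') (z n t)" using tr.le_meetD inT n(1) by blast
    then have "leq n (z n t) (z n s')" using n(3) assms(2) by simp
    then show ?thesis using tr.le_trans[OF tr.meet_le2] inT n(1) by blast
  next
    case False
    then show ?thesis using tr.le_linear[OF s'x tr.meet_le1[of x "z n t"]] inT n(1) by blast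
  qed
  then have "leq n (mt n x (z n t)) (mt n (z n s') (z n t))"
    using tr.le_meetI tr.meet_le2 inT n(1) by blast
  moreover have "leq n (mt n (z n s') (z n t)) x"
    using tr.le_trans[OF tr.meet_le1[of "z n s'" "z n t"] s'x] tr.closed inT n(1) by simp
  then have "leq n (mt n (z n s') (z n t)) (mt n x (z n t))"
    using tr.le_meet_iff[of x "z n t" "mt n (z n s') (z n t)"] tr.meet_le2 tr.closed inT n(1) by simp
  ultimately have eq: "mt n x (z n t) = mt n (z n s') (z n t)"
    using tr.le_antisym tr.closed inT by blast
  show "q (B_ml t s) \<longleftrightarrow> LE (Meet s' t) s"
    using n(2)[of "B_ml t s"] n(3)[of "Meet s' t" s] eq by simp
  show "i < k \<Longrightarrow> q (B_cm i t) \<longleftrightarrow> CA i (Meet s' t)"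
    using n(2)[of "B_cm i t"] n(4)[of i "Meet s' t"] eq by simp
qed

lemma ml_bound: "q (B_ml t s) \<Longrightarrow> q (B_up r) \<Longrightarrow> LE r t \<Longrightarrow> LE r s"
proof -
  assume *: "q (B_ml t s)" "q (B_up r)" "LE r t"
  obtain n x where n: "x \<in> dm n"
    "\<And>b. b \<in> {B_up r, B_ml t s} \<Longrightarrow> q b = holds (T n) (y n) x b"
    "\<And>a b. a \<in> {s, t, r} \<Longrightarrow> b \<in> {s, t, r} \<Longrightarrow> leq n (z n a) (z n b) \<longleftrightarrow> LE a b"
    by (rule consistent_reflect[OF cons, of "{B_up r, B_ml t s}" "{s, t, r}"]) auto
  interpret tr: tree_semilattice "dm n" "mt n" by (rule tree)
  have inT: "z n s \<in> dm n" "z n t \<in> dm n" "mt n x (z n t) \<in> dm n" "z n r \<in> dm n"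
    using z_in n(1) tr.closed by auto
  have "leq n (z n r) (mt n x (z n t))"
    using tr.le_meet_iff[of x "z n t" "z n r"] n(1) n(2)[of "B_up r"] n(3)[of r t] * inT by simp
  moreover have "leq n (mt n x (z n t)) (z n s)"
    using n(2)[of "B_ml t s"] * by simp
  ultimately have "leq n (z n r) (z n s)"
    using tr.le_trans inT by blast
  then show ?thesis using n(3)[of r s] by simp
qed

text \<open>The meets of the point and of \<open>s\<close> with \<open>t\<close> lie on the chain
  below \<open>t\<close>. If the first is not below \<open>s\<close>, then it is above the second,
  which is thus below the point.\<close>

lemma not_ml_up: "\<not> q (B_ml t s) \<Longrightarrow> q (B_up (Meet s t))"
proof -
  assume *: "\<not> q (B_ml t s)"
  obtain n x where n: "x \<in> dm n"
    "\<And>b. b \<in> {B_up (Meet s t), B_ml t s} \<Longrightarrow> q b = holds (T n) (y n) x b"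
    by (rule consistent_reflect[OF cons, of "{B_up (Meet s t), B_ml t s}" "{}"]) auto
  interpret tr: tree_semilattice "dm n" "mt n" by (rule tree)
  have inT: "z n s \<in> dm n" "z n t \<in> dm n" "mt n x (z n t) \<in> dm n" "mt n (z n s) (z n t) \<in> dm n"
    using z_in n(1) tr.closed by auto
  have "\<not> leq n (mt n x (z n t)) (z n s)"
    using n(2)[of "B_ml t s"] * by simp
  then have "\<not> leq n (mt n x (z n t)) (mt n (z n s) (z n t))"
    using tr.le_meetD inT by blast
  then have "leq n (mt n (z n s) (z n t)) (mt n x (z n t))"
    using tr.le_linear[OF tr.meet_le2[of x "z n t"] tr.meet_le2[of "z n s" "z n t"]] inT n(1) by blast
  then have "leq n (mt n (z n s) (z n t)) x"
    using tr.le_meetD inT n(1) by blast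
  then show "q (B_up (Meet s t))" using n(2)[of "B_up (Meet s t)"] by simp
qed

lemma dn_ml:
  assumes "q (B_dn s)"
  shows "q (B_dn t) \<longleftrightarrow> q (B_ml s t)" and "q (B_cx i) \<longleftrightarrow> q (B_cm i s)"
proof -
  obtain n x where n: "x \<in> dm n"
    "\<And>b. b \<in> {B_dn s, B_dn t, B_ml s t, B_cx i, B_cm i s} \<Longrightarrow> q b = holds (T n) (y n) x b"
    by (rule consistent_reflect[OF cons, of "{B_dn s, B_dn t, B_ml s t, B_cx i, B_cm i s}" "{}"]) auto
  have "mt n x (z n s) = x"
    using n(2)[of "B_dn s"] assms by (simp add: tle_def)
  then show "q (B_dn t) \<longleftrightarrow> q (B_ml s t)" "q (B_cx i) \<longleftrightarrow> q (B_cm i s)"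
    using n(2)[of "B_dn t"] n(2)[of "B_ml s t"] n(2)[of "B_cx i"] n(2)[of "B_cm i s"] by simp_all
qed

lemma dn_imp_ml: "q (B_dn t) \<Longrightarrow> q (B_ml s t)"
proof -
  assume *: "q (B_dn t)"
  obtain n x where n: "x \<in> dm n"
    "\<And>b. b \<in> {B_dn t, B_ml s t} \<Longrightarrow> q b = holds (T n) (y n) x b"
    by (rule consistent_reflect[OF cons, of "{B_dn t, B_ml s t}" "{}"]) auto
  interpret tr: tree_semilattice "dm n" "mt n" by (rule tree)
  have "leq n x (z n t)" using n(2)[of "B_dn t"] * by simp
  then have "leq n (mt n x (z n s)) (z n t)"
    using tr.le_trans[OF tr.meet_le1] tr.closed z_in n(1) by blast
  then show "q (B_ml s t)" using n(2)[of "B_ml s t"] by simp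
qed

lemma dn_up:
  assumes "q (B_dn s)" "q (B_up r)"
  shows "LE r s"
  using ml_bound[of r s r] dn_imp_ml[of s r] LE_refl assms by simp

text \<open>The two bits say that the meets of the point with \<open>s\<close> and with
  \<open>t\<close> are below each other, hence equal.\<close>

lemma ml_cong:
  assumes "q (B_ml s t)" "q (B_ml t s)"
  shows "q (B_cm i s) \<longleftrightarrow> q (B_cm i t)"
proof -
  obtain n x where n: "x \<in> dm n"
    "\<And>b. b \<in> {B_ml s t, B_ml t s, B_cm i s, B_cm i t} \<Longrightarrow> q b = holds (T n) (y n) x b"
    by (rule consistent_reflect[OF cons, of "{B_ml s t, B_ml t s, B_cm i s, B_cm i t}" "{}"]) auto
  interpret tr: tree_semilattice "dm n" "mt n" by (rule tree)
  have inT: "mt n x (z n s) \<in> dm n" "mt n x (z n t) \<in> dm n"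
    using z_in n(1) tr.closed by auto
  have "leq n (mt n x (z n s)) (z n t)" "leq n (mt n x (z n t)) (z n s)"
    using n(2)[of "B_ml s t"] n(2)[of "B_ml t s"] assms by simp_all
  then have "leq n (mt n x (z n s)) (mt n x (z n t))" "leq n (mt n x (z n t)) (mt n x (z n s))"
    using tr.le_meetI tr.meet_le1 z_in n(1) inT by simp_all
  then have "mt n x (z n s) = mt n x (z n t)"
    using tr.le_antisym inT by blast
  then show ?thesis using n(2)[of "B_cm i s"] n(2)[of "B_cm i t"] by simp
qed

end

text \<open>Excludes points branching off the tree of separators between \<open>W\<close> and the next separators above
  it: two such points above the same gap would be inseparable.\<close>

definition tight_type :: "(bit \<Rightarrow> bool) \<Rightarrow> bool" where
  "tight_type q \<longleftrightarrow> (\<forall>W. q (B_up W) \<longrightarrow> (\<forall>r. q (B_up r) \<longrightarrow> LE r W) \<longrightarrow> (\<forall>t. q (B_ml t W)))"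

lemma AE_tight_type: "AE q in \<rho>. tight_type q"
proof -
  interpret P: prob_space \<rho> by (rule prob_\<rho>)
  have "AE q in \<rho>. q (B_up W) \<longrightarrow> (\<forall>r. q (B_up r) \<longrightarrow> LE r W) \<longrightarrow> q (B_ml t W)" for W t
  proof -
    let ?A = "{q. q (B_up W) \<and> (\<forall>r. q (B_up r) \<longrightarrow> LE r W) \<and> \<not> q (B_ml t W)}"
    have "{q \<in> space \<rho>. q (B_up W) \<and> (\<forall>r. q (B_up r) \<longrightarrow> LE r W) \<and> \<not> q (B_ml t W)} \<in> sets \<rho>"
      by measurable
    then have A: "?A \<in> sets \<rho>" by (simp add: space_\<rho>)
    have "measure \<rho> ?A \<le> e" if e: "e > 0" for e :: real
    proof -
      obtain F where F: "finite F" "\<And>n x. x \<in> dm n \<Longrightarrow>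
          measure (\<mu> n) {x'\<in>dm n. \<not> separated (mt n) (z n ` F) x x'} \<le> e"
        using sep[OF e] by blast
      \<comment> \<open>Finitely many bits of the event: the point is above \<open>W\<close>, its
        meet with \<open>t\<close> is not below \<open>W\<close>, and it is above no separator that
        is not below \<open>W\<close>.\<close>
      define Q where "Q = {B_up W, B_ml t W} \<union> B_up ` {r\<in>F. \<not> LE r W}"
      define s where "s b \<longleftrightarrow> b = B_up W" for b
      have "finite Q" using F by (simp add: Q_def)
      have "?A \<subseteq> {q. \<forall>b\<in>Q. q b = s b}"
        using LE_refl by (auto simp: Q_def s_def)
      then have "measure \<rho> ?A \<le> measure \<rho> {q. \<forall>b\<in>Q. q b = s b}"
        using sets_bit_pattern[OF \<open>finite Q\<close>] by (intro P.finite_measure_mono) (auto simp: sets_\<rho>)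
      also have "\<dots> \<le> e"
      proof (rule inseparable_pattern[OF F(2) \<open>finite Q\<close>])
        show "e \<ge> 0" using e by simp
        have "finite (insert W F)" using F by simp
        from eventually_reflect[OF this]
        show "\<forall>\<^sub>F n in sequentially. \<forall>x\<in>dm n. \<forall>x'\<in>dm n.
          (\<forall>b\<in>Q. holds (T n) (y n) x b = s b) \<longrightarrow> (\<forall>b\<in>Q. holds (T n) (y n) x' b = s b) \<longrightarrow>
          \<not> separated (mt n) (z n ` F) x x'"
        proof (eventually_elim, intro ballI impI notI)
          fix n x x' assume n: "(\<forall>s\<in>insert W F. \<forall>t\<in>insert W F. leq n (z n s) (z n t) \<longleftrightarrow> LE s t) \<and>
            (\<forall>i<k. \<forall>t\<in>insert W F. z n t \<in> color (T n) i \<longleftrightarrow> CA i t)"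
            and x: "x \<in> dm n" "x' \<in> dm n"
            and h: "\<forall>b\<in>Q. holds (T n) (y n) x b = s b" "\<forall>b\<in>Q. holds (T n) (y n) x' b = s b"
            and "separated (mt n) (z n ` F) x x'"
          interpret tr: tree_semilattice "dm n" "mt n" by (rule tree)
          obtain f where f: "f \<in> F" "leq n (mt n x x') (z n f)" "leq n (z n f) x \<or> leq n (z n f) x'"
            using \<open>separated _ _ x x'\<close> by (auto simp: separated_def)
          have "LE f W"
          proof (rule ccontr)
            assume "\<not> LE f W"
            then have "B_up f \<in> Q" "\<not> s (B_up f)"
              using f LE_refl by (auto simp: Q_def s_def)
            then show False using h f(3) by force
          qed
          then have fW: "leq n (z n f) (z n W)" using n f by auto
          have nW: "\<not> leq n (mt n x (z n t)) (z n W)" "\<not> leq n (mt n x' (z n t)) (z n W)"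
            using h by (auto simp: Q_def s_def)
          have c: "mt n x (z n t) \<in> dm n" "mt n x' (z n t) \<in> dm n" "mt n x x' \<in> dm n"
            "z n f \<in> dm n" "z n W \<in> dm n" "z n t \<in> dm n"
            using tr.closed z_in x by auto
          \<comment> \<open>The lower of the two meets with \<open>t\<close> is below both points,
            hence below \<open>mt n x x'\<close>; the separator would put it below
            \<open>W\<close>.\<close>
          have "leq n (mt n x (z n t)) (mt n x' (z n t)) \<or> leq n (mt n x' (z n t)) (mt n x (z n t))"
            using tr.le_linear tr.meet_le2 c x by blast
          moreover have "leq n (mt n x (z n t)) (mt n x x')" if "leq n (mt n x (z n t)) (mt n x' (z n t))"
            using tr.le_trans[OF that tr.meet_le1[of x' "z n t"]] tr.meet_le1[of x "z n t"]
              tr.le_meet_iff[of x x' "mt n x (z n t)"] c x by simp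
          moreover have "leq n (mt n x' (z n t)) (mt n x x')" if "leq n (mt n x' (z n t)) (mt n x (z n t))"
            using tr.le_trans[OF that tr.meet_le1[of x "z n t"]] tr.meet_le1[of x' "z n t"]
              tr.le_meet_iff[of x x' "mt n x' (z n t)"] c x by simp
          ultimately have "leq n (mt n x (z n t)) (mt n x x') \<or> leq n (mt n x' (z n t)) (mt n x x')"
            by blast
          moreover have "leq n (mt n x x') (z n W)"
            using tr.le_trans[OF f(2) fW] c by blast
          ultimately show False using nW tr.le_trans c by blast
        qed
      qed
      finally show ?thesis .
    qed
    then have "measure \<rho> ?A = 0" by (rule measure_eq_0I)
    then have "AE q in \<rho>. q \<notin> ?A"
      using A by (intro AE_not_in) (auto simp: null_sets_def P.emeasure_eq_measure)
    then show ?thesis by eventually_elim auto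
  qed
  then have "AE q in \<rho>. \<forall>W t. q (B_up W) \<longrightarrow> (\<forall>r. q (B_up r) \<longrightarrow> LE r W) \<longrightarrow> q (B_ml t W)"
    by (intro AE_all_countable[THEN iffD2] allI)
  then show ?thesis unfolding tight_type_def by eventually_elim blast
qed

text \<open>A finite part of a chain without maximum is not cofinal in it.\<close>

lemma ex_above_finite:
  assumes "ideal J" "\<not> principal J" "J \<noteq> {}" "finite G" "G \<subseteq> J"
  shows "\<exists>s\<in>J. \<forall>g\<in>G. \<not> LE s g"
  using assms(4,5)
proof (induction rule: finite_induct)
  case (insert f G)
  then obtain s where s: "s \<in> J" "\<forall>g\<in>G. \<not> LE s g" by auto
  show ?case
  proof (cases "LE s f")
    case True
    obtain r where r: "r \<in> J" "\<not> LE r f"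
      using assms(2) insert.prems by (auto simp: principal_def)
    then have "LE f r" using assms(1) insert.prems by (auto simp: ideal_def)
    then show ?thesis using LE_trans[OF True] LE_trans r s(2) by blast
  qed (use s in auto)
qed (use assms(3) in auto)

text \<open>Two points with the chain \<open>J\<close> below them meet above every element of
  \<open>J\<close>. A separator would itself belong to \<open>J\<close> and bound this meet, hence
  all of \<open>J\<close>, although \<open>J\<close> has no maximum.\<close>

lemma nonprincipal_null:
  assumes J: "ideal J" "\<not> principal J"
  shows "AE q in \<rho>. below q \<noteq> J"
proof -
  interpret P: prob_space \<rho> by (rule prob_\<rho>)
  let ?A = "{q. \<forall>t. q (B_up t) = (t \<in> J)}"
  have "{q \<in> space \<rho>. \<forall>t. q (B_up t) = (t \<in> J)} \<in> sets \<rho>"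
    by measurable
  then have A: "?A \<in> sets \<rho>" by (simp add: space_\<rho>)
  have "measure \<rho> ?A \<le> e" if e: "e > 0" for e :: real
  proof -
    obtain F where F: "finite F" "\<And>n x. x \<in> dm n \<Longrightarrow>
        measure (\<mu> n) {x'\<in>dm n. \<not> separated (mt n) (z n ` F) x x'} \<le> e"
      using sep[OF e] by blast
    have "finite (F \<inter> J)" using F by simp
    \<comment> \<open>Finitely many bits must suffice: \<open>r\<close> is an element of
      \<open>J\<close> below none of the separators in \<open>J\<close>. If \<open>J\<close> is
      empty, there are no separators in it and \<open>r\<close> is arbitrary.\<close>
    have "\<exists>r. J \<noteq> {} \<longrightarrow> r \<in> J \<and> (\<forall>f\<in>F \<inter> J. \<not> LE r f)"
      using ex_above_finite[OF J _ \<open>finite (F \<inter> J)\<close>] by blast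
    then obtain r where r: "J \<noteq> {} \<longrightarrow> r \<in> J \<and> (\<forall>f\<in>F \<inter> J. \<not> LE r f)" ..
    define Q where "Q = B_up ` insert r F"
    define s where "s b \<longleftrightarrow> (\<exists>t\<in>J. b = B_up t)" for b
    have "finite Q" using F by (simp add: Q_def)
    have "?A \<subseteq> {q. \<forall>b\<in>Q. q b = s b}"
      by (auto simp: Q_def s_def)
    then have "measure \<rho> ?A \<le> measure \<rho> {q. \<forall>b\<in>Q. q b = s b}"
      using sets_bit_pattern[OF \<open>finite Q\<close>] by (intro P.finite_measure_mono) (auto simp: sets_\<rho>)
    also have "\<dots> \<le> e"
    proof (rule inseparable_pattern[OF F(2) \<open>finite Q\<close>])
      show "e \<ge> 0" using e by simp
      have "finite (insert r F)" using F by simp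
      from eventually_reflect[OF this]
      show "\<forall>\<^sub>F n in sequentially. \<forall>x\<in>dm n. \<forall>x'\<in>dm n.
        (\<forall>b\<in>Q. holds (T n) (y n) x b = s b) \<longrightarrow> (\<forall>b\<in>Q. holds (T n) (y n) x' b = s b) \<longrightarrow>
        \<not> separated (mt n) (z n ` F) x x'"
      proof (eventually_elim, intro ballI impI notI)
        fix n x x' assume n: "(\<forall>s\<in>insert r F. \<forall>t\<in>insert r F. leq n (z n s) (z n t) \<longleftrightarrow> LE s t) \<and>
          (\<forall>i<k. \<forall>t\<in>insert r F. z n t \<in> color (T n) i \<longleftrightarrow> CA i t)"
          and x: "x \<in> dm n" "x' \<in> dm n"
          and h: "\<forall>b\<in>Q. holds (T n) (y n) x b = s b" "\<forall>b\<in>Q. holds (T n) (y n) x' b = s b"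
          and "separated (mt n) (z n ` F) x x'"
        interpret tr: tree_semilattice "dm n" "mt n" by (rule tree)
        obtain f where f: "f \<in> F" "leq n (mt n x x') (z n f)" "leq n (z n f) x \<or> leq n (z n f) x'"
          using \<open>separated _ _ x x'\<close> by (auto simp: separated_def)
        then have "f \<in> J" using h by (auto simp: Q_def s_def)
        then have "r \<in> J" "\<not> LE r f" using r f by auto
        then have "leq n (z n r) x" "leq n (z n r) x'"
          using h by (auto simp: Q_def s_def)
        then have "leq n (z n r) (mt n x x')"
          using tr.le_meetI x z_in by blast
        then have "leq n (z n r) (z n f)"
          using tr.le_trans[OF _ f(2)] tr.closed x z_in by blast
        then show False using n f \<open>\<not> LE r f\<close> by auto
      qed
    qed
    finally show ?thesis .
  qed
  then have "measure \<rho> ?A = 0" by (rule measure_eq_0I)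
  then have "AE q in \<rho>. q \<notin> ?A"
    using A by (intro AE_not_in) (auto simp: null_sets_def P.emeasure_eq_measure)
  then show ?thesis by eventually_elim (auto simp: below_def)
qed

end


section \<open>Realising a type\<close>

context term_tree begin

lemma base_in: "(down t, 0, 0) \<in> hat_dom"
  by (simp add: hat_dom_def ideal_down)

lemma down_subset_down: "down s \<subseteq> down t \<longleftrightarrow> LE s t"
  using down_subset[OF ideal_down] by (simp add: down_def)

lemma principal_down: "principal (down t)"
  using ideal_principal[OF ideal_down] by blast

lemma down_eqI: "ideal I \<Longrightarrow> t \<in> I \<Longrightarrow> (\<And>r. r \<in> I \<Longrightarrow> LE r t) \<Longrightarrow> I = down t"
  unfolding ideal_def down_def by blast

lemma hat_color_base: "(down t, 0, 0) \<in> hat_color i \<longleftrightarrow> CA i t"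
proof -
  have "(\<exists>s\<in>down t. (\<forall>r\<in>down t. LE r s) \<and> CA i s) \<longleftrightarrow> CA i t"
    unfolding down_def using CA_cong LE_refl by blast
  then show ?thesis
    using principal_down[of t] base_in[of t] by (auto simp: hat_color_def)
qed

text \<open>Counterpart of \<open>ml_below\<close> in the limit tree. The condition on
  \<open>a\<close> is for the case \<open>I = down t\<close>, where the meet keeps the larger of
  \<open>a\<close> and 0 as its tag.\<close>

lemma hat_meet_base_cut:
  assumes "ideal I" "principal I \<Longrightarrow> a = 0" "s \<in> I" "LE s t \<Longrightarrow> LE t s"
  shows "hat_meet (I, a, w) (down t, 0, 0) = (down (Meet s t), 0, 0)"
proof -
  have "I \<inter> down t = down (Meet s t)"
    using assms(1,3,4) LE_trans unfolding ideal_def down_def LE_Meet by blast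
  moreover have "I \<subset> down t \<Longrightarrow> False"
    using assms(1,3,4) unfolding ideal_def down_def by blast
  moreover have "I = down t \<Longrightarrow> a = 0"
    using assms(2) principal_down by blast
  ultimately show ?thesis by auto
qed

text \<open>When \<open>t\<close> lies beyond the whole chain, the meet is the branching point of
  the sample, which need not be the value of a term.\<close>

lemma hat_meet_base_above:
  assumes "I \<subseteq> down t" "t \<notin> I"
  shows "hat_meet (I, a, w) (down t, 0, 0) = (I, a, 0)"
proof -
  have "I \<subset> down t" using assms LE_refl by (auto simp: down_def)
  then show ?thesis by auto
qed

end

context type_limit begin

definition code :: "(nat \<Rightarrow> bool) \<Rightarrow> nat" where
  "code P = set_encode {i. i < k \<and> P i}"

lemma set_decode_code: "i \<in> set_decode (code P) \<longleftrightarrow> i < k \<and> P i"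
  by (simp add: code_def)

text \<open>Over a chain without maximum, the terms beyond the chain all have the same meet with a
  point of a tight consistent type, and the tag stores the colors of this meet. Over a principal
  chain, tag 0 makes the branching point the value of the maximal term.\<close>

definition tag :: "(bit \<Rightarrow> bool) \<Rightarrow> nat" where
  "tag q = (if principal (below q) then 0
     else code (\<lambda>i. \<exists>t. (\<forall>r. q (B_up r) \<longrightarrow> LE r t) \<and> q (B_cm i t)))"

text \<open>The integer part of \<open>pos q u\<close> encodes the colors; the uniform number \<open>u\<close> makes different samples
  of the same type differ.\<close>

definition pos :: "(bit \<Rightarrow> bool) \<Rightarrow> real \<Rightarrow> real" where
  "pos q u = (if \<exists>t. q (B_dn t) \<and> (q (B_up t) \<or> \<not> principal (below q)) then 0
     else real (code (\<lambda>i. q (B_cx i))) + u)"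

text \<open>The value \<open>({}, 0, 0)\<close> is a default for types whose lower terms do not form
  an ideal; consistent types always form one.\<close>

definition sample :: "(bit \<Rightarrow> bool) \<times> real \<Rightarrow> point" where
  "sample = (\<lambda>(q, u). if ideal (below q) then (below q, tag q, pos q u) else ({}, 0, 0))"

lemma sample_in: "sample qu \<in> hat_dom"
  by (cases qu) (auto simp: sample_def hat_dom_def ideal_def)

context
  fixes q and u :: real
  assumes cons: "consistent q" and tight: "tight_type q" and u: "0 < u" "u < 1"
begin

lemma ml_mono: "q (B_ml t r) \<Longrightarrow> LE r s \<Longrightarrow> q (B_ml t s)"
proof -
  assume *: "q (B_ml t r)" "LE r s"
  obtain n x where n: "x \<in> dm n"
    "\<And>b. b \<in> {B_ml t r, B_ml t s} \<Longrightarrow> q b = holds (T n) (y n) x b"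
    "\<And>a b. a \<in> {s, r} \<Longrightarrow> b \<in> {s, r} \<Longrightarrow> leq n (z n a) (z n b) \<longleftrightarrow> LE a b"
    by (rule consistent_reflect[OF cons, of "{B_ml t r, B_ml t s}" "{s, r}"]) auto
  interpret tr: tree_semilattice "dm n" "mt n" by (rule tree)
  show ?thesis
    using n(2)[of "B_ml t r"] n(2)[of "B_ml t s"] n(3)[of r s] *
      tr.le_trans[of "mt n x (z n t)" "z n r" "z n s"] tr.closed z_in n(1) by auto
qed

lemma sample_eq: "sample (q, u) = (below q, tag q, pos q u)"
  by (simp add: sample_def ideal_below[OF cons])

lemma tag_principal: "principal (below q) \<Longrightarrow> tag q = 0"
  by (simp add: tag_def)

lemma pos_eq_0: "pos q u = 0 \<longleftrightarrow> (\<exists>t. q (B_dn t) \<and> (q (B_up t) \<or> \<not> principal (below q)))"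
  using u by (auto simp: pos_def add_nonneg_eq_0_iff)

text \<open>If \<open>t\<close> is below the point, take \<open>s = t\<close>; if some term below
  the point is not below \<open>t\<close>, take that term. Otherwise \<open>t\<close> lies beyond
  the whole chain. These are the two ways in which a meet with \<open>t\<close> is computed.\<close>

lemma below_cases:
  obtains (cut) s where "q (B_up s)" "LE s t \<Longrightarrow> LE t s"
  | (above) "below q \<subseteq> down t" "t \<notin> below q"
  by (cases "t \<in> below q") (auto simp: below_def down_def)

text \<open>If the meet with \<open>t\<close> were not below \<open>s\<close>, then
  \<open>Meet s t\<close> would be below the point and hence the maximum of its chain; tightness
  would then put the meet with \<open>t\<close> below \<open>Meet s t\<close>.\<close>

lemma ml_above:
  assumes "below q \<subseteq> down t"
  shows "q (B_ml t s) \<longleftrightarrow> below q \<subseteq> down s"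
proof
  show "q (B_ml t s) \<Longrightarrow> below q \<subseteq> down s"
    using ml_bound[OF cons] assms by (auto simp: below_def down_def)
  assume s: "below q \<subseteq> down s"
  show "q (B_ml t s)"
  proof (rule ccontr)
    assume "\<not> q (B_ml t s)"
    then have "q (B_up (Meet s t))" by (rule not_ml_up[OF cons])
    moreover have "\<forall>r. q (B_up r) \<longrightarrow> LE r (Meet s t)"
      using s assms by (auto simp: below_def down_def LE_Meet)
    ultimately have "q (B_ml t (Meet s t))" using tight by (auto simp: tight_type_def)
    moreover have "LE (Meet s t) s" using LE_refl[of "Meet s t"] by (simp add: LE_Meet)
    ultimately show False using ml_mono \<open>\<not> q (B_ml t s)\<close> by blast
  qed
qed

lemma principal_belowE:
  assumes "principal (below q)"
  obtains W where "q (B_up W)" "below q = down W" "\<And>t. q (B_ml t W)"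
proof -
  obtain W where W: "W \<in> below q" "\<forall>s\<in>below q. LE s W"
    using assms by (auto simp: principal_def)
  show ?thesis
  proof (rule that[of W])
    show "q (B_up W)" using W by (simp add: below_def)
    show "below q = down W" using down_eqI[OF ideal_below[OF cons] W(1)] W(2) by blast
    show "q (B_ml t W)" for t using W tight by (simp add: tight_type_def below_def)
  qed
qed

lemma color_Meet_idem: "(i < k \<and> CA i (Meet s s)) \<longleftrightarrow> (i < k \<and> CA i s)"
  using CA_cong[of "Meet s s" s i] LE_refl[of "Meet s s"] LE_Meet LE_refl by blast

text \<open>Over a chain with maximum \<open>W\<close>, the meets of the point with \<open>t\<close>
  and with \<open>W\<close> coincide. Otherwise \<open>ml_above\<close> and \<open>ml_cong\<close>
  show that the colors stored in the tag do not depend on the term beyond the chain used to read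
  them.\<close>

lemma color_above:
  assumes t: "below q \<subseteq> down t" and "i < k"
  shows "(below q, tag q, 0) \<in> hat_color i \<longleftrightarrow> q (B_cm i t)"
proof (cases "principal (below q)")
  case True
  then obtain W where W: "q (B_up W)" "below q = down W" "\<And>t. q (B_ml t W)"
    by (rule principal_belowE) blast
  have "LE W t" using W(1) t by (auto simp: below_def down_def)
  have "q (B_ml W t)"
    using ml_above[of W t] t W(2) by simp
  then have "q (B_cm i t) \<longleftrightarrow> q (B_cm i W)"
    using ml_cong[OF cons] W(3) by blast
  also have "\<dots> \<longleftrightarrow> CA i W"
    using ml_below(2)[OF cons W(1) _ \<open>i < k\<close>, of W] color_Meet_idem \<open>i < k\<close> by blast
  finally show ?thesis
    using hat_color_base[of W i] W(2) tag_principal[OF True] \<open>i < k\<close> by simp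
next
  case False
  have "i \<in> set_decode (tag q) \<longleftrightarrow> (\<exists>s. (\<forall>r. q (B_up r) \<longrightarrow> LE r s) \<and> q (B_cm i s))"
    using False \<open>i < k\<close> by (simp add: tag_def set_decode_code)
  also have "\<dots> \<longleftrightarrow> q (B_cm i t)"
  proof
    assume "\<exists>s. (\<forall>r. q (B_up r) \<longrightarrow> LE r s) \<and> q (B_cm i s)"
    then obtain s where s: "below q \<subseteq> down s" "q (B_cm i s)" by (auto simp: below_def down_def)
    have "q (B_ml s t)" "q (B_ml t s)" using ml_above s t by auto
    then show "q (B_cm i t)" using ml_cong[OF cons] s by blast
  qed (use t in \<open>auto simp: below_def down_def\<close>)
  finally show ?thesis
    using False ideal_below[OF cons] by (simp add: hat_color_def hat_dom_def)
qed

lemma dn_below: "q (B_dn s) \<Longrightarrow> below q \<subseteq> down s"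
  using dn_up[OF cons] by (auto simp: below_def down_def)

section \<open>The sampled point has the bits prescribed by its type\<close>

lemma sample_up: "holds hat base (sample (q, u)) (B_up t) \<longleftrightarrow> q (B_up t)"
proof -
  have "holds hat base (sample (q, u)) (B_up t) \<longleftrightarrow> hat_le (down t, 0, 0) (sample (q, u))"
    using tle_hat[OF base_in sample_in] by (simp add: eval_base) (simp add: hat_def)
  also have "\<dots> \<longleftrightarrow> down t \<subseteq> below q"
    using tag_principal principal_down[of t] by (auto simp: sample_eq)
  also have "\<dots> \<longleftrightarrow> q (B_up t)"
    using down_subset[OF ideal_below[OF cons]] by (simp add: below_def)
  finally show ?thesis .
qed

lemma sample_meet:
  shows "q (B_up s) \<Longrightarrow> (LE s t \<Longrightarrow> LE t s) \<Longrightarrow> hat_meet (sample (q, u)) (down t, 0, 0) = (down (Meet s t), 0, 0)"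
    and "below q \<subseteq> down t \<Longrightarrow> t \<notin> below q \<Longrightarrow> hat_meet (sample (q, u)) (down t, 0, 0) = (below q, tag q, 0)"
  unfolding sample_eq
  using hat_meet_base_cut[OF ideal_below[OF cons] tag_principal, of s t] hat_meet_base_above[of "below q" t]
  by (auto simp: below_def simp del: hat_meet.simps)

lemma below_in: "(below q, tag q, w) \<in> hat_dom"
  by (simp add: hat_dom_def ideal_below[OF cons])

lemma sample_ml: "holds hat base (sample (q, u)) (B_ml t s) \<longleftrightarrow> q (B_ml t s)"
proof (cases rule: below_cases[of t])
  case (cut r)
  have "holds hat base (sample (q, u)) (B_ml t s) \<longleftrightarrow> hat_le (down (Meet r t), 0, 0) (down s, 0, 0)"
    using tle_hat[OF base_in base_in] sample_meet(1)[OF cut] by (simp add: eval_base) (simp add: hat_def)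
  also have "\<dots> \<longleftrightarrow> LE (Meet r t) s"
    using down_subset_down by auto
  finally show ?thesis using ml_below(1)[OF cons cut] by blast
next
  case above
  have "holds hat base (sample (q, u)) (B_ml t s) \<longleftrightarrow> hat_le (below q, tag q, 0) (down s, 0, 0)"
    using tle_hat[OF below_in base_in] sample_meet(2)[OF above] by (simp add: eval_base) (simp add: hat_def)
  also have "\<dots> \<longleftrightarrow> below q \<subseteq> down s"
    by auto
  finally show ?thesis using ml_above[OF above(1)] by blast
qed

lemma sample_cm:
  assumes "i < k"
  shows "holds hat base (sample (q, u)) (B_cm i t) \<longleftrightarrow> q (B_cm i t)"
proof (cases rule: below_cases[of t])
  case (cut r)
  have "holds hat base (sample (q, u)) (B_cm i t) \<longleftrightarrow> (down (Meet r t), 0, 0) \<in> hat_color i"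
    using sample_meet(1)[OF cut] by (simp add: eval_base) (simp add: hat_def)
  then show ?thesis
    using ml_below(2)[OF cons cut assms] hat_color_base[of "Meet r t" i] assms by blast
next
  case above
  have "holds hat base (sample (q, u)) (B_cm i t) \<longleftrightarrow> (below q, tag q, 0) \<in> hat_color i"
    using sample_meet(2)[OF above] by (simp add: eval_base) (simp add: hat_def)
  then show ?thesis using color_above[OF above(1) assms] by blast
qed

text \<open>If a point below \<open>t\<close> has a chain with maximum \<open>W\<close>, tightness
  puts it below \<open>W\<close>, so it is the point of \<open>W\<close> itself. Hence being below
  any term forces position 0.\<close>

lemma sample_dn: "holds hat base (sample (q, u)) (B_dn t) \<longleftrightarrow> q (B_dn t)"
proof -
  have "holds hat base (sample (q, u)) (B_dn t) \<longleftrightarrow> hat_le (sample (q, u)) (down t, 0, 0)"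
    using tle_hat[OF sample_in base_in] by (simp add: eval_base) (simp add: hat_def)
  also have "\<dots> \<longleftrightarrow> pos q u = 0 \<and> below q \<subseteq> down t"
    using tag_principal principal_down[of t] by (auto simp: sample_eq)
  also have "\<dots> \<longleftrightarrow> q (B_dn t)"
  proof
    assume t: "q (B_dn t)"
    have "pos q u = 0"
    proof (cases "principal (below q)")
      case True
      then obtain W where "q (B_up W)" "\<And>t. q (B_ml t W)"
        by (rule principal_belowE) blast
      then show ?thesis using dn_ml(1)[OF cons t] by (auto simp: pos_eq_0)
    qed (use t in \<open>auto simp: pos_eq_0\<close>)
    then show "pos q u = 0 \<and> below q \<subseteq> down t" using dn_below[OF t] by blast
  next
    assume *: "pos q u = 0 \<and> below q \<subseteq> down t"
    then obtain s where "q (B_dn s)" by (auto simp: pos_eq_0)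
    then show "q (B_dn t)" using dn_ml(1)[OF cons] ml_above[OF dn_below] * by blast
  qed
  finally show ?thesis .
qed

lemma sample_cx:
  assumes "i < k"
  shows "holds hat base (sample (q, u)) (B_cx i) \<longleftrightarrow> q (B_cx i)"
proof (cases "pos q u = 0")
  case True
  then obtain s where s: "q (B_dn s)" by (auto simp: pos_eq_0)
  have "holds hat base (sample (q, u)) (B_cx i) \<longleftrightarrow> (below q, tag q, 0) \<in> hat_color i"
    using True by (simp add: hat_def sample_eq)
  then show ?thesis using color_above[OF dn_below[OF s] assms] dn_ml(2)[OF cons s] by blast
next
  case False
  then have p: "pos q u = real (code (\<lambda>i. q (B_cx i))) + u"
    by (auto simp: pos_def split: if_splits)
  have "\<lfloor>pos q u\<rfloor> = int (code (\<lambda>i. q (B_cx i)))"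
    unfolding p using u by (intro floor_unique) auto
  then show ?thesis
    using False assms ideal_below[OF cons]
    by (simp add: hat_def sample_eq hat_color_def hat_dom_def set_decode_code)
qed

end

end


section \<open>Separated samples with equal bits\<close>

text \<open>Finitely many bits that decide all quantifier-free relations of separated samples.
  \<open>B_up (Meet s t)\<close> enters when the meet of a sample with a term is compared to another
  sample through a separator.\<close>

definition core_bits :: "nat \<Rightarrow> qf_term set \<Rightarrow> bit set" where
  "core_bits k F = (\<Union>s\<in>F. \<Union>t\<in>F. {B_up t, B_up (Meet s t), B_dn t, B_ml s t}) \<union>
     (\<Union>i<k. insert (B_cx i) (\<Union>t\<in>F. {B_cm i t}))"

lemma finite_core_bits: "finite F \<Longrightarrow> finite (core_bits k F)"
  by (simp add: core_bits_def)

text \<open>If \<open>a\<close> is below \<open>b\<close>, then \<open>a\<close> is the meet, so it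
  is below \<open>c\<close>; and \<open>c\<close>, being below \<open>a\<close> or \<open>b\<close>,
  is below \<open>b\<close>. Comparing two samples thus reduces to comparing each with a
  term.\<close>

lemma le_iff_separator:
  assumes "tree_semilattice D m" "a \<in> D" "b \<in> D" "c \<in> D" "tle m (m a b) c" "tle m c a \<or> tle m c b"
  shows "tle m a b \<longleftrightarrow> tle m a c \<and> tle m c b"
proof -
  interpret tree_semilattice D m by fact
  have "tle m a c" "tle m c b" if "tle m a b"
  proof -
    have "m a b = a" using that by (simp add: tle_def)
    then show "tle m a c" using assms by simp
    then show "tle m c b" using assms le_trans[OF _ that] by auto
  qed
  then show ?thesis using le_trans assms by blast
qed

lemma meet_le_iff_separator:
  assumes "tree_semilattice D m" "a \<in> D" "b \<in> D" "c \<in> D" "e \<in> D"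
    "tle m (m a b) c" "tle m c a \<or> tle m c b"
  shows "tle m (m a e) b \<longleftrightarrow> tle m (m a e) c \<and> tle m (m e c) b"
proof
  interpret tree_semilattice D m by fact
  note D = assms(2-5) closed
  {
    assume *: "tle m (m a e) b"
    then have "tle m (m a e) (m a b)" using D meet_le1 by (simp add: le_meet_iff)
    then have "tle m (m a e) c" using le_trans[OF _ assms(6)] D by simp
    moreover have "tle m (m e c) b"
      using assms(7)
    proof
      assume "tle m c a"
      then have "tle m (m e c) a" using le_trans[OF meet_le2] D by simp
      then have "tle m (m e c) (m a e)" using D meet_le1 by (simp add: le_meet_iff)
      then show ?thesis using le_trans[OF _ *] D by simp
    next
      assume "tle m c b"
      then show ?thesis using le_trans[OF meet_le2] D by simp
    qed
    ultimately show "tle m (m a e) c \<and> tle m (m e c) b" ..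
  next
    assume *: "tle m (m a e) c \<and> tle m (m e c) b"
    then have "tle m (m a e) (m e c)" using D meet_le2 by (simp add: le_meet_iff)
    then show "tle m (m a e) b" using le_trans * D by blast
  }
qed

lemma meet_eq_separator:
  assumes "tree_semilattice D m" "a \<in> D" "b \<in> D" "c \<in> D" "tle m (m a b) c" "tle m c b"
  shows "m a b = m a c"
proof -
  interpret tree_semilattice D m by fact
  note D = assms(2-4) closed
  have "tle m (m a c) b" using le_trans[OF meet_le2 assms(6)] D by simp
  then show ?thesis
    using D assms meet_le1 by (intro le_antisym) (simp_all add: le_meet_iff)
qed

text \<open>The meets of \<open>a\<close> with \<open>b\<close> and with \<open>c\<close> lie on the
  chain below \<open>a\<close>, so the triple meet is the smaller of them. Meets of any number of
  points thus reduce to meets of two.\<close>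

lemma meet_meet_cases:
  assumes "tree_semilattice D m" "a \<in> D" "b \<in> D" "c \<in> D"
  shows "m (m a b) c = (if tle m (m a b) c then m a b else m a c)"
proof -
  interpret tree_semilattice D m by fact
  have D: "a \<in> D" "b \<in> D" "c \<in> D" "m a b \<in> D" "m a c \<in> D" "m (m a b) c \<in> D"
    using assms closed by simp_all
  have "m (m a b) c = m a c" if "\<not> tle m (m a b) c"
  proof -
    have "\<not> tle m (m a b) (m a c)" using that le_meetD(2)[of "m a b" a c] D by blast
    then have "tle m (m a c) (m a b)"
      using le_linear[OF meet_le1[of a b] meet_le1[of a c]] D by simp
    then have "tle m (m a c) (m (m a b) c)"
      by (rule le_meetI[OF _ meet_le2]) (use D in simp_all)
    moreover have "tle m (m (m a b) c) (m a c)"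
      by (rule le_meetI[OF le_trans[OF meet_le1 meet_le1] meet_le2]) (use D in simp_all)
    ultimately show ?thesis using le_antisym D by simp
  qed
  then show ?thesis by (simp add: tle_def)
qed

lemma meet_eq_iff:
  assumes "tree_semilattice D m" "a \<in> D" "b \<in> D" "c \<in> D" "d \<in> D"
  shows "m a b = m c d \<longleftrightarrow> tle m (m a b) c \<and> tle m (m a b) d \<and> tle m (m c d) a \<and> tle m (m c d) b"
proof
  interpret tree_semilattice D m by fact
  show "tle m (m a b) c \<and> tle m (m a b) d \<and> tle m (m c d) a \<and> tle m (m c d) b" if "m a b = m c d"
    using that meet_le1[of a b] meet_le2[of a b] meet_le1[of c d] meet_le2[of c d] assms by simp
  show "m a b = m c d" if "tle m (m a b) c \<and> tle m (m a b) d \<and> tle m (m c d) a \<and> tle m (m c d) b"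
    using that assms closed by (intro le_antisym le_meetI) simp_all
qed

locale matching_samples =
  S: tree_semilattice "domain_of S" "meet S" + S': tree_semilattice "domain_of S'" "meet S'"
  for S :: "'a colored_structure" and S' :: "'b colored_structure" +
  fixes k p :: nat and F :: "qf_term set" and y v :: "nat \<Rightarrow> 'a" and y' v' :: "nat \<Rightarrow> 'b"
  assumes y: "y i \<in> domain_of S" and y': "y' i \<in> domain_of S'"
    and v: "i < p \<Longrightarrow> v i \<in> domain_of S" and v': "i < p \<Longrightarrow> v' i \<in> domain_of S'"
    and match: "i < p \<Longrightarrow> b \<in> core_bits k F \<Longrightarrow> holds S y (v i) b \<longleftrightarrow> holds S' y' (v' i) b"
    and sep: "i < p \<Longrightarrow> j < p \<Longrightarrow> i \<noteq> j \<Longrightarrow> separated (meet S) (eval_term S y ` F) (v i) (v j)"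
    and sep': "i < p \<Longrightarrow> j < p \<Longrightarrow> i \<noteq> j \<Longrightarrow> separated (meet S') (eval_term S' y' ` F) (v' i) (v' j)"
begin

abbreviation "z \<equiv> eval_term S y"
abbreviation "z' \<equiv> eval_term S' y'"

lemma z: "z t \<in> domain_of S" and z': "z' t \<in> domain_of S'"
  by (induction t) (simp_all add: y y' S.closed S'.closed)

lemma match_up: "i < p \<Longrightarrow> t \<in> F \<Longrightarrow> S.le (z t) (v i) \<longleftrightarrow> S'.le (z' t) (v' i)"
  using match[of i "B_up t"] by (auto simp: core_bits_def)

lemma match_up_Meet:
  "i < p \<Longrightarrow> s \<in> F \<Longrightarrow> t \<in> F \<Longrightarrow> S.le (meet S (z s) (z t)) (v i) \<longleftrightarrow> S'.le (meet S' (z' s) (z' t)) (v' i)"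
  using match[of i "B_up (Meet s t)"] by (auto simp: core_bits_def)

lemma match_dn: "i < p \<Longrightarrow> t \<in> F \<Longrightarrow> S.le (v i) (z t) \<longleftrightarrow> S'.le (v' i) (z' t)"
  using match[of i "B_dn t"] by (auto simp: core_bits_def)

lemma match_ml:
  "i < p \<Longrightarrow> s \<in> F \<Longrightarrow> t \<in> F \<Longrightarrow> S.le (meet S (v i) (z s)) (z t) \<longleftrightarrow> S'.le (meet S' (v' i) (z' s)) (z' t)"
  using match[of i "B_ml s t"] by (auto simp: core_bits_def)

lemma match_cx: "i < p \<Longrightarrow> c < k \<Longrightarrow> v i \<in> color S c \<longleftrightarrow> v' i \<in> color S' c"
  using match[of i "B_cx c"] by (auto simp: core_bits_def)

lemma match_cm:
  "i < p \<Longrightarrow> c < k \<Longrightarrow> t \<in> F \<Longrightarrow> meet S (v i) (z t) \<in> color S c \<longleftrightarrow> meet S' (v' i) (z' t) \<in> color S' c"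
  using match[of i "B_cm c t"] by (auto simp: core_bits_def)

text \<open>The two structures may separate a pair by different terms \<open>t\<close> and
  \<open>r\<close>. In \<open>S\<close> the meet of \<open>v i\<close> with \<open>z r\<close> is
  below \<open>v j\<close>, hence below \<open>z t\<close>; this is a bit and passes to
  \<open>S'\<close>, where \<open>z' r\<close> bounds the meet of the pair.\<close>

lemma common_separator_aux:
  assumes ij: "i < p" "j < p" and t: "t \<in> F" "S.le (meet S (v i) (v j)) (z t)"
    and r: "r \<in> F" "S'.le (meet S' (v' i) (v' j)) (z' r)" "S'.le (z' r) (v' j)"
  shows "S'.le (meet S' (v' i) (v' j)) (z' t)"
proof -
  have d: "v i \<in> domain_of S" "v j \<in> domain_of S" "v' i \<in> domain_of S'" "v' j \<in> domain_of S'"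
    using v v' ij by auto
  have "S.le (z r) (v j)" using match_up r ij by simp
  from S.le_trans[OF S.meet_le2 this] have "S.le (meet S (v i) (z r)) (v j)"
    using d z S.closed by simp
  then have "S.le (meet S (v i) (z r)) (meet S (v i) (v j))"
    using d z S.closed S.meet_le1 by (simp add: S.le_meet_iff)
  from S.le_trans[OF this t(2)] have "S.le (meet S (v i) (z r)) (z t)"
    using d z S.closed by simp
  then have "S'.le (meet S' (v' i) (z' r)) (z' t)" using match_ml r t ij by simp
  moreover have "S'.le (meet S' (v' i) (v' j)) (meet S' (v' i) (z' r))"
    using r d z' S'.closed S'.meet_le1 by (simp add: S'.le_meet_iff)
  ultimately show ?thesis
    using S'.le_trans d z' S'.closed by metis
qed

lemma common_separator:
  assumes ij: "i < p" "j < p" "i \<noteq> j"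
  obtains t where "t \<in> F" "S.le (meet S (v i) (v j)) (z t)" "S'.le (meet S' (v' i) (v' j)) (z' t)"
    "S.le (z t) (v i) \<and> S'.le (z' t) (v' i) \<or> S.le (z t) (v j) \<and> S'.le (z' t) (v' j)"
proof -
  have d: "v i \<in> domain_of S" "v j \<in> domain_of S" "v' i \<in> domain_of S'" "v' j \<in> domain_of S'"
    using v v' ij by auto
  obtain t where t: "t \<in> F" "S.le (meet S (v i) (v j)) (z t)" "S.le (z t) (v i) \<or> S.le (z t) (v j)"
    using sep[OF ij] by (auto simp: separated_def)
  obtain r where r: "r \<in> F" "S'.le (meet S' (v' i) (v' j)) (z' r)" "S'.le (z' r) (v' i) \<or> S'.le (z' r) (v' j)"
    using sep'[OF ij] by (auto simp: separated_def)
  have "S'.le (meet S' (v' i) (v' j)) (z' t)"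
    using r(3)
  proof
    assume "S'.le (z' r) (v' j)"
    then show ?thesis using common_separator_aux[of i j t r] ij t r by simp
  next
    assume "S'.le (z' r) (v' i)"
    moreover have "meet S (v j) (v i) = meet S (v i) (v j)" "meet S' (v' j) (v' i) = meet S' (v' i) (v' j)"
      using S.comm S'.comm d by auto
    ultimately show ?thesis using common_separator_aux[of j i t r] ij t r by simp
  qed
  then show ?thesis using that[of t] t match_up ij by blast
qed

lemma match_le:
  assumes "i < p" "l < p"
  shows "S.le (v i) (v l) \<longleftrightarrow> S'.le (v' i) (v' l)"
proof (cases "i = l")
  case True
  then show ?thesis using S.le_refl S'.le_refl v v' assms by simp
next
  case False
  then obtain r where r: "r \<in> F" "S.le (meet S (v i) (v l)) (z r)" "S'.le (meet S' (v' i) (v' l)) (z' r)"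
    "S.le (z r) (v i) \<and> S'.le (z' r) (v' i) \<or> S.le (z r) (v l) \<and> S'.le (z' r) (v' l)"
    using common_separator[OF assms] by metis
  then have "S.le (v i) (v l) \<longleftrightarrow> S.le (v i) (z r) \<and> S.le (z r) (v l)"
    using le_iff_separator[OF S.tree_semilattice_axioms, of "v i" "v l" "z r"] v z assms by blast
  moreover have "S'.le (v' i) (v' l) \<longleftrightarrow> S'.le (v' i) (z' r) \<and> S'.le (z' r) (v' l)"
    using r le_iff_separator[OF S'.tree_semilattice_axioms, of "v' i" "v' l" "z' r"] v' z' assms by blast
  ultimately show ?thesis using match_dn match_up r assms by simp
qed

lemma match_meet_z_le:
  assumes "i < p" "l < p" "t \<in> F"
  shows "S.le (meet S (v i) (z t)) (v l) \<longleftrightarrow> S'.le (meet S' (v' i) (z' t)) (v' l)"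
proof (cases "i = l")
  case True
  then show ?thesis using S.meet_le1 S'.meet_le1 v v' z z' assms by simp
next
  case False
  then obtain r where r: "r \<in> F" "S.le (meet S (v i) (v l)) (z r)" "S'.le (meet S' (v' i) (v' l)) (z' r)"
    "S.le (z r) (v i) \<and> S'.le (z' r) (v' i) \<or> S.le (z r) (v l) \<and> S'.le (z' r) (v' l)"
    using common_separator[OF assms(1,2)] by metis
  then have "S.le (meet S (v i) (z t)) (v l) \<longleftrightarrow>
      S.le (meet S (v i) (z t)) (z r) \<and> S.le (meet S (z t) (z r)) (v l)"
    using meet_le_iff_separator[OF S.tree_semilattice_axioms, of "v i" "v l" "z r" "z t"] v z assms by blast
  moreover have "S'.le (meet S' (v' i) (z' t)) (v' l) \<longleftrightarrow>
      S'.le (meet S' (v' i) (z' t)) (z' r) \<and> S'.le (meet S' (z' t) (z' r)) (v' l)"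
    using r meet_le_iff_separator[OF S'.tree_semilattice_axioms, of "v' i" "v' l" "z' r" "z' t"] v' z' assms by blast
  ultimately show ?thesis using match_ml match_up_Meet r assms by simp
qed

text \<open>A common separator turns the meet of two samples into the meet of one of them with the
  same term in both structures, so its relations are covered by the matching bits.\<close>

lemma meet_sample:
  assumes "i < p" "j < p"
  obtains "meet S (v i) (v j) = v i" "meet S' (v' i) (v' j) = v' i"
  | l t where "l < p" "t \<in> F" "meet S (v i) (v j) = meet S (v l) (z t)"
    "meet S' (v' i) (v' j) = meet S' (v' l) (z' t)"
proof (cases "i = j")
  case True
  then show ?thesis using that(1) S.idem S'.idem v v' assms by simp
next
  case False
  then obtain t where t: "t \<in> F" "S.le (meet S (v i) (v j)) (z t)" "S'.le (meet S' (v' i) (v' j)) (z' t)"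
    "S.le (z t) (v i) \<and> S'.le (z' t) (v' i) \<or> S.le (z t) (v j) \<and> S'.le (z' t) (v' j)"
    using common_separator[OF assms] by metis
  note d = v[OF assms(1)] v[OF assms(2)] v'[OF assms(1)] v'[OF assms(2)]
  have comm: "meet S (v i) (v j) = meet S (v j) (v i)" "meet S' (v' i) (v' j) = meet S' (v' j) (v' i)"
    using S.comm S'.comm d by auto
  from t(4) show ?thesis
  proof
    assume "S.le (z t) (v j) \<and> S'.le (z' t) (v' j)"
    then show ?thesis
      using that(2)[of i t] assms(1) t d z z'
        meet_eq_separator[OF S.tree_semilattice_axioms, of "v i" "v j" "z t"]
        meet_eq_separator[OF S'.tree_semilattice_axioms, of "v' i" "v' j" "z' t"] by simp
  next
    assume "S.le (z t) (v i) \<and> S'.le (z' t) (v' i)"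
    then show ?thesis
      using that(2)[of j t] assms(2) t d z z' comm
        meet_eq_separator[OF S.tree_semilattice_axioms, of "v j" "v i" "z t"]
        meet_eq_separator[OF S'.tree_semilattice_axioms, of "v' j" "v' i" "z' t"] by simp
  qed
qed

lemma match_meet_le:
  assumes "i < p" "j < p" "l < p"
  shows "S.le (meet S (v i) (v j)) (v l) \<longleftrightarrow> S'.le (meet S' (v' i) (v' j)) (v' l)"
  by (rule meet_sample[OF assms(1,2)]) (simp_all add: match_le match_meet_z_le assms)

lemma match_meet_color:
  assumes "i < p" "j < p" "c < k"
  shows "meet S (v i) (v j) \<in> color S c \<longleftrightarrow> meet S' (v' i) (v' j) \<in> color S' c"
  by (rule meet_sample[OF assms(1,2)]) (simp_all add: match_cx match_cm assms)

lemma meet_three: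
  assumes "i < p" "j < p" "l < p"
  obtains b where "b < p" "meet S (meet S (v i) (v j)) (v l) = meet S (v i) (v b)"
    "meet S' (meet S' (v' i) (v' j)) (v' l) = meet S' (v' i) (v' b)"
  using that[of j] that[of l] assms match_meet_le[OF assms]
    meet_meet_cases[OF S.tree_semilattice_axioms, of "v i" "v j" "v l"]
    meet_meet_cases[OF S'.tree_semilattice_axioms, of "v' i" "v' j" "v' l"] v v' by metis

lemma eval_sample:
  "wf_term p t \<Longrightarrow> \<exists>i<p. \<exists>j<p. eval_term S v t = meet S (v i) (v j) \<and> eval_term S' v' t = meet S' (v' i) (v' j)"
proof (induction t)
  case (Var i)
  then show ?case
    by (intro exI[of _ i] conjI) (simp_all add: S.idem S'.idem v v')
next
  case (Meet s t)
  obtain i j where ij: "i < p" "j < p" "eval_term S v s = meet S (v i) (v j)" "eval_term S' v' s = meet S' (v' i) (v' j)"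
    using Meet by auto
  obtain a b where ab: "a < p" "b < p" "eval_term S v t = meet S (v a) (v b)" "eval_term S' v' t = meet S' (v' a) (v' b)"
    using Meet by auto
  obtain c where c: "c < p" "meet S (meet S (v i) (v j)) (v a) = meet S (v i) (v c)"
    "meet S' (meet S' (v' i) (v' j)) (v' a) = meet S' (v' i) (v' c)"
    using meet_three ij ab by metis
  obtain e where e: "e < p" "meet S (meet S (v i) (v c)) (v b) = meet S (v i) (v e)"
    "meet S' (meet S' (v' i) (v' c)) (v' b) = meet S' (v' i) (v' e)"
    using meet_three ij ab c by metis
  have "eval_term S v (Meet s t) = meet S (v i) (v e)"
    using S.assoc[of "meet S (v i) (v j)" "v a" "v b"] S.closed v ij ab c e by simp
  moreover have "eval_term S' v' (Meet s t) = meet S' (v' i) (v' e)"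
    using S'.assoc[of "meet S' (v' i) (v' j)" "v' a" "v' b"] S'.closed v' ij ab c e by simp
  ultimately show ?case using ij e by blast
qed

lemma match_sat: "wf_formula k p \<phi> \<Longrightarrow> sat S v \<phi> \<longleftrightarrow> sat S' v' \<phi>"
proof (induction \<phi>)
  case (Eq s t)
  obtain i j where ij: "i < p" "j < p" "eval_term S v s = meet S (v i) (v j)" "eval_term S' v' s = meet S' (v' i) (v' j)"
    using Eq eval_sample[of s] by auto
  obtain a b where ab: "a < p" "b < p" "eval_term S v t = meet S (v a) (v b)" "eval_term S' v' t = meet S' (v' a) (v' b)"
    using Eq eval_sample[of t] by auto
  show ?case
    using match_meet_le ij ab v v' meet_eq_iff[OF S.tree_semilattice_axioms, of "v i" "v j" "v a" "v b"]
      meet_eq_iff[OF S'.tree_semilattice_axioms, of "v' i" "v' j" "v' a" "v' b"] by simp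
next
  case (Color c t)
  then show ?case using eval_sample[of t] match_meet_color by auto
qed auto

end


section \<open>Measurability of the limit tree\<close>

context term_tree begin

text \<open>Chains become 0/1 functions on the countably many terms, in a countable product of real
  lines.\<close>

definition emb :: "point \<Rightarrow> (qf_term \<Rightarrow> real) \<times> real \<times> real" where
  "emb x = (\<lambda>t. of_bool (t \<in> fst x), real (fst (snd x)), snd (snd x))"

definition hat_space :: "point measure" where
  "hat_space = vimage_algebra hat_dom emb borel"

lemma inj_emb: "inj_on emb A"
proof (rule inj_onI)
  fix x y assume "emb x = emb y"
  then have "(of_bool (t \<in> fst x) :: real) = of_bool (t \<in> fst y)" for t
    using fun_cong[of "\<lambda>t. of_bool (t \<in> fst x) :: real" "\<lambda>t. of_bool (t \<in> fst y)" t] by (simp add: emb_def)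
  then have "t \<in> fst x \<longleftrightarrow> t \<in> fst y" for t
    by (simp only: of_bool_eq_iff)
  then have "fst x = fst y" by blast
  then show "x = y" using \<open>emb x = emb y\<close> by (simp add: emb_def prod_eq_iff)
qed

lemma closed_emb: "closed (emb ` hat_dom)"
proof -
  \<comment> \<open>Downward closure says that the indicator decreases along \<open>LE\<close>,
    linearity that incomparable terms have indicators with sum at most 1; both are closed conditions
    on coordinates.\<close>
  let ?C = "{p. (\<forall>t. fst p t = 0 \<or> fst p t = 1) \<and> (\<forall>s t. LE s t \<longrightarrow> fst p t \<le> fst p s) \<and>
     (\<forall>s t. \<not> LE s t \<and> \<not> LE t s \<longrightarrow> fst p s + fst p t \<le> 1) \<and> fst (snd p) \<in> \<nat>}
     :: ((qf_term \<Rightarrow> real) \<times> real \<times> real) set"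
  have c: "continuous_on UNIV (\<lambda>p :: (qf_term \<Rightarrow> real) \<times> real \<times> real. fst p t)" for t
    by (rule continuous_on_compose2[OF continuous_on_product_coordinates[of t] continuous_on_fst[OF continuous_on_id]]) auto
  have "emb ` hat_dom = ?C"
  proof (intro equalityI subsetI)
    fix p assume "p \<in> emb ` hat_dom"
    then obtain I a w where I: "ideal I" "p = emb (I, a, w)" by (auto simp: hat_dom_def)
    have "of_bool (t \<in> I) \<le> (of_bool (s \<in> I) :: real)" if "LE s t" for s t
      using I that by (auto simp: ideal_def)
    moreover have "of_bool (s \<in> I) + of_bool (t \<in> I) \<le> (1 :: real)" if "\<not> LE s t \<and> \<not> LE t s" for s t
      using I that unfolding ideal_def by (cases "s \<in> I"; cases "t \<in> I") auto
    ultimately show "p \<in> ?C" by (auto simp: I emb_def)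
  next
    fix p assume p: "p \<in> ?C"
    then obtain a where a: "fst (snd p) = real a" by (auto elim: Nats_cases)
    define x where "x = ({t. fst p t = 1}, a, snd (snd p))"
    have "emb x = p"
      using p a by (auto simp: emb_def x_def prod_eq_iff fun_eq_iff)
    moreover have "x \<in> hat_dom"
    proof -
      have "fst p s = 1" if "fst p t = 1" "LE s t" for s t
      proof -
        have "fst p t \<le> fst p s" "fst p s = 0 \<or> fst p s = 1" using p that(2) by blast+
        then show ?thesis using that by auto
      qed
      moreover have "LE s t \<or> LE t s" if "fst p s = 1" "fst p t = 1" for s t
      proof (rule ccontr)
        assume "\<not> (LE s t \<or> LE t s)"
        then have "fst p s + fst p t \<le> 1" using p by auto
        then show False using that by simp
      qed
      ultimately show ?thesis by (auto simp: x_def hat_dom_def ideal_def)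
    qed
    ultimately show "p \<in> emb ` hat_dom" by blast
  qed
  moreover have "closed ?C"
  proof -
    have 4: "closed {p :: (qf_term \<Rightarrow> real) \<times> real \<times> real. fst (snd p) \<in> \<nat>}"
      using continuous_closed_vimage[OF closed_Nats, of "\<lambda>p :: (qf_term \<Rightarrow> real) \<times> real \<times> real. fst (snd p)"]
      by (simp add: vimage_def)
    show ?thesis
      by (intro closed_Collect_conj closed_Collect_all closed_Collect_imp closed_Collect_disj
          closed_Collect_eq closed_Collect_le open_Collect_const 4 c continuous_intros)
  qed
  ultimately show ?thesis by simp
qed

lemma space_hat [simp]: "space hat_space = hat_dom"
  by (simp add: hat_space_def)

lemma measurable_emb [measurable]: "emb \<in> borel_measurable hat_space"
  unfolding hat_space_def by (rule measurable_vimage_algebra1) auto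

lemma measurable_below [measurable]: "Measurable.pred hat_space (\<lambda>x. t \<in> fst x)"
proof -
  have "(\<lambda>p :: (qf_term \<Rightarrow> real) \<times> real \<times> real. fst p t) \<in> borel_measurable borel"
    by (intro borel_measurable_continuous_onI
        continuous_on_compose2[OF continuous_on_product_coordinates[of t] continuous_on_fst[OF continuous_on_id]]) auto
  then have [measurable]: "(\<lambda>x. fst (emb x) t) \<in> borel_measurable hat_space"
    by (rule measurable_compose[OF measurable_emb])
  have "Measurable.pred hat_space (\<lambda>x. fst (emb x) t = 1)" by measurable
  then show ?thesis by (simp add: emb_def)
qed

lemma measurable_tag [measurable]: "(\<lambda>x. real (fst (snd x))) \<in> borel_measurable hat_space"
  and measurable_pos [measurable]: "(\<lambda>x. snd (snd x)) \<in> borel_measurable hat_space"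
proof -
  have "(\<lambda>p :: (qf_term \<Rightarrow> real) \<times> real \<times> real. fst (snd p)) \<in> borel_measurable borel"
    "(\<lambda>p :: (qf_term \<Rightarrow> real) \<times> real \<times> real. snd (snd p)) \<in> borel_measurable borel"
    by (intro borel_measurable_continuous_onI continuous_intros)+
  from this[THEN measurable_compose[OF measurable_emb]]
  show "(\<lambda>x. real (fst (snd x))) \<in> borel_measurable hat_space"
    "(\<lambda>x. snd (snd x)) \<in> borel_measurable hat_space"
    by (simp_all add: emb_def)
qed

lemma measurable_hatI:
  assumes "\<And>\<omega>. \<omega> \<in> space N \<Longrightarrow> f \<omega> \<in> hat_dom" and "\<And>t. Measurable.pred N (\<lambda>\<omega>. t \<in> fst (f \<omega>))"
    and [measurable]: "(\<lambda>\<omega>. real (fst (snd (f \<omega>)))) \<in> borel_measurable N"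
      "(\<lambda>\<omega>. snd (snd (f \<omega>))) \<in> borel_measurable N"
  shows "f \<in> measurable N hat_space"
  unfolding hat_space_def
proof (rule measurable_vimage_algebra2)
  note assms(2)[measurable]
  have [measurable]: "(\<lambda>\<omega> t. of_bool (t \<in> fst (f \<omega>)) :: real) \<in> borel_measurable N"
    by (intro measurable_coordinatewise_then_product) (simp add: of_bool_def)
  show "(\<lambda>\<omega>. emb (f \<omega>)) \<in> borel_measurable N"
    unfolding emb_def by (intro borel_measurable_Pair) measurable
qed (use assms(1) in auto)

lemma measurable_meet: "(\<lambda>(x, y). hat_meet x y) \<in> measurable (hat_space \<Otimes>\<^sub>M hat_space) hat_space"
proof (rule measurable_hatI)
  let ?M = "hat_space \<Otimes>\<^sub>M hat_space"
  have f: "fst (hat_meet x y) = fst x \<inter> fst y" for x y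
    by (cases x; cases y) auto
  \<comment> \<open>Equality and inclusion of chains are written as conjunctions over the countably
    many terms, hence are measurable.\<close>
  have t: "real (fst (snd (hat_meet x y))) =
      (if \<forall>t. t \<in> fst x \<longleftrightarrow> t \<in> fst y then max (real (fst (snd x))) (real (fst (snd y)))
       else if \<forall>t. t \<in> fst x \<longrightarrow> t \<in> fst y then real (fst (snd x))
       else if \<forall>t. t \<in> fst y \<longrightarrow> t \<in> fst x then real (fst (snd y)) else 0)" for x y
    by (cases x; cases y) (auto simp: of_nat_max)
  have p: "snd (snd (hat_meet x y)) =
      (if (\<forall>t. t \<in> fst x \<longleftrightarrow> t \<in> fst y) \<and> real (fst (snd x)) = real (fst (snd y)) \<and>
         snd (snd x) = snd (snd y) then snd (snd x) else 0)" for x y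
    by (cases x; cases y) auto
  note [measurable] = measurable_compose[OF measurable_fst measurable_below]
    measurable_compose[OF measurable_snd measurable_below]
  show "Measurable.pred ?M (\<lambda>\<omega>. t \<in> fst (case \<omega> of (x, y) \<Rightarrow> hat_meet x y))" for t
    by (simp add: f split_beta)
  show "(\<lambda>\<omega>. real (fst (snd (case \<omega> of (x, y) \<Rightarrow> hat_meet x y)))) \<in> borel_measurable ?M"
    unfolding split_beta t by measurable
  show "(\<lambda>\<omega>. snd (snd (case \<omega> of (x, y) \<Rightarrow> hat_meet x y))) \<in> borel_measurable ?M"
    unfolding split_beta p by measurable
qed (auto simp: space_pair_measure hat_meet_in_dom simp del: hat_meet.simps)

lemma measurable_color: "hat_color i \<in> sets hat_space"
proof -
  have [measurable]: "Measurable.pred (count_space UNIV) (\<lambda>a :: nat. i \<in> set_decode a)" by simp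
  have [measurable]: "(\<lambda>x. fst (snd x)) \<in> measurable hat_space (count_space UNIV)"
  proof -
    have "(\<lambda>x. nat \<lfloor>real (fst (snd x))\<rfloor>) \<in> measurable hat_space (count_space UNIV)" by measurable
    then show ?thesis by simp
  qed
  have [measurable]: "Measurable.pred hat_space (\<lambda>x. principal (fst x))"
    unfolding principal_def Bex_def Ball_def by measurable
  have [measurable]: "Measurable.pred hat_space (\<lambda>x. \<exists>t\<in>fst x. (\<forall>s\<in>fst x. LE s t) \<and> CA i t)"
    unfolding Bex_def Ball_def by measurable
  have "hat_color i = {x \<in> space hat_space. if snd (snd x) \<noteq> 0 then i \<in> set_decode (nat \<lfloor>snd (snd x)\<rfloor>)
     else if principal (fst x) then \<exists>t\<in>fst x. (\<forall>s\<in>fst x. LE s t) \<and> CA i t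
     else i \<in> set_decode (fst (snd x))}"
    by (auto simp: hat_color_def) blast+
  also have "\<dots> \<in> sets hat_space"
    by measurable
  finally show ?thesis .
qed

lemma colored_hat: "colored_tree_semilattice k hat"
  using tree_hat by (auto simp: colored_tree_semilattice_def hat_def hat_color_def)

lemma pred_eq_hat: "Measurable.pred (hat_space \<Otimes>\<^sub>M hat_space) (\<lambda>p. fst p = snd p)"
  by (rule pred_eq_vimage_algebra[OF inj_emb]) (simp_all add: hat_space_def)

lemma measurable_solutions_hat:
  "wf_formula k p \<phi> \<Longrightarrow> solutions p \<phi> hat \<in> sets (PiM {..<p} (\<lambda>_. hat_space))"
  using measurable_meet by (intro measurable_solutions[OF _ pred_eq_hat])
    (auto simp: hat_def measurable_color)

lemma pred_tle_hat:
  assumes f: "f \<in> measurable N hat_space" and g: "g \<in> measurable N hat_space"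
  shows "Measurable.pred N (\<lambda>\<omega>. tle hat_meet (f \<omega>) (g \<omega>))"
proof -
  have fg: "(\<lambda>\<omega>. (f \<omega>, g \<omega>)) \<in> measurable N (hat_space \<Otimes>\<^sub>M hat_space)"
    using f g by measurable
  have "(\<lambda>\<omega>. hat_meet (f \<omega>) (g \<omega>)) \<in> measurable N hat_space"
    using measurable_compose[OF fg measurable_meet] by simp
  then have "(\<lambda>\<omega>. (hat_meet (f \<omega>) (g \<omega>), f \<omega>)) \<in> measurable N (hat_space \<Otimes>\<^sub>M hat_space)"
    using f by measurable
  from measurable_compose[OF this pred_eq_hat] show ?thesis by (simp add: tle_def)
qed

lemma pred_separated_hat:
  assumes f: "f \<in> measurable N hat_space" and g: "g \<in> measurable N hat_space" and "finite F"
  shows "Measurable.pred N (\<lambda>\<omega>. separated hat_meet (eval_term hat base ` F) (f \<omega>) (g \<omega>))"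
proof -
  have fg: "(\<lambda>\<omega>. (f \<omega>, g \<omega>)) \<in> measurable N (hat_space \<Otimes>\<^sub>M hat_space)"
    using f g by measurable
  have m: "(\<lambda>\<omega>. hat_meet (f \<omega>) (g \<omega>)) \<in> measurable N hat_space"
    using measurable_compose[OF fg measurable_meet] by simp
  have c: "(\<lambda>\<omega>. (down t, 0, 0)) \<in> measurable N hat_space" for t
    by (rule measurable_const) (simp add: hat_dom_def ideal_down)
  have eq: "separated hat_meet (eval_term hat base ` F) x y \<longleftrightarrow> (\<exists>t\<in>F. tle hat_meet (hat_meet x y) (down t, 0, 0) \<and>
      (tle hat_meet (down t, 0, 0) x \<or> tle hat_meet (down t, 0, 0) y))" for x y
    by (simp add: separated_def eval_base del: hat_meet.simps)
  show ?thesis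
    unfolding eq using \<open>finite F\<close> pred_tle_hat[OF m c] pred_tle_hat[OF c f] pred_tle_hat[OF c g]
    by measurable
qed

text \<open>A point is coded by a set of natural numbers; the markers 0, 1 and 2 keep its chain, tag
  and position apart.\<close>

lemma ex_inj_point: "\<exists>f :: point \<Rightarrow> real. inj f"
proof -
  obtain h :: "nat set \<Rightarrow> real" where h: "inj h"
    using nat_sets_eqpoll_reals eqpoll_def bij_betw_imp_inj_on by blast
  obtain r :: "real \<Rightarrow> nat set" where r: "inj r"
    using eqpoll_sym[OF nat_sets_eqpoll_reals] eqpoll_def bij_betw_imp_inj_on by blast
  define c where "c x = (\<lambda>t. prod_encode (0, to_nat t)) ` fst x \<union> {prod_encode (1, fst (snd x))} \<union>
    (\<lambda>i. prod_encode (2, i)) ` r (snd (snd x))" for x :: point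
  have "inj c"
  proof (rule injI)
    fix x y assume eq: "c x = c y"
    have "t \<in> fst x \<longleftrightarrow> prod_encode (0, to_nat t) \<in> c x" for t x
      by (auto simp: c_def)
    then have "fst x = fst y" using eq by blast
    moreover have "a = fst (snd x) \<longleftrightarrow> prod_encode (1, a) \<in> c x" for a x
      by (auto simp: c_def)
    then have "fst (snd x) = fst (snd y)" using eq by metis
    moreover have "i \<in> r (snd (snd x)) \<longleftrightarrow> prod_encode (2, i) \<in> c x" for i x
      by (auto simp: c_def)
    then have "r (snd (snd x)) = r (snd (snd y))" using eq by blast
    then have "snd (snd x) = snd (snd y)" using r by (simp add: inj_eq)
    ultimately show "x = y" by (simp add: prod_eq_iff)
  qed
  then have "inj (h \<circ> c)" using h by (simp add: inj_compose)
  then show ?thesis by (rule exI[of inj])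
qed

end


section \<open>Sampling from the limit\<close>

text \<open>The event depends only on the types of the coordinates and splits into finitely many
  boxes. This reduces convergence for tuples to convergence for single points.\<close>

lemma measure_PiM_pattern:
  fixes p :: nat
  assumes M: "prob_space M" and fin: "finite D"
    and tau: "\<And>c. {x \<in> space M. \<tau> x = c} \<in> sets M"
    and D: "D \<subseteq> {..<p} \<rightarrow>\<^sub>E UNIV"
  shows "{v \<in> space (PiM {..<p} (\<lambda>_. M)). (\<lambda>i\<in>{..<p}. \<tau> (v i)) \<in> D} \<in> sets (PiM {..<p} (\<lambda>_. M))" (is "?A \<in> sets ?P")
    and "measure (PiM {..<p} (\<lambda>_. M)) {v \<in> space (PiM {..<p} (\<lambda>_. M)). (\<lambda>i\<in>{..<p}. \<tau> (v i)) \<in> D} =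
      (\<Sum>c\<in>D. \<Prod>i<p. measure M {x \<in> space M. \<tau> x = c i})"
proof -
  interpret M: prob_space M by fact
  interpret P: finite_product_prob_space "\<lambda>_. M" "{..<p}" by unfold_locales auto
  define B where "B c = Pi\<^sub>E {..<p} (\<lambda>i. {x \<in> space M. \<tau> x = c i})" for c
  have B: "B c \<in> sets ?P" for c
    unfolding B_def by (intro sets_PiM_I_finite tau) auto
  have eq: "?A = (\<Union>c\<in>D. B c)"
  proof (intro equalityI subsetI)
    fix v assume v: "v \<in> ?A"
    then have "v \<in> B (\<lambda>i\<in>{..<p}. \<tau> (v i))"
      by (auto simp: B_def space_PiM PiE_iff)
    then show "v \<in> (\<Union>c\<in>D. B c)" using v by blast
  next
    fix v assume "v \<in> (\<Union>c\<in>D. B c)"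
    then obtain c where c: "c \<in> D" "v \<in> B c" by blast
    then have "(\<lambda>i\<in>{..<p}. \<tau> (v i)) = c"
      using D by (intro ext) (auto simp: B_def PiE_iff extensional_def restrict_def)
    then show "v \<in> ?A" using c by (auto simp: B_def space_PiM PiE_iff)
  qed
  show "?A \<in> sets ?P" unfolding eq using fin B by auto
  have "disjoint_family_on B D"
    unfolding disjoint_family_on_def
  proof (intro ballI impI)
    fix c d assume cd: "c \<in> D" "d \<in> D" "c \<noteq> d"
    have False if "v \<in> B c" "v \<in> B d" for v
    proof -
      have "c i = d i" for i
        using that PiE_arb[OF subsetD[OF D cd(1)], of i] PiE_arb[OF subsetD[OF D cd(2)], of i]
        by (cases "i < p") (auto simp: B_def PiE_iff)
      then show False using cd(3) by auto
    qed
    then show "B c \<inter> B d = {}" by blast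
  qed
  then have "measure ?P ?A = (\<Sum>c\<in>D. measure ?P (B c))"
    unfolding eq using fin B by (intro P.finite_measure_finite_Union) auto
  also have "\<dots> = (\<Sum>c\<in>D. \<Prod>i<p. measure M {x \<in> space M. \<tau> x = c i})"
    unfolding B_def by (intro sum.cong refl P.finite_measure_PiM_emb tau)
  finally show "measure ?P ?A = (\<Sum>c\<in>D. \<Prod>i<p. measure M {x \<in> space M. \<tau> x = c i})" .
qed

lemma measure_PiM_pairs_le:
  fixes p :: nat and e :: real
  assumes M: "prob_space M" and B: "{xy \<in> space (M \<Otimes>\<^sub>M M). B (fst xy) (snd xy)} \<in> sets (M \<Otimes>\<^sub>M M)"
    and le: "measure (M \<Otimes>\<^sub>M M) {xy \<in> space (M \<Otimes>\<^sub>M M). B (fst xy) (snd xy)} \<le> e"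
  shows "{v \<in> space (PiM {..<p} (\<lambda>_. M)). \<exists>i<p. \<exists>j<p. i \<noteq> j \<and> B (v i) (v j)} \<in> sets (PiM {..<p} (\<lambda>_. M))" (is "?A \<in> sets ?P")
    and "measure (PiM {..<p} (\<lambda>_. M)) {v \<in> space (PiM {..<p} (\<lambda>_. M)). \<exists>i<p. \<exists>j<p. i \<noteq> j \<and> B (v i) (v j)} \<le> p * p * e"
proof -
  interpret M: prob_space M by fact
  interpret P: product_prob_space "\<lambda>_. M" "{..<p}" by unfold_locales
  let ?B = "{xy \<in> space (M \<Otimes>\<^sub>M M). B (fst xy) (snd xy)}"
  define C where "C i j = {v \<in> space ?P. B (v i) (v j)}" for i j
  define I where "I = {ij \<in> {..<p} \<times> {..<p}. fst ij \<noteq> snd ij}"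
  have meas: "(\<lambda>v. (v i, v j)) \<in> measurable ?P (M \<Otimes>\<^sub>M M)" if "i < p" "j < p" for i j
    using that by (intro measurable_Pair measurable_component_singleton) auto
  have C_eq: "C i j = (\<lambda>v. (v i, v j)) -` ?B \<inter> space ?P" if "i < p" "j < p" for i j
    using that measurable_space[OF meas[OF that]] by (auto simp: C_def)
  have C: "C i j \<in> sets ?P" if "i < p" "j < p" for i j
    unfolding C_eq[OF that] by (rule measurable_sets[OF meas[OF that] B])
  have C_le: "measure ?P (C i j) \<le> e" if "i < p" "j < p" "i \<noteq> j" for i j
    using measure_distr[OF meas B, of i j] distr_PiM_pair[OF M that] C_eq that le by simp
  have eq: "?A = (\<Union>ij\<in>I. C (fst ij) (snd ij))"
    by (fastforce simp: C_def I_def)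
  have I: "finite I" "I \<subseteq> {..<p} \<times> {..<p}" by (auto simp: I_def)
  show "?A \<in> sets ?P"
    unfolding eq by (intro sets.finite_UN I) (auto simp: I_def intro: C)
  have "measure ?P ?A \<le> (\<Sum>ij\<in>I. measure ?P (C (fst ij) (snd ij)))"
    unfolding eq using I C by (intro P.finite_measure_subadditive_finite) (auto simp: I_def)
  also have "\<dots> \<le> (\<Sum>ij\<in>I. e)"
    using C_le by (intro sum_mono) (auto simp: I_def)
  also have "\<dots> \<le> p * p * e"
  proof -
    have "card I \<le> card ({..<p} \<times> {..<p})" using I by (intro card_mono) auto
    then have "real (card I) \<le> p * p" by (simp flip: of_nat_mult)
    moreover have "e \<ge> 0" using le measure_nonneg order_trans by blast
    ultimately show ?thesis by (simp add: mult_right_mono)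
  qed
  finally show "measure ?P ?A \<le> p * p * e" .
qed

lemma sets_pair_finite:
  assumes "finite (space M)" "sets M = Pow (space M)"
  shows "sets (M \<Otimes>\<^sub>M M) = Pow (space (M \<Otimes>\<^sub>M M))"
proof (intro equalityI subsetI)
  fix A assume "A \<in> Pow (space (M \<Otimes>\<^sub>M M))"
  then have A: "A \<subseteq> space M \<times> space M" by (simp add: space_pair_measure)
  then have "A = (\<Union>xy\<in>A. {fst xy} \<times> {snd xy})" by auto
  also have "\<dots> \<in> sets (M \<Otimes>\<^sub>M M)"
    using A assms finite_subset[OF A] by (intro sets.finite_UN pair_measureI) auto
  finally show "A \<in> sets (M \<Otimes>\<^sub>M M)" .
qed (use sets.sets_into_space in blast)

context type_limit begin

section \<open>The random source of samples\<close>

definition unif :: "real measure" where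
  "unif = uniform_measure lborel {0<..<1}"

lemma prob_unif: "prob_space unif"
  unfolding unif_def by (rule prob_space_uniform_measure) auto

lemma sets_unif [measurable_cong]: "sets unif = sets borel"
  by (simp add: unif_def)

lemma AE_unif: "AE u in unif. 0 < u \<and> u < 1"
  unfolding unif_def by (rule AE_uniform_measureI) auto

lemma AE_unif_neq: "AE u in unif. u \<noteq> a"
  unfolding unif_def
  by (rule AE_uniform_measureI) (use AE_lborel_singleton[of a] in auto)

definition source :: "((bit \<Rightarrow> bool) \<times> real) measure" where
  "source = \<rho> \<Otimes>\<^sub>M unif"

lemma prob_source: "prob_space source"
proof -
  interpret \<rho>: prob_space \<rho> by (rule prob_\<rho>)
  interpret unif: prob_space unif by (rule prob_unif)
  interpret pair_prob_space \<rho> unif ..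
  show ?thesis unfolding source_def by (rule prob_space_axioms)
qed

lemma AE_source:
  assumes "AE q in \<rho>. P q" "AE u in unif. Q u"
  shows "AE \<omega> in source. P (fst \<omega>) \<and> Q (snd \<omega>)"
proof -
  interpret \<rho>: prob_space \<rho> by (rule prob_\<rho>)
  interpret unif: prob_space unif by (rule prob_unif)
  have "AE \<omega> in source. P (fst \<omega>)"
  proof -
    obtain N where N: "N \<in> null_sets \<rho>" "{u \<in> space \<rho>. \<not> P u} \<subseteq> N"
      using assms(1) by (auto simp: eventually_ae_filter)
    have "emeasure (\<rho> \<Otimes>\<^sub>M unif) (N \<times> space unif) = 0"
      using N(1) by (subst unif.emeasure_pair_measure_Times) auto
    then have "N \<times> space unif \<in> null_sets (\<rho> \<Otimes>\<^sub>M unif)" using N(1) by auto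
    then show ?thesis
      unfolding source_def by (rule AE_I') (use N(2) in \<open>auto simp: space_pair_measure\<close>)
  qed
  moreover have "AE \<omega> in source. Q (snd \<omega>)"
  proof -
    obtain N where N: "N \<in> null_sets unif" "{u \<in> space unif. \<not> Q u} \<subseteq> N"
      using assms(2) by (auto simp: eventually_ae_filter)
    have "emeasure (\<rho> \<Otimes>\<^sub>M unif) (space \<rho> \<times> N) = 0"
      using N(1) by (subst unif.emeasure_pair_measure_Times) auto
    then have "space \<rho> \<times> N \<in> null_sets (\<rho> \<Otimes>\<^sub>M unif)" using N(1) by auto
    then show ?thesis
      unfolding source_def by (rule AE_I') (use N(2) in \<open>auto simp: space_pair_measure\<close>)
  qed
  ultimately show ?thesis by eventually_elim simp
qed

lemma measurable_bit [measurable]: "Measurable.pred source (\<lambda>\<omega>. fst \<omega> b)"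
proof -
  have "Measurable.pred \<rho> (\<lambda>q. q b)" by measurable
  from measurable_compose[OF measurable_fst this] show ?thesis by (simp add: source_def)
qed

lemma measurable_snd_source [measurable]: "snd \<in> borel_measurable source"
  unfolding source_def using measurable_snd[of \<rho> unif] by (simp add: measurable_cong_sets[OF refl sets_unif])

text \<open>As a finite sum of indicators the code is visibly measurable in the bits.\<close>

lemma real_code: "real (code P) = (\<Sum>i<k. if P i then 2 ^ i else 0)"
proof -
  have "{i. i < k \<and> P i} = {i \<in> {..<k}. P i}" by auto
  then have "code P = (\<Sum>i\<in>{i \<in> {..<k}. P i}. 2 ^ i)"
    by (simp add: code_def set_encode_def)
  also have "\<dots> = (\<Sum>i<k. if P i then 2 ^ i else 0)"
    by (rule sum.inter_filter) simp
  finally show ?thesis by (simp add: if_distrib of_nat_sum cong: if_cong)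
qed

lemma measurable_sample: "sample \<in> measurable source hat_space"
proof (rule measurable_hatI)
  have [measurable]: "Measurable.pred source (\<lambda>\<omega>. t \<in> below (fst \<omega>))" for t
    by (simp add: below_def)
  have [measurable]: "Measurable.pred source (\<lambda>\<omega>. ideal (below (fst \<omega>)))"
    unfolding ideal_def Ball_def by measurable
  have [measurable]: "Measurable.pred source (\<lambda>\<omega>. principal (below (fst \<omega>)))"
    unfolding principal_def Ball_def Bex_def by measurable
  show "sample \<omega> \<in> hat_dom" for \<omega> by (rule sample_in)
  have 1: "fst (sample \<omega>) = (if ideal (below (fst \<omega>)) then below (fst \<omega>) else {})"
    "real (fst (snd (sample \<omega>))) = (if ideal (below (fst \<omega>)) then real (tag (fst \<omega>)) else 0)"
    "snd (snd (sample \<omega>)) = (if ideal (below (fst \<omega>)) then pos (fst \<omega>) (snd \<omega>) else 0)" for \<omega>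
    by (auto simp: sample_def split_beta)
  have 2: "real (tag q) = (if principal (below q) then 0
     else real (code (\<lambda>i. \<exists>t. (\<forall>r. q (B_up r) \<longrightarrow> LE r t) \<and> q (B_cm i t))))" for q
    by (simp add: tag_def)
  show "Measurable.pred source (\<lambda>\<omega>. t \<in> fst (sample \<omega>))" for t
    unfolding 1 by (simp add: if_distrib[of "\<lambda>A. t \<in> A"] cong: if_cong)
  show "(\<lambda>\<omega>. real (fst (snd (sample \<omega>)))) \<in> borel_measurable source"
    unfolding 1 2 real_code by measurable
  show "(\<lambda>\<omega>. snd (snd (sample \<omega>))) \<in> borel_measurable source"
    unfolding 1 pos_def real_code by measurable
qed

text \<open>Two independent samples almost surely have different chains below them, or chains with a
  common maximum; in the latter case their meet is this maximum.\<close>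

lemma AE_separated:
  "AE \<omega> in source \<Otimes>\<^sub>M source. \<exists>t. separated hat_meet {eval_term hat base t} (sample (fst \<omega>)) (sample (snd \<omega>))"
proof -
  interpret source: prob_space source by (rule prob_source)
  interpret pair_prob_space source source ..
  interpret hat: tree_semilattice hat_dom hat_meet by (rule tree_hat)
  let ?P = "\<lambda>\<omega> \<omega>'. \<exists>t. separated hat_meet {eval_term hat base t} (sample \<omega>) (sample \<omega>')"
  let ?Z = "\<lambda>t. (down t, 0, 0)"
  have good: "AE \<omega> in source. consistent (fst \<omega>) \<and> tight_type (fst \<omega>) \<and> 0 < snd \<omega> \<and> snd \<omega> < 1"
    using AE_source[OF AE_conjI[OF AE_consistent AE_tight_type] AE_unif] by eventually_elim simp
  have up: "hat_le (?Z t) (sample \<omega>) \<longleftrightarrow> t \<in> below (fst \<omega>)"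
    if "consistent (fst \<omega>) \<and> tight_type (fst \<omega>) \<and> 0 < snd \<omega> \<and> snd \<omega> < 1" for \<omega> t
  proof -
    have "holds hat base (sample (fst \<omega>, snd \<omega>)) (B_up t) \<longleftrightarrow> t \<in> below (fst \<omega>)"
      using sample_up[of "fst \<omega>" "snd \<omega>"] that by (simp add: below_def)
    moreover have "holds hat base (sample \<omega>) (B_up t) \<longleftrightarrow> hat_le (?Z t) (sample \<omega>)"
      using tle_hat[OF base_in sample_in] by (simp add: eval_base) (simp add: hat_def)
    ultimately show ?thesis by simp
  qed
  have eq: "sample \<omega> = (below (fst \<omega>), tag (fst \<omega>), pos (fst \<omega>) (snd \<omega>))"
    if "consistent (fst \<omega>) \<and> tight_type (fst \<omega>) \<and> 0 < snd \<omega> \<and> snd \<omega> < 1" for \<omega>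
    using sample_eq[of "fst \<omega>" "snd \<omega>"] that by simp
  have sepI: "?P \<omega> \<omega>'" if "hat_le (hat_meet (sample \<omega>) (sample \<omega>')) (?Z t)"
    "hat_le (?Z t) (sample \<omega>) \<or> hat_le (?Z t) (sample \<omega>')" for \<omega> \<omega>' t
    using that tle_hat[OF base_in sample_in] tle_hat[OF hat_meet_in_dom[OF sample_in sample_in] base_in]
    by (intro exI[of _ t]) (simp add: separated_def eval_base)
  have sep: "?P \<omega> \<omega>'"
    if g: "consistent (fst \<omega>) \<and> tight_type (fst \<omega>) \<and> 0 < snd \<omega> \<and> snd \<omega> < 1"
      and g': "consistent (fst \<omega>') \<and> tight_type (fst \<omega>') \<and> 0 < snd \<omega>' \<and> snd \<omega>' < 1"
      and ne: "snd \<omega> \<noteq> snd \<omega>'" and np: "principal (below (fst \<omega>)) \<or> below (fst \<omega>') \<noteq> below (fst \<omega>)" for \<omega> \<omega>'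
  proof -
    define I J where "I = below (fst \<omega>)" and "J = below (fst \<omega>')"
    have id: "ideal I" "ideal J"
      using ideal_below g g' by (auto simp: I_def J_def)
    \<comment> \<open>A term in exactly one of the two chains lies above their whole intersection,
      and below one of the samples, so it separates them.\<close>
    have *: "hat_le (hat_meet (sample \<omega>) (sample \<omega>')) (?Z t)" if "t \<in> I - J \<union> (J - I)" for t
    proof -
      have "I \<inter> J \<subset> down t"
        using id that LE_refl unfolding ideal_def down_def by blast
      moreover have "I \<noteq> J" using that by auto
      ultimately show ?thesis by (simp add: eq[OF g] eq[OF g'] flip: I_def J_def)
    qed
    show ?thesis
    proof (cases "I = J")
      case False
      then obtain t where t: "t \<in> I - J \<union> (J - I)" by blast
      then show ?thesis using sepI[OF *[OF t]] up[OF g] up[OF g'] by (auto simp: I_def J_def)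
    next
      case True
      then have "principal I" using np by (auto simp: I_def J_def)
      then obtain W where W: "I = down W" using ideal_principal id by blast
      have W_in: "W \<in> I" using LE_refl W by (simp add: down_def)
      have tags: "tag (fst \<omega>) = 0" "tag (fst \<omega>') = 0"
        using \<open>principal I\<close> True by (auto simp: tag_def I_def J_def)
      have "hat_meet (sample \<omega>) (sample \<omega>') = ?Z W"
      proof -
        \<comment> \<open>Equal nonzero positions would have the distinct fractional parts
          \<open>snd \<omega>\<close> and \<open>snd \<omega>'\<close>. So either the samples differ
          and meet at \<open>W\<close>, or both are the point of \<open>W\<close>.\<close>
        have "pos (fst \<omega>) (snd \<omega>) = 0" if "pos (fst \<omega>) (snd \<omega>) = pos (fst \<omega>') (snd \<omega>')"
        proof (rule ccontr)
          assume "pos (fst \<omega>) (snd \<omega>) \<noteq> 0"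
          moreover have "pos q u = 0 \<or> (\<exists>a::nat. pos q u = real a + u)" for q u
            by (auto simp: pos_def)
          then obtain a b :: nat where
            "pos (fst \<omega>) (snd \<omega>) = 0 \<or> pos (fst \<omega>) (snd \<omega>) = real a + snd \<omega>"
            "pos (fst \<omega>') (snd \<omega>') = 0 \<or> pos (fst \<omega>') (snd \<omega>') = real b + snd \<omega>'"
            by metis
          ultimately have "frac (real a + snd \<omega>) = frac (real b + snd \<omega>')" using that by auto
          then have "snd \<omega> = snd \<omega>'"
            using g g' frac_unique_iff[of "real a + snd \<omega>" "snd \<omega>"] frac_unique_iff[of "real b + snd \<omega>'" "snd \<omega>'"] by auto
          then show False using ne by simp
        qed
        then show ?thesis
          using tags True W by (auto simp: eq[OF g] eq[OF g'] simp flip: I_def J_def)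
      qed
      then show ?thesis using sepI[of \<omega> \<omega>' W] up[OF g, of W] W_in by (simp add: I_def)
    qed
  qed
  have ms: "(\<lambda>\<omega>. sample (fst \<omega>)) \<in> measurable (source \<Otimes>\<^sub>M source) hat_space"
    "(\<lambda>\<omega>. sample (snd \<omega>)) \<in> measurable (source \<Otimes>\<^sub>M source) hat_space"
    using measurable_sample by measurable
  have [measurable]: "Measurable.pred (source \<Otimes>\<^sub>M source)
      (\<lambda>\<omega>. separated hat_meet {eval_term hat base t} (sample (fst \<omega>)) (sample (snd \<omega>)))" for t
    using pred_separated_hat[OF ms, of "{t}"] by simp
  have "AE \<omega> in source. AE \<omega>' in source. ?P \<omega> \<omega>'"
    using good
  proof eventually_elim
    case g: (elim \<omega>)
    have "AE q in \<rho>. principal (below (fst \<omega>)) \<or> below q \<noteq> below (fst \<omega>)"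
      using nonprincipal_null[OF ideal_below, of "fst \<omega>"] g by (cases "principal (below (fst \<omega>))") auto
    from AE_source[OF this AE_unif_neq[of "snd \<omega>"]]
    have "AE \<omega>' in source. (principal (below (fst \<omega>)) \<or> below (fst \<omega>') \<noteq> below (fst \<omega>)) \<and> snd \<omega>' \<noteq> snd \<omega>" .
    with good show ?case
      by eventually_elim (use sep[OF g] in auto)
  qed
  then show ?thesis
    by (intro AE_pair_measure) (auto simp: split_beta)
qed

end


section \<open>Convergence\<close>

lemma measure_pair_le:
  assumes M: "prob_space M" and B: "{xy \<in> space (M \<Otimes>\<^sub>M M). B (fst xy) (snd xy)} \<in> sets (M \<Otimes>\<^sub>M M)"
    and le: "\<And>x. x \<in> space M \<Longrightarrow> measure M {y \<in> space M. B x y} \<le> e"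
  shows "measure (M \<Otimes>\<^sub>M M) {xy \<in> space (M \<Otimes>\<^sub>M M). B (fst xy) (snd xy)} \<le> e"
proof -
  interpret M: prob_space M by fact
  interpret pair_prob_space M M ..
  let ?B = "{xy \<in> space (M \<Otimes>\<^sub>M M). B (fst xy) (snd xy)}"
  obtain x where "x \<in> space M" using M.not_empty by blast
  then have e: "e \<ge> 0" using le[of x] measure_nonneg[of M "{y \<in> space M. B x y}"] by linarith
  have "emeasure (M \<Otimes>\<^sub>M M) ?B = (\<integral>\<^sup>+ x. emeasure M (Pair x -` ?B) \<partial>M)"
    using B by (rule M.emeasure_pair_measure_alt)
  also have "\<dots> \<le> (\<integral>\<^sup>+ x. ennreal e \<partial>M)"
  proof (rule nn_integral_mono)
    fix x assume x: "x \<in> space M"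
    have "Pair x -` ?B = {y \<in> space M. B x y}" using x by (auto simp: space_pair_measure)
    then show "emeasure M (Pair x -` ?B) \<le> ennreal e"
      using le[OF x] by (simp add: M.emeasure_eq_measure ennreal_leI)
  qed
  also have "\<dots> = ennreal e" by (simp add: M.emeasure_space_1)
  finally show ?thesis using e by (simp add: emeasure_eq_measure)
qed

lemma pairing_Neg:
  assumes M: "prob_space M" and space: "space M = domain_of S"
    and sol: "solutions p \<phi> S \<in> sets (PiM {..<p} (\<lambda>_. M))"
  shows "pairing p (Neg \<phi>) S M = 1 - pairing p \<phi> S M"
proof -
  interpret M: prob_space M by fact
  interpret P: product_prob_space "\<lambda>_. M" "{..<p}" by unfold_locales
  have "solutions p (Neg \<phi>) S = space (PiM {..<p} (\<lambda>_. M)) - solutions p \<phi> S"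
    by (auto simp: solutions_def space_PiM space)
  then show ?thesis
    unfolding pairing_def using P.prob_compl[OF sol] by simp
qed

context type_limit begin

definition hat_measure :: "point measure" where
  "hat_measure = distr source hat_space sample"

lemma prob_hat_measure: "prob_space hat_measure"
  unfolding hat_measure_def using prob_source measurable_sample by (rule prob_space.prob_space_distr)

lemma solutions_T: "wf_formula k p \<phi> \<Longrightarrow> solutions p \<phi> (T n) \<in> sets (PiM {..<p} (\<lambda>_. \<mu> n))"
proof -
  assume wf: "wf_formula k p \<phi>"
  have fin_n: "finite (space (\<mu> n))" "sets (\<mu> n) = Pow (space (\<mu> n))"
    using fin[of n] by (auto simp: finite_weighted_tree_semilattice_def)
  note pair = sets_pair_finite[OF fin_n]
  show ?thesis
  proof (rule measurable_solutions[OF _ _ _ space_\<mu> wf])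
    show "(\<lambda>(x, y). mt n x y) \<in> measurable (\<mu> n \<Otimes>\<^sub>M \<mu> n) (\<mu> n)"
      using tree_semilattice.closed[OF tree] by (auto simp: measurable_def pair space_pair_measure space_\<mu>)
    show "Measurable.pred (\<mu> n \<Otimes>\<^sub>M \<mu> n) (\<lambda>p. fst p = snd p)"
      by (auto simp: measurable_def pair)
    show "\<forall>i<k. color (T n) i \<in> sets (\<mu> n)"
      using fin[of n] by (auto simp: finite_weighted_tree_semilattice_def colored_tree_semilattice_def)
  qed
qed

text \<open>Almost every pair is separated by some term, so along finite sets exhausting the terms
  the inseparable pairs decrease to a null set. Keeping \<open>F0\<close> inside \<open>F\<close>
  preserves the separation bound of the finite trees.\<close>

lemma ex_separating_terms:
  assumes "finite F0" "e > 0"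
  obtains F where "finite F" "F0 \<subseteq> F"
    "measure (source \<Otimes>\<^sub>M source) {\<omega> \<in> space (source \<Otimes>\<^sub>M source).
       \<not> separated hat_meet (eval_term hat base ` F) (sample (fst \<omega>)) (sample (snd \<omega>))} \<le> e"
proof -
  interpret source: prob_space source by (rule prob_source)
  interpret pair_prob_space source source ..
  define F where "F m = F0 \<union> {t :: qf_term. to_nat t < m}" for m
  have "finite {t :: qf_term. to_nat t < m}" for m
    by (rule finite_imageD[of to_nat]) (auto intro: finite_subset[of _ "{..<m}"] inj_on_subset[OF inj_to_nat])
  then have finF: "finite (F m)" for m using assms by (simp add: F_def)
  define B where "B m = {\<omega> \<in> space (source \<Otimes>\<^sub>M source).
       \<not> separated hat_meet (eval_term hat base ` F m) (sample (fst \<omega>)) (sample (snd \<omega>))}" for m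
  have ms: "(\<lambda>\<omega>. sample (fst \<omega>)) \<in> measurable (source \<Otimes>\<^sub>M source) hat_space"
    "(\<lambda>\<omega>. sample (snd \<omega>)) \<in> measurable (source \<Otimes>\<^sub>M source) hat_space"
    using measurable_sample by measurable
  have B: "B m \<in> sets (source \<Otimes>\<^sub>M source)" for m
    unfolding B_def using pred_separated_hat[OF ms finF] by measurable
  have "decseq B"
  proof (rule decseq_SucI)
    fix m
    have "F m \<subseteq> F (Suc m)" by (auto simp: F_def)
    from separated_mono[OF _ image_mono[OF this, of "eval_term hat base"], of hat_meet] show "B (Suc m) \<subseteq> B m"
      unfolding B_def by blast
  qed
  then have lim: "(\<lambda>m. measure (source \<Otimes>\<^sub>M source) (B m)) \<longlonglongrightarrow> measure (source \<Otimes>\<^sub>M source) (\<Inter>m. B m)"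
    using B by (intro finite_Lim_measure_decseq) auto
  have "AE \<omega> in source \<Otimes>\<^sub>M source. \<omega> \<notin> (\<Inter>m. B m)"
    using AE_separated
  proof eventually_elim
    case (elim \<omega>)
    then obtain t where "separated hat_meet {eval_term hat base t} (sample (fst \<omega>)) (sample (snd \<omega>))" ..
    then have "separated hat_meet (eval_term hat base ` F (Suc (to_nat t))) (sample (fst \<omega>)) (sample (snd \<omega>))"
      by (rule separated_mono) (auto simp: F_def)
    then have "\<omega> \<notin> B (Suc (to_nat t))" by (simp add: B_def)
    then show ?case by blast
  qed
  then have "measure (source \<Otimes>\<^sub>M source) (\<Inter>m. B m) = 0"
    using B by (subst (asm) AE_iff_null_sets[symmetric]) (auto simp: null_sets_def measure_def)
  with lim have "(\<lambda>m. measure (source \<Otimes>\<^sub>M source) (B m)) \<longlonglongrightarrow> 0" by simp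
  then have "\<forall>\<^sub>F m in sequentially. measure (source \<Otimes>\<^sub>M source) (B m) < e"
    using \<open>e > 0\<close> by (rule order_tendstoD)
  then obtain m where "measure (source \<Otimes>\<^sub>M source) (B m) < e"
    using eventually_happens'[OF sequentially_bot] by blast
  then show ?thesis
    using that[of "F m"] finF by (auto simp: F_def B_def)
qed

lemma AE_sample_holds: "AE \<omega> in source. \<forall>b\<in>core_bits k F. holds hat base (sample \<omega>) b \<longleftrightarrow> fst \<omega> b"
  using AE_source[OF AE_conjI[OF AE_consistent AE_tight_type] AE_unif]
proof eventually_elim
  case (elim \<omega>)
  then have *: "consistent (fst \<omega>)" "tight_type (fst \<omega>)" "0 < snd \<omega>" "snd \<omega> < 1" by auto
  show ?case
    using sample_up[OF *] sample_dn[OF *] sample_ml[OF *] sample_cx[OF *] sample_cm[OF *]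
    by (auto simp: core_bits_def simp del: holds.simps)
qed

lemma measure_source_pattern:
  assumes "finite C" "c \<subseteq> C"
  shows "measure source {\<omega> \<in> space source. {b \<in> C. fst \<omega> b} = c} = measure \<rho> {q. \<forall>b\<in>C. q b = (b \<in> c)}"
proof -
  interpret \<rho>: prob_space \<rho> by (rule prob_\<rho>)
  interpret unif: prob_space unif by (rule prob_unif)
  let ?A = "{q. \<forall>b\<in>C. q b = (b \<in> c)}"
  have A: "?A \<in> sets \<rho>" unfolding sets_\<rho> by (rule sets_bit_pattern[OF assms(1)])
  have "{\<omega> \<in> space source. {b \<in> C. fst \<omega> b} = c} = ?A \<times> space unif"
    using assms(2) by (auto simp: source_def space_pair_measure space_\<rho>)
  then show ?thesis
    using A by (simp add: measure_def source_def unif.emeasure_pair_measure_Times unif.emeasure_space_1)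
qed

abbreviation "source_prod p \<equiv> PiM {..<p :: nat} (\<lambda>_. source)"

text \<open>The bits of the samples over finitely many separating terms determine the satisfaction of
  \<open>\<phi>\<close> in the same way in \<open>T n\<close> and in the limit, up to the rare inseparable pairs.\<close>

lemma sat_measure_le_limit:
  assumes wf: "wf_formula k p \<phi>" and L: "(\<lambda>n. pairing p \<phi> (T n) (\<mu> n)) \<longlonglongrightarrow> L"
  shows "pairing p \<phi> hat hat_measure \<le> L"
proof -
  interpret source: prob_space source by (rule prob_source)
  interpret Q: product_prob_space "\<lambda>_. source" "{..<p}" by unfold_locales
  let ?Q = "source_prod p"
  let ?sat = "{\<omega> \<in> space ?Q. sat hat (\<lambda>i. sample (\<omega> i)) \<phi>}"
  have pair_eq: "pairing p \<phi> hat hat_measure = measure ?Q ?sat"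
    unfolding hat_measure_def
    by (rule pairing_distr[OF prob_source measurable_sample _ measurable_solutions_hat wf])
      (use wf in \<open>auto simp: hat_def\<close>)
  have "measure ?Q ?sat \<le> L + 2 * p * p * e" if e: "e > 0" for e :: real
  proof -
    obtain F0 where F0: "finite F0" "\<And>n x. x \<in> dm n \<Longrightarrow>
        measure (\<mu> n) {x'\<in>dm n. \<not> separated (mt n) (z n ` F0) x x'} \<le> e"
      using sep[OF e] by blast
    obtain F where F: "finite F" "F0 \<subseteq> F" and bad_hat: "measure (source \<Otimes>\<^sub>M source) {\<omega> \<in> space (source \<Otimes>\<^sub>M source).
       \<not> separated hat_meet (eval_term hat base ` F) (sample (fst \<omega>)) (sample (snd \<omega>))} \<le> e"
      using ex_separating_terms[OF F0(1) e] by blast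
    let ?C = "core_bits k F"
    let ?tau = "\<lambda>\<omega> :: (bit \<Rightarrow> bool) \<times> real. {b \<in> ?C. fst \<omega> b}"
    let ?tn = "\<lambda>n x. {b \<in> ?C. holds (T n) (y n) x b}"
    let ?good = "\<lambda>\<omega>. \<forall>b\<in>?C. holds hat base (sample \<omega>) b \<longleftrightarrow> fst \<omega> b"
    let ?bad = "\<lambda>\<omega> \<omega>'. \<not> separated hat_meet (eval_term hat base ` F) (sample \<omega>) (sample \<omega>')"
    let ?badn = "\<lambda>n x x'. \<not> separated (mt n) (z n ` F) x x'"
    have finC: "finite ?C" using F finite_core_bits by blast
    \<comment> \<open>The patterns of limit tuples that satisfy \<phi> and avoid all exceptions.
      Each pattern in \<open>D\<close> thus comes with a witness tuple to which tuples of
      \<open>T n\<close> can be matched.\<close>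
    define D where "D = {c. \<exists>\<omega>\<in>space ?Q. c = (\<lambda>i\<in>{..<p}. ?tau (\<omega> i)) \<and> (\<forall>i<p. ?good (\<omega> i)) \<and>
      \<not> (\<exists>i<p. \<exists>j<p. i \<noteq> j \<and> ?bad (\<omega> i) (\<omega> j)) \<and> sat hat (\<lambda>i. sample (\<omega> i)) \<phi>}"
    have D_sub: "D \<subseteq> {..<p} \<rightarrow>\<^sub>E Pow ?C" by (auto simp: D_def)
    then have finD: "finite D"
      by (rule finite_subset) (use finC in \<open>auto intro!: finite_PiE\<close>)
    have D_sub': "D \<subseteq> {..<p} \<rightarrow>\<^sub>E UNIV" using D_sub by blast
    let ?S = "\<Sum>c\<in>D. \<Prod>i<p. measure source {\<omega> \<in> space source. ?tau \<omega> = c i}"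
    let ?Sn = "\<lambda>n. \<Sum>c\<in>D. \<Prod>i<p. measure (\<mu> n) {x \<in> space (\<mu> n). ?tn n x = c i}"
    have tau_meas: "{\<omega> \<in> space source. ?tau \<omega> = c} \<in> sets source" for c
    proof -
      have "{\<omega> \<in> space source. ?tau \<omega> = c} = {\<omega> \<in> space source. c \<subseteq> ?C \<and> (\<forall>b\<in>?C. fst \<omega> b = (b \<in> c))}"
        by auto
      also have "\<dots> \<in> sets source" using finC by measurable
      finally show ?thesis .
    qed
    have ms: "(\<lambda>\<omega>. sample (fst \<omega>)) \<in> measurable (source \<Otimes>\<^sub>M source) hat_space"
      "(\<lambda>\<omega>. sample (snd \<omega>)) \<in> measurable (source \<Otimes>\<^sub>M source) hat_space"
      using measurable_sample by measurable
    have bad_meas: "{\<omega> \<in> space (source \<Otimes>\<^sub>M source). ?bad (fst \<omega>) (snd \<omega>)} \<in> sets (source \<Otimes>\<^sub>M source)"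
      using pred_separated_hat[OF ms F(1)] by measurable
    note pat = measure_PiM_pattern[OF prob_source finD tau_meas D_sub']
    note bad = measure_PiM_pairs_le[OF prob_source bad_meas bad_hat, of p]
    have "AE \<omega> in ?Q. \<forall>i\<in>{..<p}. ?good (\<omega> i)"
      by (intro AE_finite_allI AE_PiM_component prob_source AE_sample_holds) auto
    then have "AE \<omega> in ?Q. \<omega> \<in> ?sat \<longrightarrow> \<omega> \<in> {\<omega> \<in> space ?Q. (\<lambda>i\<in>{..<p}. ?tau (\<omega> i)) \<in> D} \<union>
        {\<omega> \<in> space ?Q. \<exists>i<p. \<exists>j<p. i \<noteq> j \<and> ?bad (\<omega> i) (\<omega> j)}"
    proof eventually_elim
      case (elim \<omega>)
      show ?case
      proof (intro impI, rule UnCI)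
        assume sat: "\<omega> \<in> ?sat"
          and nb: "\<omega> \<notin> {\<omega> \<in> space ?Q. \<exists>i<p. \<exists>j<p. i \<noteq> j \<and> ?bad (\<omega> i) (\<omega> j)}"
        have good: "\<forall>i<p. ?good (\<omega> i)" using elim by blast
        have s: "\<omega> \<in> space ?Q" "sat hat (\<lambda>i. sample (\<omega> i)) \<phi>" using sat by simp_all
        have nb': "\<not> (\<exists>i<p. \<exists>j<p. i \<noteq> j \<and> ?bad (\<omega> i) (\<omega> j))" using nb s(1) by blast
        have "(\<lambda>i\<in>{..<p}. ?tau (\<omega> i)) \<in> D"
          unfolding D_def by (rule CollectI, rule bexI[OF _ s(1)]) (intro conjI refl good nb' s(2))
        then show "\<omega> \<in> {\<omega> \<in> space ?Q. (\<lambda>i\<in>{..<p}. ?tau (\<omega> i)) \<in> D}" using sat by simp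
      qed
    qed
    then have "measure ?Q ?sat \<le> measure ?Q ({\<omega> \<in> space ?Q. (\<lambda>i\<in>{..<p}. ?tau (\<omega> i)) \<in> D} \<union>
        {\<omega> \<in> space ?Q. \<exists>i<p. \<exists>j<p. i \<noteq> j \<and> ?bad (\<omega> i) (\<omega> j)})"
      by (rule Q.finite_measure_mono_AE) (rule sets.Un[OF pat(1) bad(1)])
    also have "\<dots> \<le> measure ?Q {\<omega> \<in> space ?Q. (\<lambda>i\<in>{..<p}. ?tau (\<omega> i)) \<in> D} +
        measure ?Q {\<omega> \<in> space ?Q. \<exists>i<p. \<exists>j<p. i \<noteq> j \<and> ?bad (\<omega> i) (\<omega> j)}"
      using pat(1) bad(1) by (rule measure_Un_le)
    also have "\<dots> \<le> ?S + p * p * e"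
      using pat(2) bad(2) by simp
    finally have upper: "measure ?Q ?sat \<le> ?S + p * p * e" .
    \<comment> \<open>A pairwise separated tuple of \<open>T n\<close> with pattern in
      \<open>D\<close> matches the witness of that pattern and so satisfies \<phi>.\<close>
    have lower: "?Sn n - p * p * e \<le> pairing p \<phi> (T n) (\<mu> n)" for n
    proof -
      interpret \<mu>: prob_space "\<mu> n" by (rule prob_\<mu>)
      interpret P: product_prob_space "\<lambda>_. \<mu> n" "{..<p}" by unfold_locales
      let ?P = "PiM {..<p} (\<lambda>_. \<mu> n)"
      have fin_n: "finite (space (\<mu> n))" "sets (\<mu> n) = Pow (space (\<mu> n))"
        using fin[of n] by (auto simp: finite_weighted_tree_semilattice_def)
      have tn_meas: "{x \<in> space (\<mu> n). ?tn n x = c} \<in> sets (\<mu> n)" for c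
        using fin_n by auto
      have bad_meas_n: "{x \<in> space (\<mu> n \<Otimes>\<^sub>M \<mu> n). ?badn n (fst x) (snd x)} \<in> sets (\<mu> n \<Otimes>\<^sub>M \<mu> n)"
        using sets_pair_finite[OF fin_n] by auto
      have bad_n: "measure (\<mu> n \<Otimes>\<^sub>M \<mu> n) {x \<in> space (\<mu> n \<Otimes>\<^sub>M \<mu> n). ?badn n (fst x) (snd x)} \<le> e"
      proof (rule measure_pair_le[OF prob_\<mu> bad_meas_n])
        fix x assume x: "x \<in> space (\<mu> n)"
        have "measure (\<mu> n) {x' \<in> space (\<mu> n). ?badn n x x'} \<le>
            measure (\<mu> n) {x'\<in>dm n. \<not> separated (mt n) (z n ` F0) x x'}"
          using separated_mono[OF _ image_mono[OF F(2)], of "mt n" "z n" x] fin_n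
          by (intro \<mu>.finite_measure_mono) (auto simp: space_\<mu>)
        also have "\<dots> \<le> e" using F0 x by (simp add: space_\<mu>)
        finally show "measure (\<mu> n) {x' \<in> space (\<mu> n). ?badn n x x'} \<le> e" .
      qed
      note pat_n = measure_PiM_pattern[OF prob_\<mu> finD tn_meas D_sub']
      note bad_n = measure_PiM_pairs_le[OF prob_\<mu> bad_meas_n bad_n, of p]
      have "{v \<in> space ?P. (\<lambda>i\<in>{..<p}. ?tn n (v i)) \<in> D} \<subseteq>
          solutions p \<phi> (T n) \<union> {v \<in> space ?P. \<exists>i<p. \<exists>j<p. i \<noteq> j \<and> ?badn n (v i) (v j)}"
      proof (rule subsetI, rule UnCI)
        fix v assume v: "v \<in> {v \<in> space ?P. (\<lambda>i\<in>{..<p}. ?tn n (v i)) \<in> D}"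
          and nb: "v \<notin> {v \<in> space ?P. \<exists>i<p. \<exists>j<p. i \<noteq> j \<and> ?badn n (v i) (v j)}"
        then obtain \<omega> where \<omega>: "(\<lambda>i\<in>{..<p}. ?tn n (v i)) = (\<lambda>i\<in>{..<p}. ?tau (\<omega> i))" "\<forall>i<p. ?good (\<omega> i)"
          "\<not> (\<exists>i<p. \<exists>j<p. i \<noteq> j \<and> ?bad (\<omega> i) (\<omega> j))" "sat hat (\<lambda>i. sample (\<omega> i)) \<phi>"
          by (auto simp: D_def)
        have tau_eq: "?tn n (v i) = ?tau (\<omega> i)" if "i < p" for i
          using fun_cong[OF \<omega>(1), of i] that by simp
        have vdom: "v i \<in> dm n" if "i < p" for i
          using v that by (auto simp: space_PiM space_\<mu>)
        have match: "holds (T n) (y n) (v i) b \<longleftrightarrow> holds hat base (sample (\<omega> i)) b"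
          if "i < p" "b \<in> ?C" for i b
          using tau_eq[OF that(1)] \<omega>(2) that by blast
        have "matching_samples (T n) hat k p F (y n) v base (\<lambda>i. sample (\<omega> i))"
        proof (intro matching_samples.intro matching_samples_axioms.intro)
          show "tree_semilattice (domain_of hat) (meet hat)"
            using tree_hat by (simp add: hat_def)
          show "separated (mt n) (z n ` F) (v i) (v j)" if "i < p" "j < p" "i \<noteq> j" for i j
            using nb v that by blast
          show "separated (meet hat) (eval_term hat base ` F) (sample (\<omega> i)) (sample (\<omega> j))"
            if "i < p" "j < p" "i \<noteq> j" for i j
          proof -
            have "separated hat_meet (eval_term hat base ` F) (sample (\<omega> i)) (sample (\<omega> j))"
              using \<omega>(3) that by blast
            moreover have "meet hat = hat_meet" by (simp add: hat_def)
            ultimately show ?thesis by simp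
          qed
        qed (use tree y_in vdom match base_in sample_in in \<open>simp_all add: hat_def base_def del: holds.simps\<close>)
        then have "sat (T n) v \<phi>"
          using matching_samples.match_sat[OF _ wf] \<omega>(4) by blast
        then show "v \<in> solutions p \<phi> (T n)"
          using v by (simp add: solutions_def space_PiM space_\<mu>)
      qed
      then have "measure ?P {v \<in> space ?P. (\<lambda>i\<in>{..<p}. ?tn n (v i)) \<in> D} \<le>
          measure ?P (solutions p \<phi> (T n) \<union> {v \<in> space ?P. \<exists>i<p. \<exists>j<p. i \<noteq> j \<and> ?badn n (v i) (v j)})"
        by (rule P.finite_measure_mono) (rule sets.Un[OF solutions_T[OF wf] bad_n(1)])
      also have "\<dots> \<le> measure ?P (solutions p \<phi> (T n)) +
          measure ?P {v \<in> space ?P. \<exists>i<p. \<exists>j<p. i \<noteq> j \<and> ?badn n (v i) (v j)}"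
        using solutions_T[OF wf] bad_n(1) by (rule measure_Un_le)
      finally show ?thesis
        using pat_n(2) bad_n(2) by (simp add: pairing_def)
    qed
    have "?Sn \<longlonglongrightarrow> ?S"
    proof (intro tendsto_sum tendsto_prod)
      fix c i assume "c \<in> D" "i \<in> {..<p}"
      then have c: "c i \<subseteq> ?C" using D_sub by auto
      have "{x \<in> space (\<mu> n). ?tn n x = c i} = {x \<in> dm n. \<forall>b\<in>?C. holds (T n) (y n) x b = (b \<in> c i)}" for n
        using c by (auto simp: space_\<mu>)
      then show "(\<lambda>n. measure (\<mu> n) {x \<in> space (\<mu> n). ?tn n x = c i}) \<longlonglongrightarrow>
          measure source {\<omega> \<in> space source. ?tau \<omega> = c i}"
        using lim[OF finC, of "\<lambda>b. b \<in> c i"] measure_source_pattern[OF finC c] by simp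
    qed
    then have "(\<lambda>n. ?Sn n - p * p * e) \<longlonglongrightarrow> ?S - p * p * e"
      by (rule tendsto_diff) (rule tendsto_const)
    then have "?S - p * p * e \<le> L"
      using lower by (intro LIMSEQ_le[OF _ L]) auto
    then show ?thesis using upper by simp
  qed
  then have *: "measure ?Q ?sat \<le> L + 2 * p * p * e" if "e > 0" for e :: real using that .
  show ?thesis
    unfolding pair_eq
  proof (rule field_le_epsilon)
    fix e :: real assume "e > 0"
    \<comment> \<open>The added 1 keeps the denominator positive for \<open>p = 0\<close>.\<close>
    define d where "d = e / (2 * real p * real p + 1)"
    have pos: "0 < 2 * real p * real p + 1"
      by (rule add_nonneg_pos) auto
    then have "d > 0" using \<open>e > 0\<close> by (simp add: d_def)
    have "(2 * real p * real p + 1) * d = e"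
      using pos unfolding d_def by simp
    then have "2 * real p * real p * d \<le> e" using \<open>d > 0\<close> by (simp add: distrib_right)
    then show "measure ?Q ?sat \<le> L + e" using *[OF \<open>d > 0\<close>] by simp
  qed
qed

text \<open>The one-sided bound, applied to \<phi> and to \<open>Neg \<phi>\<close>, gives both
  inequalities.\<close>

lemma pairing_limit:
  assumes wf: "wf_formula k p \<phi>" and conv: "convergent (\<lambda>n. pairing p \<phi> (T n) (\<mu> n))"
  shows "(\<lambda>n. pairing p \<phi> (T n) (\<mu> n)) \<longlonglongrightarrow> pairing p \<phi> hat hat_measure"
proof -
  obtain L where L: "(\<lambda>n. pairing p \<phi> (T n) (\<mu> n)) \<longlonglongrightarrow> L"
    using conv by (auto simp: convergent_def)
  have "(\<lambda>n. pairing p (Neg \<phi>) (T n) (\<mu> n)) \<longlonglongrightarrow> 1 - L"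
    using tendsto_diff[OF tendsto_const L, of 1] pairing_Neg[OF prob_\<mu> space_\<mu> solutions_T[OF wf]] by simp
  then have "pairing p (Neg \<phi>) hat hat_measure \<le> 1 - L"
    using wf by (intro sat_measure_le_limit) simp_all
  moreover have "pairing p (Neg \<phi>) hat hat_measure = 1 - pairing p \<phi> hat hat_measure"
  proof (rule pairing_Neg[OF prob_hat_measure])
    have "sets (PiM {..<p} (\<lambda>_. hat_measure)) = sets (PiM {..<p} (\<lambda>_. hat_space))"
      by (intro sets_PiM_cong) (auto simp: hat_measure_def)
    then show "solutions p \<phi> hat \<in> sets (PiM {..<p} (\<lambda>_. hat_measure))"
      using measurable_solutions_hat[OF wf] by simp
  qed (simp add: hat_measure_def hat_def)
  ultimately have "pairing p \<phi> hat hat_measure = L"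
    using sat_measure_le_limit[OF wf L] by simp
  then show ?thesis using L by simp
qed

lemma ex_real_limit:
  obtains S :: "real colored_structure" and \<nu> where "borel_weighted_tree_semilattice k S \<nu>"
    "\<And>p \<phi>. wf_formula k p \<phi> \<Longrightarrow> pairing p \<phi> S \<nu> = pairing p \<phi> hat hat_measure"
proof -
  obtain f :: "point \<Rightarrow> real" where f: "inj f" using ex_inj_point by blast
  have sets: "sets hat_measure = sets (vimage_algebra (domain_of hat) emb borel)"
    by (simp add: hat_measure_def hat_space_def hat_def)
  have sets': "sets hat_measure = sets hat_space" by (simp add: hat_measure_def)
  have meet: "(\<lambda>(x, y). meet hat x y) \<in> measurable (hat_measure \<Otimes>\<^sub>M hat_measure) hat_measure"
    unfolding measurable_cong_sets[OF sets_pair_measure_cong[OF sets' sets'] sets']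
    using measurable_meet by (simp add: hat_def)
  have "space hat_measure = domain_of hat" "inj_on emb (domain_of hat)" "closed (emb ` domain_of hat)"
    "\<forall>i<k. color hat i \<in> sets hat_measure" "inj_on f (domain_of hat)"
    using inj_emb closed_emb measurable_color inj_on_subset[OF f subset_UNIV]
    by (simp_all add: hat_measure_def hat_def)
  then show ?thesis
    using ex_real_copy[OF colored_hat _ sets _ _ meet _ prob_hat_measure] that by blast
qed

end

theorem theorem5p3:
  fixes k :: nat
    and T :: "nat \<Rightarrow> 'a colored_structure"
    and \<mu> :: "nat \<Rightarrow> 'a measure"
  assumes "\<And>n. finite_weighted_tree_semilattice k (T n) (\<mu> n)"
    and "QF_convergent k T \<mu>"
  shows "\<exists>(T_hat :: real colored_structure) (\<mu>_hat :: real measure).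
           borel_weighted_tree_semilattice k T_hat \<mu>_hat \<and> QF_limit k T \<mu> T_hat \<mu>_hat"
proof -
  have fin: "tree_semilattice (domain_of (T n)) (meet (T n))" "finite (domain_of (T n))"
    "prob_space (\<mu> n)" "space (\<mu> n) = domain_of (T n)" "sets (\<mu> n) = Pow (domain_of (T n))" for n
    using assms(1)[of n] by (auto simp: finite_weighted_tree_semilattice_def colored_tree_semilattice_def)
  have sets_eq: "sets (\<mu> n) = Pow (space (\<mu> n))" for n
    by (simp add: fin)
  have "\<forall>n. \<exists>y :: nat \<Rightarrow> 'a. range y \<subseteq> domain_of (T n) \<and>
    (\<forall>j. \<forall>x\<in>domain_of (T n). measure (\<mu> n) {x'\<in>domain_of (T n).
       \<not> separated (meet (T n)) ((\<lambda>i. y (prod_encode (j, i))) ` {..<j+2}) x x'} \<le> 1 / (j + 1))"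
    using ex_separator_sequence[OF fin] by blast
  from choice[OF this] obtain y where y: "\<And>n. range (y n) \<subseteq> domain_of (T n)"
    and y_sep: "\<And>n j x. x \<in> domain_of (T n) \<Longrightarrow> measure (\<mu> n) {x'\<in>domain_of (T n).
       \<not> separated (meet (T n)) ((\<lambda>i. y n (prod_encode (j, i))) ` {..<j+2}) x x'} \<le> 1 / (j + 1)"
    by blast
  obtain r \<rho> where r: "strict_mono r" and \<rho>: "prob_space \<rho>"
    "sets \<rho> = sets (PiM UNIV (\<lambda>_ :: bit. count_space UNIV))"
    and lim: "\<And>F s. finite F \<Longrightarrow> (\<lambda>n. measure (\<mu> (r n)) {x \<in> space (\<mu> (r n)).
        \<forall>b\<in>F. holds (T (r n)) (y (r n)) x b = s b})
       \<longlonglongrightarrow> measure \<rho> {q \<in> space \<rho>. \<forall>b\<in>F. q b = s b}"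
    by (rule ex_limit_bit_distribution[where M = \<mu>, OF fin(3) sets_eq, where b = "\<lambda>n. holds (T n) (y n)"]) blast
  have space_\<rho>: "space \<rho> = UNIV"
    using sets_eq_imp_space_eq[OF \<rho>(2)] by (simp add: space_PiM)
  interpret type_limit k "\<lambda>n. T (r n)" "\<lambda>n. \<mu> (r n)" "\<lambda>n. y (r n)" \<rho>
  proof (rule type_limit.intro)
    fix e :: real assume "e > 0"
    then obtain j :: nat where j: "1 / (j + 1) < e"
      using reals_Archimedean by (auto simp: inverse_eq_divide add.commute)
    \<comment> \<open>The variables that name the separators of precision \<open>j\<close>.\<close>
    define F where "F = (\<lambda>i. Var (prod_encode (j, i))) ` {..<j+2}"
    have "eval_term (T (r n)) (y (r n)) ` F = (\<lambda>i. y (r n) (prod_encode (j, i))) ` {..<j+2}" for n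
      by (simp add: F_def image_image)
    then have "measure (\<mu> (r n)) {x'\<in>domain_of (T (r n)).
        \<not> separated (meet (T (r n))) (eval_term (T (r n)) (y (r n)) ` F) x x'} \<le> e"
      if "x \<in> domain_of (T (r n))" for n x
      using y_sep[OF that, of j] j by (simp add: add.commute)
    then show "\<exists>F. finite F \<and> (\<forall>n. \<forall>x\<in>domain_of (T (r n)). measure (\<mu> (r n)) {x'\<in>domain_of (T (r n)).
        \<not> separated (meet (T (r n))) (eval_term (T (r n)) (y (r n)) ` F) x x'} \<le> e)"
      by (intro exI[of _ F]) (auto simp: F_def)
  next
    show "y (r n) i \<in> domain_of (T (r n))" for n i
      using y by blast
    show "(\<lambda>n. measure (\<mu> (r n)) {x \<in> domain_of (T (r n)). \<forall>b\<in>F. holds (T (r n)) (y (r n)) x b = s b})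
        \<longlonglongrightarrow> measure \<rho> {q. \<forall>b\<in>F. q b = s b}" if "finite F" for F s
      using lim[OF that, of s] by (simp add: fin(4) space_\<rho>)
  qed (rule assms(1) \<rho>)+
  obtain S :: "real colored_structure" and \<nu> where S: "borel_weighted_tree_semilattice k S \<nu>"
    "\<And>p \<phi>. wf_formula k p \<phi> \<Longrightarrow> pairing p \<phi> S \<nu> = pairing p \<phi> hat hat_measure"
    by (rule ex_real_limit) blast
  have "(\<lambda>n. pairing p \<phi> (T n) (\<mu> n)) \<longlonglongrightarrow> pairing p \<phi> S \<nu>" if wf: "wf_formula k p \<phi>" for p \<phi>
  proof -
    obtain L where L: "(\<lambda>n. pairing p \<phi> (T n) (\<mu> n)) \<longlonglongrightarrow> L"
      using assms(2) wf by (auto simp: QF_convergent_def convergent_def)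
    then have sub: "(\<lambda>n. pairing p \<phi> (T (r n)) (\<mu> (r n))) \<longlonglongrightarrow> L"
      using LIMSEQ_subseq_LIMSEQ[OF _ r] by (fastforce simp: o_def)
    then have "(\<lambda>n. pairing p \<phi> (T (r n)) (\<mu> (r n))) \<longlonglongrightarrow> pairing p \<phi> hat hat_measure"
      by (intro pairing_limit[OF wf]) (auto simp: convergent_def)
    then show ?thesis using L LIMSEQ_unique[OF sub] S(2)[OF wf] by simp
  qed
  then show ?thesis using S(1) by (auto simp: QF_limit_def)
qed

end
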